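(* The hyperfans $\{\psi_A: A\in\mathrm{PSL}_2(\mathbb Z)\}$ span $ppsl_2$; a complete set of (finite linear) relations on them is given by the USA identities $$\Psi_A=\{c(d+b)+a(d-b)\}\,h+(d^2-b^2+2bd)\,e+(a^2-c^2-2ac)\,f$$ as $A=\begin{pmatrix}a&b\\c&d\end{pmatrix}$ varies over $\mathrm{PSL}_2(\mathbb Z)$, where $$\Psi_A=\psi_{STA}-2\psi_{SA}+\psi_{ST^{-1}A}-\{\psi_{UA}-2\psi_A+\psi_{U^{-1}A}\};$$ and $\{\psi_A: A\in\mathcal O\}$ provides a basis for $ppsl_2$.
   Context: $sl_2=sl_2(\mathbb R)$ has basis $e=\begin{pmatrix}0&1\\0&0\end{pmatrix}$, $f=\begin{pmatrix}0&0\\1&0\end{pmatrix}$, $h=\begin{pmatrix}1&0\\0&-1\end{pmatrix}$. The matrix $\begin{pmatrix}\alpha&\beta\\ \gamma&-\alpha\end{pmatrix}$ is identified with the vector field $\{(\gamma+\beta)\cos\theta+2\alpha\sin\theta+(\gamma-\beta)\}\frac{\partial}{\partial\theta}$ on $\mathbb S^1$. The circle $\mathbb S^1$ is identified with $\hat{\mathbb R}=\mathbb R\cup\{\infty\}$ via $s\mapsto\frac{s-i}{s+i}$ (so $0\mapsto-1$, $\infty\mapsto 1$, $1\mapsto -i$, $-1\mapsto i$), and the image of $\hat{\mathbb Q}=\mathbb Q\cup\{\infty\}$ is the set of rational points. $ppsl_2$ is the real vector space (Lie algebra under the piecewise $sl_2$-bracket) of piecewise $sl_2$ vector fields on $\mathbb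 S^1$: those given on each of finitely many open arcs with rational endpoints covering $\mathbb S^1$ up to these endpoints by an element of $sl_2$. Equivalently, it consists of piecewise constant $sl_2$-valued functions on $\mathbb S^1$ with finitely many rational breakpoints, up to values at breakpoints; $sl_2\subseteq ppsl_2$ as the constant ones. $\mathrm{PSL}_2(\mathbb Z)$ acts on the right on $\mathbb S^1=\hat{\mathbb R}$ by $x.A=\frac{dx-b}{-cx+a}$ for $A=\begin{pmatrix}a&b\\c&d\end{pmatrix}$. Put $$S=\begin{pmatrix}0&-1\\1&0\end{pmatrix},\quad T=\begin{pmatrix}1&1\\0&1\end{pmatrix},\quad U=\begin{pmatrix}1&0\\1&1\end{pmatrix}.$$ The (unnormalized) hyperfan $\psi_I\in ppsl_2$ takes the value $e$ on quadrants I and II (upper half circle) and $0$ on quadrants III and IV, and $\psi_A\in ppsl_2$ for $A\in\mathrm{PSL}_2(\mathbb Z)$ is defined by $\psi_A(\theta.A)=A^{-1}\psi_I(\theta)A$. Thus $\psi_A$ takes the constant value $A^{-1}eA$ on the arc to the left of the oriented geodesic $e_A$ from $-\frac ba$ to $-\frac dc$, and vanishes on the complementary arc. In the USA identities the elements $e,f,h$ are themselves combinations of hyperfans: $h=\Psi_I-\frac13\Psi_T-\frac13\Psi_{U^{-1}}$, $e=\frac23\Psi_T-\frac13\Psi_{U^{-1}}$, $f=-\frac13\Psi_T+\frac23\Psi_{U^{-1}}$. The Farey tesselation $\tau_*$ is the set of geodesics underlying the $e_A$, $A\in\mathrm{PSL}_2(\mathbb Z)$, and $A\mapsto e_A$ is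 a bijection from $\mathrm{PSL}_2(\mathbb Z)$ to the set of oriented edges of $\tau_*$. A point of $\hat{\mathbb Q}$ has generation $g$ if the radial arc in the disk from the origin to it meets the interiors of exactly $g$ triangles complementary to $\tau_*$. $\mathcal O$ is the set of $A\in\mathrm{PSL}_2(\mathbb Z)$ such that $e_A$ is either the edge oriented from $\frac01$ to $\frac10$, or else an edge oriented from its endpoint of lower generation to its endpoint of higher generation (one orientation for each edge of $\tau_*$).
   Formalization: The basis claim is false as printed: no nonzero constant (e.g. e) lies in the span of the ψ_A, A∈O. Proved instead: these ψ_A are distinct and linearly independent, and ppsl_2 is the direct sum of their span and sl_2, i.e. they give a basis of ppsl_2 modulo sl_2. *)

theory Defs
  imports "HOL-Analysis.Analysis" "HOL-Library.Poly_Mapping"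
begin

section \<open>The Lie algebra \<open>sl\<^sub>2(\<real>)\<close> and the group \<open>PSL\<^sub>2(\<int>)\<close>\<close>

definition mat2 :: "'a::zero \<Rightarrow> 'a \<Rightarrow> 'a \<Rightarrow> 'a \<Rightarrow> 'a^2^2" where
  "mat2 a b c d = vector [vector [a, b], vector [c, d]]"

lemma mat2_nth [simp]:
  "mat2 a b c d $ 1 $ 1 = a" "mat2 a b c d $ 1 $ 2 = b"
  "mat2 a b c d $ 2 $ 1 = c" "mat2 a b c d $ 2 $ 2 = d"
  by (simp_all add: mat2_def)

lemma matrix2_eq_iff:
  "(A::'a^2^2) = B \<longleftrightarrow> A$1$1 = B$1$1 \<and> A$1$2 = B$1$2 \<and> A$2$1 = B$2$1 \<and> A$2$2 = B$2$2"
  by (auto simp: vec_eq_iff forall_2)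

lemma matrix2_mult_nth:
  "((A::'a::semiring_1^2^2) ** B) $ i $ j = A$i$1 * B$1$j + A$i$2 * B$2$j"
  by (simp add: matrix_matrix_mult_def sum_2)

definition sl2 :: "(real^2^2) set" where
  "sl2 = {X. trace X = 0}"

definition mat_e :: "real^2^2" where "mat_e = mat2 0 1 0 0"
definition mat_f :: "real^2^2" where "mat_f = mat2 0 0 1 0"
definition mat_h :: "real^2^2" where "mat_h = mat2 1 0 0 (-1)"

lemma sl2_iff: "X \<in> sl2 \<longleftrightarrow> X$1$1 + X$2$2 = 0"
  by (simp add: sl2_def trace_def sum_2)

lemma sl2_mats [simp]: "mat_e \<in> sl2" "mat_f \<in> sl2" "mat_h \<in> sl2" "0 \<in> sl2"
  by (simp_all add: sl2_iff mat_e_def mat_f_def mat_h_def)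

definition adj2 :: "int^2^2 \<Rightarrow> int^2^2" where
  "adj2 A = mat2 (A$2$2) (- A$1$2) (- A$2$1) (A$1$1)"

lemma det_mat2 [simp]: "det (mat2 a b c d) = a * d - b * (c::int)"
  by (simp add: det_2)

quotient_type psl2z = "int^2^2" / partial: "\<lambda>A B. det A = 1 \<and> (B = A \<or> B = - A)"
proof (rule part_equivpI)
  show "\<exists>x::int^2^2. det x = 1 \<and> (x = x \<or> x = - x)"
    by (rule exI[of _ "mat 1"]) simp
  show "symp (\<lambda>A B::int^2^2. det A = 1 \<and> (B = A \<or> B = - A))"
    by (rule sympI) (auto simp: det_2)
  show "transp (\<lambda>A B::int^2^2. det A = 1 \<and> (B = A \<or> B = - A))"
    by (rule transpI) auto
qed

instantiation psl2z :: "{monoid_mult, inverse}"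
begin

lift_definition one_psl2z :: psl2z is "mat 1" by simp

lift_definition times_psl2z :: "psl2z \<Rightarrow> psl2z \<Rightarrow> psl2z" is "(**)"
  by (auto simp: det_mul matrix2_eq_iff matrix2_mult_nth)

lift_definition inverse_psl2z :: "psl2z \<Rightarrow> psl2z" is adj2
  by (auto simp: adj2_def det_2 matrix2_eq_iff algebra_simps)

definition divide_psl2z :: "psl2z \<Rightarrow> psl2z \<Rightarrow> psl2z" where
  "divide_psl2z A B = A * inverse B"

instance
  by standard (transfer, auto simp: matrix_mul_assoc det_mul)+

end

lemma psl2z_left_inverse: "inverse A * A = (1::psl2z)"
  by transfer (auto simp: adj2_def det_2 matrix2_eq_iff matrix2_mult_nth mat_def algebra_simps)

lemma psl2z_right_inverse: "A * inverse A = (1::psl2z)"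
  by transfer (auto simp: adj2_def det_2 matrix2_eq_iff matrix2_mult_nth mat_def algebra_simps)

lemma psl2z_inverse_inverse: "inverse (inverse A) = (A::psl2z)"
  by transfer (auto simp: adj2_def det_2 matrix2_eq_iff algebra_simps)

(* The class of the matrix with rows (a, b), (c, d); meaningful only for a * d - b * c = 1. *)
lift_definition psl :: "int \<Rightarrow> int \<Rightarrow> int \<Rightarrow> int \<Rightarrow> psl2z"
  is "\<lambda>a b c d. if a * d - b * c = 1 then mat2 a b c d else mat 1"
  by auto

definition S_psl :: psl2z where "S_psl = psl 0 (-1) 1 0"
definition T_psl :: psl2z where "T_psl = psl 1 1 0 1"
definition U_psl :: psl2z where "U_psl = psl 1 0 1 1"

section \<open>The circle and the right action of \<open>PSL\<^sub>2(\<int>)\<close>\<close>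

(* None is the point at infinity. *)
type_synonym rhat = "real option"

definition cay :: "rhat \<Rightarrow> complex" where
  "cay x = (case x of None \<Rightarrow> 1 | Some s \<Rightarrow> (of_real s - \<i>) / (of_real s + \<i>))"

definition qhat :: "rhat set" where
  "qhat = insert None (Some ` \<rat>)"

(* x.A = (d x - b) / (- c x + a) *)
definition mob :: "rhat \<Rightarrow> int^2^2 \<Rightarrow> rhat" where
  "mob x A = (case x of
      None \<Rightarrow> if A$2$1 = 0 then None else Some (- of_int (A$2$2) / of_int (A$2$1))
    | Some s \<Rightarrow> if - of_int (A$2$1) * s + of_int (A$1$1) = 0 then None
        else Some ((of_int (A$2$2) * s - of_int (A$1$2)) / (- of_int (A$2$1) * s + of_int (A$1$1))))"

lift_definition psl_act :: "rhat \<Rightarrow> psl2z \<Rightarrow> rhat" is mob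
proof -
  fix x and A B :: "int^2^2"
  assume "det A = 1 \<and> (B = A \<or> B = - A)"
  moreover have "mob x (- A) = mob x A"
  proof (cases x)
    case (Some s)
    define p q where "p = of_int (A$2$2) * s - of_int (A$1$2)"
      and "q = - of_int (A$2$1) * s + of_int (A$1$1)"
    have "of_int ((- A)$2$2) * s - of_int ((- A)$1$2) = - p"
      "- of_int ((- A)$2$1) * s + of_int ((- A)$1$1) = - q"
      by (simp_all add: p_def q_def)
    then show ?thesis
      unfolding mob_def Some option.case p_def[symmetric] q_def[symmetric] by simp
  qed (simp add: mob_def)
  ultimately show "mob x A = mob x B" by auto
qed

(* The adjoint action: the value A^{-1} X A. *)
lift_definition psl_conj :: "psl2z \<Rightarrow> real^2^2 \<Rightarrow> real^2^2"
  is "\<lambda>A X. map_matrix of_int (adj2 A) ** X ** map_matrix of_int A"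
  by (auto simp: fun_eq_iff adj2_def matrix2_eq_iff matrix2_mult_nth algebra_simps)

lemma mob_adj2:
  assumes "det A = 1"
  shows "mob (mob x A) (adj2 A) = x"
proof -
  define a b c d where abcd: "a = real_of_int (A$1$1)" "b = real_of_int (A$1$2)"
    "c = real_of_int (A$2$1)" "d = real_of_int (A$2$2)"
  have "real_of_int (A$1$1 * A$2$2 - A$1$2 * A$2$1) = 1"
    using assms by (simp only: det_2 of_int_1)
  then have dt: "a * d - b * c = 1" by (simp add: abcd)
  have z: "A$2$1 = 0 \<longleftrightarrow> c = 0" by (simp add: abcd)
  show ?thesis
  proof (cases x)
    case None
    show ?thesis
    proof (cases "c = 0")
      case True
      then show ?thesis using None z by (simp add: mob_def adj2_def)
    next
      case False
      then have "c * (- d / c) + d = 0" by simp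
      then show ?thesis using None z False by (simp add: mob_def adj2_def abcd[symmetric])
    qed
  next
    case (Some s)
    show ?thesis
    proof (cases "- c * s + a = 0")
      case True
      then have "a = c * s" by simp
      with dt have nz: "c \<noteq> 0" by auto
      then have "a / c = s" using \<open>a = c * s\<close> by simp
      then show ?thesis using Some z True nz by (simp add: mob_def adj2_def abcd[symmetric])
    next
      case False
      define y where "y = (d * s - b) / (- c * s + a)"
      have y: "y * (- c * s + a) = d * s - b" using False by (simp add: y_def)
      have "(c * y + d) * (- c * s + a) = c * (y * (- c * s + a)) + d * (- c * s + a)"
        by (simp add: algebra_simps)
      also have "\<dots> = 1" unfolding y using dt by (simp add: algebra_simps)
      finally have 1: "(c * y + d) * (- c * s + a) = 1" .
      then have nz: "c * y + d \<noteq> 0" by auto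
      have "(a * y + b) * (- c * s + a) = a * (y * (- c * s + a)) + b * (- c * s + a)"
        by (simp add: algebra_simps)
      also have "\<dots> = s * (a * d - b * c)" unfolding y by (simp add: algebra_simps)
      finally have "(a * y + b) * (- c * s + a) = s * ((c * y + d) * (- c * s + a))"
        using dt 1 by simp
      then have "a * y + b = s * (c * y + d)" using False by simp
      then have "(a * y + b) / (c * y + d) = s" using nz by simp
      moreover have "mob x A = Some y"
        using Some False by (simp add: mob_def y_def abcd[symmetric])
      ultimately show ?thesis
        using Some nz by (simp add: mob_def adj2_def abcd[symmetric])
    qed
  qed
qed

lemma psl_act_inverse: "psl_act (psl_act x A) (inverse A) = x"
  by transfer (simp add: mob_adj2)

lemma psl_act_inverse': "psl_act (psl_act x (inverse A)) A = x"
  using psl_act_inverse[of x "inverse A"] by (simp add: psl2z_inverse_inverse)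

lemma real_plus_ii_nz [simp]: "complex_of_real s + \<i> \<noteq> 0"
  by (simp add: complex_eq_iff)

lemma real_comb_nz:
  assumes "(p::real) \<noteq> 0 \<or> q \<noteq> 0"
  shows "complex_of_real p + \<i> * of_real q \<noteq> 0"
  using assms by (auto simp: complex_eq_iff)

lemma cay_mob:
  fixes A :: "int^2^2"
  assumes "det A = 1"
  defines "P \<equiv> \<lambda>z. of_int (A$2$2) * \<i> * (1 + z) - of_int (A$1$2) * (1 - z)"
    and "Q \<equiv> \<lambda>z. - of_int (A$2$1) * \<i> * (1 + z) + of_int (A$1$1) * (1 - z)"
  shows "P (cay x) + \<i> * Q (cay x) \<noteq> 0"
    and "cay (mob x A) = (P (cay x) - \<i> * Q (cay x)) / (P (cay x) + \<i> * Q (cay x))"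
proof -
  define a b c d where abcd: "a = real_of_int (A$1$1)" "b = real_of_int (A$1$2)"
    "c = real_of_int (A$2$1)" "d = real_of_int (A$2$2)"
  have "real_of_int (A$1$1 * A$2$2 - A$1$2 * A$2$1) = 1"
    using assms(1) by (simp only: det_2 of_int_1)
  then have dt: "a * d - b * c = 1" by (simp add: abcd)
  have z: "A$2$1 = 0 \<longleftrightarrow> c = 0" by (simp add: abcd)
  have cz: "of_int (A$1$1) = complex_of_real a" "of_int (A$1$2) = complex_of_real b"
    "of_int (A$2$1) = complex_of_real c" "of_int (A$2$2) = complex_of_real d"
    by (simp_all add: abcd)
  obtain p q k where pq: "p \<noteq> 0 \<or> q \<noteq> 0" and k: "k \<noteq> 0"
    and P: "P (cay x) = k * complex_of_real p" and Q: "Q (cay x) = k * complex_of_real q"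
    and m: "mob x A = (if q = 0 then None else Some (p / q))"
  proof (cases x)
    case None
    show ?thesis
    proof (rule that[of d "-c" "2 * \<i>"])
      show "d \<noteq> 0 \<or> - c \<noteq> 0" using dt by auto
    qed (use None z in \<open>auto simp: P_def Q_def cay_def cz mob_def abcd[symmetric]\<close>)
  next
    case (Some s)
    show ?thesis
    proof (rule that[of "d * s - b" "- c * s + a" "2 * \<i> / (of_real s + \<i>)"])
      show "d * s - b \<noteq> 0 \<or> - c * s + a \<noteq> 0"
      proof (rule ccontr)
        assume "\<not> ?thesis"
        then have "b = d * s" "a = c * s" by auto
        with dt show False by (simp add: algebra_simps)
      qed
      show "2 * \<i> / (complex_of_real s + \<i>) \<noteq> 0" by simp
      have 1: "1 + cay x = 2 * of_real s / (of_real s + \<i>)"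
        and 2: "1 - cay x = 2 * \<i> / (of_real s + \<i>)"
        using Some by (simp_all add: cay_def add_divide_eq_iff divide_simps)
      show "P (cay x) = 2 * \<i> / (of_real s + \<i>) * complex_of_real (d * s - b)"
        unfolding P_def 1 2 cz by (simp add: diff_divide_distrib[symmetric] algebra_simps)
      show "Q (cay x) = 2 * \<i> / (of_real s + \<i>) * complex_of_real (- c * s + a)"
        unfolding Q_def 1 2 cz
        by (simp add: add_divide_distrib[symmetric] diff_divide_distrib[symmetric] algebra_simps)
      show "mob x A = (if - c * s + a = 0 then None else Some ((d * s - b) / (- c * s + a)))"
        using Some by (simp add: mob_def abcd[symmetric])
    qed
  qed
  have PQ: "P (cay x) + \<i> * Q (cay x) = k * (of_real p + \<i> * of_real q)"
    "P (cay x) - \<i> * Q (cay x) = k * (of_real p - \<i> * of_real q)"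
    by (simp_all add: P Q algebra_simps)
  have nz: "complex_of_real p + \<i> * of_real q \<noteq> 0" by (rule real_comb_nz[OF pq])
  show "P (cay x) + \<i> * Q (cay x) \<noteq> 0" unfolding PQ using k nz by simp
  show "cay (mob x A) = (P (cay x) - \<i> * Q (cay x)) / (P (cay x) + \<i> * Q (cay x))"
  proof (cases "q = 0")
    case True
    then show ?thesis unfolding PQ m using k pq by (simp add: cay_def)
  next
    case False
    have "(complex_of_real p / of_real q - \<i>) / (of_real p / of_real q + \<i>)
        = (of_real p - \<i> * of_real q) / (of_real p + \<i> * of_real q)"
      using False nz real_plus_ii_nz[of "p / q"] by (simp add: frac_eq_eq) (simp add: field_simps)
    then show ?thesis unfolding PQ m using k False by (simp add: cay_def)
  qed
qed

lemma connected_psl_act: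
  assumes "connected (cay ` C)"
  shows "connected (cay ` (\<lambda>x. psl_act x A) ` C)"
  using assms
proof (transfer fixing: C)
  fix A :: "int^2^2"
  assume C: "connected (cay ` C)"
  assume A: "det A = 1 \<and> (A = A \<or> A = - A)"
  define P where "P = (\<lambda>z. of_int (A$2$2) * \<i> * (1 + z) - of_int (A$1$2) * (1 - z))"
  define Q where "Q = (\<lambda>z. - of_int (A$2$1) * \<i> * (1 + z) + of_int (A$1$1) * (1 - z))"
  have cm: "P (cay x) + \<i> * Q (cay x) \<noteq> 0"
    "cay (mob x A) = (P (cay x) - \<i> * Q (cay x)) / (P (cay x) + \<i> * Q (cay x))" for x
    using cay_mob[of A x] A unfolding P_def Q_def by blast+
  have "continuous_on (cay ` C) (\<lambda>z. (P z - \<i> * Q z) / (P z + \<i> * Q z))"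
  proof (rule continuous_on_divide)
    show "continuous_on (cay ` C) (\<lambda>z. P z - \<i> * Q z)"
      "continuous_on (cay ` C) (\<lambda>z. P z + \<i> * Q z)"
      unfolding P_def Q_def by (intro continuous_intros)+
    show "\<forall>z\<in>cay ` C. P z + \<i> * Q z \<noteq> 0" using cm(1) by auto
  qed
  then have "connected ((\<lambda>z. (P z - \<i> * Q z) / (P z + \<i> * Q z)) ` cay ` C)"
    using C by (rule connected_continuous_image)
  also have "(\<lambda>z. (P z - \<i> * Q z) / (P z + \<i> * Q z)) ` cay ` C = cay ` (\<lambda>x. mob x A) ` C"
    by (simp add: image_image cm(2))
  finally show "connected (cay ` (\<lambda>x. mob x A) ` C)" .
qed

section \<open>Piecewise constant \<open>sl\<^sub>2\<close>-valued functions\<close>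

(* The components of the circle minus a finite set are the open arcs between its points, so
   being constant on connected sets missing B is being constant on each of these arcs. *)
definition piecewise_sl2 :: "(rhat \<Rightarrow> real^2^2) \<Rightarrow> bool" where
  "piecewise_sl2 F \<longleftrightarrow> range F \<subseteq> sl2 \<and>
     (\<exists>B. finite B \<and> B \<subseteq> qhat \<and>
       (\<forall>C. connected (cay ` C) \<and> C \<inter> B = {} \<longrightarrow> F constant_on C))"

lemma piecewise_const: "X \<in> sl2 \<Longrightarrow> piecewise_sl2 (\<lambda>_. X)"
  unfolding piecewise_sl2_def constant_on_def by (auto intro!: exI[of _ "{}"])

lemma piecewise_scaleR:
  assumes "piecewise_sl2 F" shows "piecewise_sl2 (\<lambda>x. r *\<^sub>R F x)"
proof -
  obtain B where B: "finite B" "B \<subseteq> qhat"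
      "\<And>C. connected (cay ` C) \<Longrightarrow> C \<inter> B = {} \<Longrightarrow> F constant_on C"
    using assms unfolding piecewise_sl2_def by metis
  have "(\<lambda>x. r *\<^sub>R F x) constant_on C" if "connected (cay ` C)" "C \<inter> B = {}" for C
    using B(3)[OF that] unfolding constant_on_def by metis
  moreover have "r *\<^sub>R F x \<in> sl2" for x
  proof -
    have "F x \<in> sl2" using assms unfolding piecewise_sl2_def by auto
    then show ?thesis by (simp add: sl2_iff flip: distrib_left)
  qed
  ultimately show ?thesis
    unfolding piecewise_sl2_def using B(1,2) by blast
qed

lemma piecewise_add:
  assumes "piecewise_sl2 F" "piecewise_sl2 G" shows "piecewise_sl2 (\<lambda>x. F x + G x)"
proof -
  obtain B B' where B: "finite B" "B \<subseteq> qhat"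
      "\<And>C. connected (cay ` C) \<Longrightarrow> C \<inter> B = {} \<Longrightarrow> F constant_on C"
    and B': "finite B'" "B' \<subseteq> qhat"
      "\<And>C. connected (cay ` C) \<Longrightarrow> C \<inter> B' = {} \<Longrightarrow> G constant_on C"
    using assms unfolding piecewise_sl2_def by metis
  have "(\<lambda>x. F x + G x) constant_on C" if "connected (cay ` C)" "C \<inter> (B \<union> B') = {}" for C
  proof -
    have "F constant_on C" "G constant_on C" using that B(3) B'(3) by blast+
    then show ?thesis unfolding constant_on_def by metis
  qed
  moreover have "F x + G x \<in> sl2" for x
  proof -
    have "F x \<in> sl2" "G x \<in> sl2" using assms unfolding piecewise_sl2_def by auto
    then show ?thesis unfolding sl2_iff vector_add_component by linarith
  qed
  ultimately show ?thesis
    unfolding piecewise_sl2_def using B(1,2) B'(1,2) by (intro conjI exI[of _ "B \<union> B'"]) auto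
qed

lemma piecewise_uminus:
  assumes "piecewise_sl2 F" shows "piecewise_sl2 (\<lambda>x. - F x)"
  using piecewise_scaleR[OF assms, of "-1"] by simp

quotient_type ppsl2 = "rhat \<Rightarrow> real^2^2" / partial:
  "\<lambda>F G. piecewise_sl2 F \<and> piecewise_sl2 G \<and> finite {x. F x \<noteq> G x}"
proof (rule part_equivpI)
  show "\<exists>F. piecewise_sl2 F \<and> piecewise_sl2 F \<and> finite {x. F x \<noteq> F x}"
    using piecewise_const[of 0] by auto
  show "symp (\<lambda>F G. piecewise_sl2 F \<and> piecewise_sl2 G \<and> finite {x. F x \<noteq> G x})"
    by (rule sympI) (simp add: neq_commute)
  show "transp (\<lambda>F G. piecewise_sl2 F \<and> piecewise_sl2 G \<and> finite {x. F x \<noteq> G x})"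
  proof (rule transpI)
    fix F G H :: "rhat \<Rightarrow> real^2^2"
    assume "piecewise_sl2 F \<and> piecewise_sl2 G \<and> finite {x. F x \<noteq> G x}"
      and "piecewise_sl2 G \<and> piecewise_sl2 H \<and> finite {x. G x \<noteq> H x}"
    moreover from this have "finite {x. F x \<noteq> H x}"
      by (intro finite_subset[of "{x. F x \<noteq> H x}" "{x. F x \<noteq> G x} \<union> {x. G x \<noteq> H x}"]) auto
    ultimately show "piecewise_sl2 F \<and> piecewise_sl2 H \<and> finite {x. F x \<noteq> H x}" by blast
  qed
qed

instantiation ppsl2 :: real_vector
begin

lift_definition zero_ppsl2 :: ppsl2 is "\<lambda>_. 0"
  by (simp add: piecewise_const)

lift_definition plus_ppsl2 :: "ppsl2 \<Rightarrow> ppsl2 \<Rightarrow> ppsl2" is "\<lambda>F G x. F x + G x"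
proof -
  fix F F' G G' :: "rhat \<Rightarrow> real^2^2"
  assume 1: "piecewise_sl2 F \<and> piecewise_sl2 F' \<and> finite {x. F x \<noteq> F' x}"
    and 2: "piecewise_sl2 G \<and> piecewise_sl2 G' \<and> finite {x. G x \<noteq> G' x}"
  have "finite {x. F x + G x \<noteq> F' x + G' x}"
    by (rule finite_subset[of _ "{x. F x \<noteq> F' x} \<union> {x. G x \<noteq> G' x}"]) (use 1 2 in auto)
  then show "piecewise_sl2 (\<lambda>x. F x + G x) \<and> piecewise_sl2 (\<lambda>x. F' x + G' x) \<and>
      finite {x. F x + G x \<noteq> F' x + G' x}"
    using 1 2 piecewise_add by blast
qed

lift_definition uminus_ppsl2 :: "ppsl2 \<Rightarrow> ppsl2" is "\<lambda>F x. - F x"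
  by (simp add: piecewise_uminus)

lift_definition scaleR_ppsl2 :: "real \<Rightarrow> ppsl2 \<Rightarrow> ppsl2" is "\<lambda>r F x. r *\<^sub>R F x"
proof -
  fix r and F G :: "rhat \<Rightarrow> real^2^2"
  assume 1: "piecewise_sl2 F \<and> piecewise_sl2 G \<and> finite {x. F x \<noteq> G x}"
  then have "finite {x. r *\<^sub>R F x \<noteq> r *\<^sub>R G x}"
    by (intro finite_subset[of "{x. r *\<^sub>R F x \<noteq> r *\<^sub>R G x}" "{x. F x \<noteq> G x}"]) auto
  then show "piecewise_sl2 (\<lambda>x. r *\<^sub>R F x) \<and> piecewise_sl2 (\<lambda>x. r *\<^sub>R G x) \<and>
      finite {x. r *\<^sub>R F x \<noteq> r *\<^sub>R G x}"
    using 1 piecewise_scaleR by blast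
qed

definition minus_ppsl2 :: "ppsl2 \<Rightarrow> ppsl2 \<Rightarrow> ppsl2" where
  "minus_ppsl2 F G = F + - G"

instance
proof
  fix F G H :: ppsl2 and r s :: real
  show "F + G + H = F + (G + H)"
    by transfer (auto simp: add.assoc intro!: piecewise_add)
  show "F + G = G + F"
    by transfer (auto simp: add.commute intro!: piecewise_add)
  show "0 + F = F" by transfer auto
  show "- F + F = 0" by transfer (auto intro!: piecewise_const)
  show "F - G = F + - G" by (rule minus_ppsl2_def)
  show "r *\<^sub>R (F + G) = r *\<^sub>R F + r *\<^sub>R G"
    by transfer (auto simp: scaleR_add_right intro!: piecewise_add piecewise_scaleR)
  show "(r + s) *\<^sub>R F = r *\<^sub>R F + s *\<^sub>R F"
    by transfer (auto simp: scaleR_add_left intro!: piecewise_add piecewise_scaleR)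
  show "r *\<^sub>R s *\<^sub>R F = (r * s) *\<^sub>R F"
    by transfer (auto intro!: piecewise_scaleR)
  show "1 *\<^sub>R F = F" by transfer auto
qed

end

lift_definition const_pp :: "real^2^2 \<Rightarrow> ppsl2" is "\<lambda>X _. if X \<in> sl2 then X else 0"
  by (auto intro: piecewise_const)

section \<open>Hyperfans\<close>

definition psi_I :: "rhat \<Rightarrow> real^2^2" where
  "psi_I x = (if Im (cay x) > 0 then mat_e else 0)"

definition psi_fun :: "psl2z \<Rightarrow> rhat \<Rightarrow> real^2^2" where
  "psi_fun A x = psl_conj A (psi_I (psl_act x (inverse A)))"

lemma psi_fun_act: "psi_fun A (psl_act x A) = psl_conj A (psi_I x)"
  by (simp add: psi_fun_def psl_act_inverse)

lemma psl_conj_sl2: "X \<in> sl2 \<Longrightarrow> psl_conj A X \<in> sl2"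
proof (transfer fixing: X)
  fix A :: "int^2^2"
  assume X: "X \<in> sl2" and A: "det A = 1 \<and> (A = A \<or> A = - A)"
  define a b c d where abcd: "a = real_of_int (A$1$1)" "b = real_of_int (A$1$2)"
    "c = real_of_int (A$2$1)" "d = real_of_int (A$2$2)"
  have "X$2$2 = - X$1$1" using X by (simp add: sl2_iff)
  then show "map_matrix of_int (adj2 A) ** X ** map_matrix of_int A \<in> sl2"
    by (simp add: sl2_iff matrix2_mult_nth adj2_def abcd[symmetric] algebra_simps)
qed

lemma cay_Im_zero:
  assumes "Im (cay x) = 0" shows "x = None \<or> x = Some 0"
proof (cases x)
  case (Some s)
  have "cay x = of_real ((s^2 - 1) / (s^2 + 1)) - \<i> * of_real (2 * s / (s^2 + 1))"
  proof -
    have "complex_of_real (s^2 + 1) \<noteq> 0"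
      by (metis add.commute of_real_eq_0_iff sum_power2_eq_zero_iff power_one zero_neq_one)
    moreover have "complex_of_real (s^2 + 1) = (of_real s + \<i>) * (of_real s - \<i>)"
      by (simp add: algebra_simps power2_eq_square)
    ultimately show ?thesis
      using Some by (simp add: cay_def divide_simps) (simp add: algebra_simps power2_eq_square)
  qed
  then have "2 * s / (s^2 + 1) = 0" using assms by simp
  then show ?thesis using Some by (simp add: add_nonneg_eq_0_iff)
qed simp

lemma piecewise_psi_fun: "piecewise_sl2 (psi_fun A)"
proof -
  let ?B = "{psl_act None A, psl_act (Some 0) A}"
  have q: "?B \<subseteq> qhat"
    by transfer (auto simp: mob_def qhat_def)
  have "psi_fun A constant_on C" if C: "connected (cay ` C)" "C \<inter> ?B = {}" for C
  proof -
    let ?D = "(\<lambda>x. psl_act x (inverse A)) ` C"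
    have conn: "connected (Im ` cay ` ?D)"
      using connected_psl_act[OF C(1), of "inverse A"]
      by (intro connected_continuous_image continuous_intros)
    have nz: "0 \<notin> Im ` cay ` ?D"
    proof
      assume "0 \<in> Im ` cay ` ?D"
      then obtain x where x: "x \<in> C" "Im (cay (psl_act x (inverse A))) = 0" by auto
      then have "x \<in> ?B"
        using cay_Im_zero[OF x(2)] psl_act_inverse'[of x A] by auto
      with x C(2) show False by blast
    qed
    have "(\<forall>x\<in>?D. Im (cay x) > 0) \<or> (\<forall>x\<in>?D. \<not> Im (cay x) > 0)"
    proof (rule ccontr)
      assume "\<not> ?thesis"
      then obtain x y where "x \<in> ?D" "y \<in> ?D" "Im (cay x) > 0" "\<not> Im (cay y) > 0"
        by blast
      then have "0 \<in> Im ` cay ` ?D"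
        using connectedD_interval[OF conn, of "Im (cay y)" "Im (cay x)" 0] by (auto simp: image_image)
      with nz show False by simp
    qed
    then have "(\<lambda>x. psi_I (psl_act x (inverse A))) constant_on C"
      unfolding constant_on_def psi_I_def by (metis imageI)
    then show ?thesis unfolding constant_on_def psi_fun_def by metis
  qed
  moreover have "range (psi_fun A) \<subseteq> sl2"
    by (auto simp: psi_fun_def psi_I_def intro!: psl_conj_sl2)
  ultimately show ?thesis
    unfolding piecewise_sl2_def using q by (intro conjI exI[of _ ?B]) auto
qed

lift_definition psi :: "psl2z \<Rightarrow> ppsl2" is psi_fun
  by (simp add: piecewise_psi_fun)

section \<open>The USA identities\<close>

(* For g = psi this is the element Psi_A; for g = gen below it is the same combination taken
   in the free vector space on the symbols psi_A. *)
definition Psi :: "(psl2z \<Rightarrow> 'v::real_vector) \<Rightarrow> psl2z \<Rightarrow> 'v" where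
  "Psi g A = g (S_psl * T_psl * A) - 2 *\<^sub>R g (S_psl * A) + g (S_psl * inverse T_psl * A)
     - (g (U_psl * A) - 2 *\<^sub>R g A + g (inverse U_psl * A))"

definition usa_rhs :: "'v::real_vector \<Rightarrow> 'v \<Rightarrow> 'v \<Rightarrow> int \<Rightarrow> int \<Rightarrow> int \<Rightarrow> int \<Rightarrow> 'v" where
  "usa_rhs vh ve vf a b c d =
     real_of_int (c * (d + b) + a * (d - b)) *\<^sub>R vh
     + real_of_int (d^2 - b^2 + 2 * b * d) *\<^sub>R ve
     + real_of_int (a^2 - c^2 - 2 * a * c) *\<^sub>R vf"

instantiation poly_mapping :: (type, real_vector) real_vector
begin

lift_definition scaleR_poly_mapping ::
    "real \<Rightarrow> ('a \<Rightarrow>\<^sub>0 'b) \<Rightarrow> ('a \<Rightarrow>\<^sub>0 'b)" is "\<lambda>r f k. r *\<^sub>R f k"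
proof -
  fix r :: real and f :: "'a \<Rightarrow> 'b"
  assume "finite {k. f k \<noteq> 0}"
  then show "finite {k. r *\<^sub>R f k \<noteq> 0}" by (rule rev_finite_subset) auto
qed

instance
  by standard (transfer, simp add: fun_eq_iff scaleR_add_right scaleR_add_left)+

end

definition gen :: "psl2z \<Rightarrow> (psl2z \<Rightarrow>\<^sub>0 real)" where
  "gen A = Poly_Mapping.single A 1"

definition hyperfan_comb :: "(psl2z \<Rightarrow>\<^sub>0 real) \<Rightarrow> ppsl2" where
  "hyperfan_comb r = (\<Sum>A\<in>Poly_Mapping.keys r. Poly_Mapping.lookup r A *\<^sub>R psi A)"

(* The expressions of h, e, f through hyperfans, by which h, e, f are eliminated from the
   USA identities to make them linear relations among the hyperfans alone. *)
definition h_gen :: "psl2z \<Rightarrow>\<^sub>0 real" where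
  "h_gen = Psi gen 1 - (1/3) *\<^sub>R Psi gen T_psl - (1/3) *\<^sub>R Psi gen (inverse U_psl)"

definition e_gen :: "psl2z \<Rightarrow>\<^sub>0 real" where
  "e_gen = (2/3) *\<^sub>R Psi gen T_psl - (1/3) *\<^sub>R Psi gen (inverse U_psl)"

definition f_gen :: "psl2z \<Rightarrow>\<^sub>0 real" where
  "f_gen = - (1/3) *\<^sub>R Psi gen T_psl + (2/3) *\<^sub>R Psi gen (inverse U_psl)"

definition usa_relations :: "(psl2z \<Rightarrow>\<^sub>0 real) set" where
  "usa_relations = {Psi gen (psl a b c d) - usa_rhs h_gen e_gen f_gen a b c d
     | a b c d. a * d - b * c = 1}"

section \<open>The Farey tesselation and the set \<open>\<O>\<close>\<close>

(* The edge e_A runs from 0.A = -b/a to infinity.A = -d/c. *)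
definition e_init :: "psl2z \<Rightarrow> rhat" where "e_init A = psl_act (Some 0) A"
definition e_term :: "psl2z \<Rightarrow> rhat" where "e_term A = psl_act None A"

(* The geodesic of the Poincare disk with given distinct ideal endpoints: z |-> 2z/(1+|z|^2)
   is the isometry to the Klein disk, fixing the circle at infinity, in which geodesics
   are chords. *)
definition geodesic :: "rhat \<Rightarrow> rhat \<Rightarrow> complex set" where
  "geodesic x y = {z \<in> ball 0 1. (2 / (1 + (cmod z)^2)) *\<^sub>R z \<in> open_segment (cay x) (cay y)}"

definition farey_tesselation :: "complex set set" where
  "farey_tesselation = range (\<lambda>A. geodesic (e_init A) (e_term A))"

(* The components are the open triangles complementary to the tesselation. *)
definition generation :: "rhat \<Rightarrow> nat" where
  "generation x =
     card {t \<in> components (ball 0 1 - \<Union> farey_tesselation). closed_segment 0 (cay x) \<inter> t \<noteq> {}}"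

(* The hyperfans over O_set are linearly independent even modulo the constants: at a vertex
   of generation g - 1 > 0, the jumps of those of generation at most g are parabolic about
   that vertex and its two neighbours of generation g, hence independent. So they are a basis
   of a complement of sl2 in ppsl2, that is, of ppsl2 modulo sl2; they do not span the
   nonzero constants. *)
definition O_set :: "psl2z set" where
  "O_set = {A. (e_init A = Some 0 \<and> e_term A = None) \<or> generation (e_init A) < generation (e_term A)}"

end

theory Submission
  imports Defs
begin

text \<open>
Away from finitely many points an element of \<open>ppsl2\<close> is a step function on the real line with
rational breakpoints, and modulo constants it is determined by its jumps on the circle. If
\<open>A\<close> has rows \<open>p = (a, b)\<close> and \<open>q = (c, d)\<close>, the edge \<open>e\<^sub>A\<close> runs from \<open>pt a b\<close> to \<open>pt c d\<close> and the
only jumps of \<open>psi A\<close> are \<open>-N\<^sub>q\<close> and \<open>N\<^sub>q\<close>, at these two points, where \<open>N\<^sub>q = nilp c d\<close> is the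
nilpotent matrix that fixes the second one. Under \<open>sl\<^sub>2 = Sym\<^sup>2\<close> the matrix \<open>N\<^sub>q\<close> is the square of a
linear form vanishing at \<open>q\<close>, so any three of these matrices at distinct points are independent.

\<^bold>\<open>USA identities.\<close> At a generic \<open>s\<close> the six hyperfans in \<open>Psi\<^sub>A\<close> depend only on the signs of
\<open>n = a s + b\<close>, \<open>m = c s + d\<close> and \<open>n \<plusminus> m\<close>, and in each case their values add up to the same
matrix (\<open>usa_identity\<close>).

\<^bold>\<open>Spanning.\<close> On the arc cut off by an edge \<open>p q\<close> with mediant \<open>r = p + q\<close>, the function \<open>N\<^sub>r\<close> is a
difference of hyperfans of the edges \<open>p r\<close> and \<open>q r\<close>, modulo constants. As \<open>N\<^sub>p\<close>, \<open>N\<^sub>q\<close>, \<open>N\<^sub>r\<close> span \<open>sl\<^sub>2\<close>,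
all multiples of the indicator function of the arc are in the span (\<open>in_span_arc\<close>), and a Farey path
from a rational number to \<open>\<infinity>\<close> yields every rational step (\<open>in_span_step\<close>).

\<^bold>\<open>Orientations.\<close> \<open>O_set\<close> is defined by generations. By \<open>O_set_iff_height\<close> its edges are those
whose height \<open>|a| + 2 |b|\<close> increases, which is all that the algebra needs. In the Klein
model edges are chords, hence zero sets of affine forms; a radius to a point beyond an edge \<open>p q\<close>
enters exactly one more triangle before it reaches the next edge \<open>p r\<close> or \<open>q r\<close>, so the generation of
a mediant exceeds those of its two parents.

\<^bold>\<open>Relations.\<close> A vertex \<open>q\<close> other than \<open>0\<close> and \<open>\<infinity>\<close> has two parents. Modulo constants, hyperfans over \<open>O_set\<close> and hyperfans of
shorter edges, the USA identities of the two edges from the parents to \<open>q\<close> read \<open>y - 2 x = 0\<close> and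
\<open>x - 2 y = 0\<close> for the two hyperfans \<open>x\<close>, \<open>y\<close> of the reversed edges. This system is invertible, so by
induction the USA identities reduce every hyperfan to \<open>O_set\<close> and constants
(\<open>reversed_edge_reducible\<close>).

\<^bold>\<open>Independence.\<close> In a linear combination over \<open>O_set\<close> that is constant, consider a vertex \<open>q\<close> of
maximal height. If \<open>q\<close> is not \<open>\<infinity>\<close>, the jump at \<open>q\<close> shows that both edges ending at \<open>q\<close> occur, with
opposite coefficients. At the higher parent \<open>p\<close> of \<open>q\<close>, or at \<open>p = 0\<close> if \<open>q\<close> is \<open>\<infinity>\<close>, the jump only involves
\<open>N\<^sub>p\<close>, \<open>N\<^sub>q\<close> and at most one more child of \<open>p\<close>; by independence the coefficient of the edge from \<open>p\<close> to \<open>q\<close> vanishes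
(\<open>hyperfan_coefficients_vanish\<close>). Together with the reduction this determines the kernel, and it
makes \<open>O_set\<close> a basis of a complement of the constants.
\<close>

section \<open>Rows of matrices and their hyperfans\<close>

text \<open>
The row \<open>(a, b)\<close> stands for the Farey point at which the form \<open>a s + b\<close> vanishes; with this sign the
rows of a matrix give the two ends of its edge.
\<close>

definition pt :: "int \<Rightarrow> int \<Rightarrow> rhat" where
  "pt a b = (if a = 0 then None else Some (- of_int b / of_int a))"

text \<open>
This is \<open>A\<^sup>-\<^sup>1 e A\<close> for every \<open>A\<close> with second row \<open>(c, d)\<close> (lemma \<open>conj_e_psl\<close>): the value of a hyperfan depends only on
the end point of its edge.
\<close>

definition nilp :: "int \<Rightarrow> int \<Rightarrow> real^2^2" where
  "nilp c d = mat2 (of_int (c * d)) (of_int (d\<^sup>2)) (- of_int (c\<^sup>2)) (- of_int (c * d))"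

lemma psl_cases:
  obtains a b c d where "a * d - b * c = 1" "A = psl a b c d"
proof -
  have "\<exists>a b c d. a * d - b * c = 1 \<and> A = psl a b c d"
  proof (transfer)
    fix A :: "int^2^2" assume A: "det A = 1 \<and> (A = A \<or> A = - A)"
    show "\<exists>a b c d. a * d - b * c = 1 \<and> det A = 1 \<and>
        ((if a * d - b * c = 1 then mat2 a b c d else mat 1) = A \<or>
         (if a * d - b * c = 1 then mat2 a b c d else mat 1) = - A)"
      using A by (intro exI[of _ "A$1$1"] exI[of _ "A$1$2"] exI[of _ "A$2$1"] exI[of _ "A$2$2"])
        (auto simp: det_2 matrix2_eq_iff)
  qed
  then show ?thesis using that by blast
qed

lemma psl_eq_iff:
  assumes "a * d - b * c = 1" "a' * d' - b' * c' = 1"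
  shows "psl a b c d = psl a' b' c' d' \<longleftrightarrow>
    (a = a' \<and> b = b' \<and> c = c' \<and> d = d') \<or> (a = - a' \<and> b = - b' \<and> c = - c' \<and> d = - d')"
  using assms by transfer (auto simp: matrix2_eq_iff)

text \<open>
With this equation the operations on the quotient are computed on the chosen representatives, so that
no choice of signs enters the calculations.
\<close>

lemma psl_abs:
  assumes "a * d - b * c = 1"
  shows "psl a b c d = abs_psl2z (mat2 a b c d)"
  using assms by (simp add: psl_def)

lemma psl_times:
  assumes "a * d - b * c = 1" "a' * d' - b' * c' = 1"
  shows "psl a b c d * psl a' b' c' d' =
    psl (a * a' + b * c') (a * b' + b * d') (c * a' + d * c') (c * b' + d * d')"
proof -
  have "(a * a' + b * c') * (c * b' + d * d') - (a * b' + b * d') * (c * a' + d * c') =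
      (a * d - b * c) * (a' * d' - b' * c')"
    by (simp add: algebra_simps)
  then have "(a * a' + b * c') * (c * b' + d * d') - (a * b' + b * d') * (c * a' + d * c') = 1"
    using assms by simp
  moreover have "mat2 a b c d ** mat2 a' b' c' d' =
      mat2 (a * a' + b * c') (a * b' + b * d') (c * a' + d * c') (c * b' + d * d')"
    by (simp add: matrix2_eq_iff matrix2_mult_nth)
  ultimately show ?thesis
    using assms by (simp add: psl_abs times_psl2z.abs_eq)
qed

lemma psl_inverse:
  assumes "a * d - b * c = 1"
  shows "inverse (psl a b c d) = psl d (- b) (- c) a"
  using assms by (simp add: psl_abs inverse_psl2z.abs_eq adj2_def mult.commute)

lemma psl_one: "psl 1 0 0 1 = 1"
  by transfer (auto simp: matrix2_eq_iff mat_def)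

lemma psl_uminus:
  "a * d - b * c = 1 \<Longrightarrow> psl (- a) (- b) (- c) (- d) = psl a b c d"
  by (subst psl_eq_iff) auto

lemma psl_mult_generators:
  assumes "a * d - b * c = 1"
  shows "S_psl * psl a b c d = psl (- c) (- d) a b"
    "U_psl * psl a b c d = psl a b (a + c) (b + d)"
    "inverse U_psl * psl a b c d = psl a b (c - a) (d - b)"
    "S_psl * T_psl * psl a b c d = psl (- c) (- d) (a + c) (b + d)"
    "S_psl * inverse T_psl * psl a b c d = psl (- c) (- d) (a - c) (b - d)"
  using assms by (simp_all add: S_psl_def T_psl_def U_psl_def psl_inverse psl_times)

lemma Psi_psl:
  assumes "a * d - b * c = 1"
  shows "Psi g (psl a b c d) =
    g (psl (- c) (- d) (a + c) (b + d)) - 2 *\<^sub>R g (psl (- c) (- d) a b)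
      + g (psl (- c) (- d) (a - c) (b - d))
    - (g (psl a b (a + c) (b + d)) - 2 *\<^sub>R g (psl a b c d) + g (psl a b (c - a) (d - b)))"
  using assms by (simp add: Psi_def psl_mult_generators)

lemma e_init_psl:
  assumes "a * d - b * c = 1" shows "e_init (psl a b c d) = pt a b"
  using assms by (simp add: e_init_def pt_def psl_abs psl_act.abs_eq mob_def)

lemma e_term_psl:
  assumes "a * d - b * c = 1" shows "e_term (psl a b c d) = pt c d"
  using assms by (simp add: e_term_def pt_def psl_abs psl_act.abs_eq mob_def)

lemma conj_e_psl:
  assumes "a * d - b * c = 1" shows "psl_conj (psl a b c d) mat_e = nilp c d"
  using assms by (simp add: psl_abs psl_conj.abs_eq nilp_def mat_e_def matrix2_eq_iff
    matrix2_mult_nth adj2_def power2_eq_square)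

lemma nilp_sl2: "nilp c d \<in> sl2"
  by (simp add: sl2_iff nilp_def)

lemma Im_cay_Some: "Im (cay (Some s)) > 0 \<longleftrightarrow> s < 0"
proof -
  have "Im (cay (Some s)) = - 2 * s / (s\<^sup>2 + 1)"
    by (simp add: cay_def Im_divide power2_eq_square)
  moreover have "s\<^sup>2 + 1 > 0" by (simp add: add_nonneg_pos)
  ultimately show ?thesis by (simp add: zero_less_divide_iff divide_less_0_iff)
qed

text \<open>
The sign of \<open>Im (cay s)\<close> is opposite to that of \<open>s\<close>, and \<open>s.A\<^sup>-\<^sup>1\<close> is the quotient of the two factors.
The formula also holds at their zeros, which are moved to \<open>0\<close> and \<open>\<infinity>\<close>, where \<open>psi_I\<close> vanishes.
\<close>

lemma psi_fun_Some:
  assumes "a * d - b * c = 1"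
  shows "psi_fun (psl a b c d) (Some s) =
    (if (of_int a * s + of_int b) * (of_int c * s + of_int d) < 0 then nilp c d else 0)"
proof -
  let ?n = "of_int a * s + of_int b" and ?m = "of_int c * s + of_int d"
  have act: "psl_act (Some s) (inverse (psl a b c d)) = (if ?m = 0 then None else Some (?n / ?m))"
    using assms by (simp add: psl_inverse psl_abs[of d a] psl_act.abs_eq mob_def mult.commute)
  have "0 < Im (cay (psl_act (Some s) (inverse (psl a b c d)))) \<longleftrightarrow> ?n * ?m < 0"
    unfolding act by (auto simp: Im_cay_Some divide_less_0_iff mult_less_0_iff) (auto simp: cay_def)
  moreover have "psl_conj (psl a b c d) 0 = 0"
    using assms
    by (simp add: psl_abs psl_conj.abs_eq matrix2_eq_iff matrix2_mult_nth)
  ultimately show ?thesis by (simp add: psi_fun_def psi_I_def conj_e_psl[OF assms])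
qed

section \<open>Elements of \<open>ppsl2\<close> as functions on the affine line\<close>

text \<open>
Values at finitely many points are immaterial, and so is the value at \<open>\<infinity>\<close>. This relation lets
one calculate in \<open>ppsl2\<close> with ordinary functions of a real variable.
\<close>

definition represents :: "ppsl2 \<Rightarrow> (real \<Rightarrow> real^2^2) \<Rightarrow> bool" where
  "represents F f \<longleftrightarrow> finite {t. rep_ppsl2 F (Some t) \<noteq> f t}"

lemma finite_rhat:
  "finite (Some -` S :: real set) \<Longrightarrow> finite (S :: rhat set)"
proof -
  assume "finite (Some -` S :: real set)"
  then have "finite (insert None (Some ` (Some -` S)))"
    by (intro finite.insertI finite_imageI)
  moreover have "S \<subseteq> insert None (Some ` (Some -` S))"
  proof
    fix x assume "x \<in> S" then show "x \<in> insert None (Some ` (Some -` S))"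
      by (cases x) auto
  qed
  ultimately show ?thesis by (rule rev_finite_subset)
qed

lemma rep_piecewise: "piecewise_sl2 (rep_ppsl2 F)"
  using Quotient_rep_reflp[OF Quotient_ppsl2] by blast

lemma representsI:
  assumes "piecewise_sl2 g" "finite {t. g (Some t) \<noteq> f t}"
  shows "represents (abs_ppsl2 g) f"
proof -
  have "finite {x. rep_ppsl2 (abs_ppsl2 g) x \<noteq> g x}"
    using Quotient_rep_abs[OF Quotient_ppsl2, of g] assms(1) by simp
  then have "finite (Some -` {x. rep_ppsl2 (abs_ppsl2 g) x \<noteq> g x})"
    by (intro finite_vimageI) auto
  with assms(2) show ?thesis unfolding represents_def
    by (rule finite_subset[rotated, OF finite_UnI]) auto
qed

lemma represents_eq:
  assumes "represents F f" "represents G g" "finite {t. f t \<noteq> g t}"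
  shows "F = G"
proof -
  have "finite {t. rep_ppsl2 F (Some t) \<noteq> rep_ppsl2 G (Some t)}"
    using finite_UnI[OF finite_UnI[OF assms(1)[unfolded represents_def]
      assms(2)[unfolded represents_def]] assms(3)]
    by (rule rev_finite_subset) auto
  then have "finite {x. rep_ppsl2 F x \<noteq> rep_ppsl2 G x}"
    by (intro finite_rhat) (simp add: vimage_def)
  then show ?thesis
    using Quotient_rel_rep[OF Quotient_ppsl2, of F G] rep_piecewise by blast
qed

lemma represents_cong:
  assumes "represents F f" "finite {t. f t \<noteq> g t}"
  shows "represents F g"
  unfolding represents_def
  by (rule finite_subset[OF _ finite_UnI[OF assms[unfolded represents_def]]]) auto

lemma represents_add:
  assumes "represents F f" "represents G g"
  shows "represents (F + G) (\<lambda>t. f t + g t)"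
proof -
  have "F + G = abs_ppsl2 (\<lambda>x. rep_ppsl2 F x + rep_ppsl2 G x)"
    by (simp add: plus_ppsl2_def)
  moreover have "finite {t. rep_ppsl2 F (Some t) + rep_ppsl2 G (Some t) \<noteq> f t + g t}"
    by (rule finite_subset[OF _ finite_UnI[OF assms[unfolded represents_def]]]) auto
  ultimately show ?thesis
    using representsI[of "\<lambda>x. rep_ppsl2 F x + rep_ppsl2 G x"]
      piecewise_add[OF rep_piecewise rep_piecewise] by simp
qed

lemma represents_scaleR:
  assumes "represents F f"
  shows "represents (r *\<^sub>R F) (\<lambda>t. r *\<^sub>R f t)"
proof -
  have "r *\<^sub>R F = abs_ppsl2 (\<lambda>x. r *\<^sub>R rep_ppsl2 F x)"
    by (simp add: scaleR_ppsl2_def)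
  moreover have "finite {t. r *\<^sub>R rep_ppsl2 F (Some t) \<noteq> r *\<^sub>R f t}"
    by (rule finite_subset[OF _ assms[unfolded represents_def]]) auto
  ultimately show ?thesis
    using representsI[of "\<lambda>x. r *\<^sub>R rep_ppsl2 F x"] piecewise_scaleR[OF rep_piecewise] by simp
qed

lemma represents_diff:
  assumes "represents F f" "represents G g"
  shows "represents (F - G) (\<lambda>t. f t - g t)"
  using represents_add[OF assms(1) represents_scaleR[OF assms(2), of "-1"]] by simp

lemma represents_const: "X \<in> sl2 \<Longrightarrow> represents (const_pp X) (\<lambda>_. X)"
  using representsI[OF piecewise_const, of X "\<lambda>_. X"] by (simp add: const_pp_def)

lemma represents_zero: "represents 0 (\<lambda>_. 0)"
  using representsI[OF piecewise_const, of 0 "\<lambda>_. 0"] by (simp add: zero_ppsl2_def)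

lemma represents_sum:
  "(\<And>i. i \<in> I \<Longrightarrow> represents (F i) (f i)) \<Longrightarrow>
    represents (\<Sum>i\<in>I. F i) (\<lambda>t. \<Sum>i\<in>I. f i t)"
  by (induction I rule: infinite_finite_induct) (auto simp: represents_zero intro!: represents_add)

lemma represents_psi_fun: "represents (psi A) (\<lambda>s. psi_fun A (Some s))"
  using representsI[OF piecewise_psi_fun[of A], of "\<lambda>s. psi_fun A (Some s)"]
  by (simp add: psi_def)

lemma represents_psi:
  assumes "a * d - b * c = 1"
  shows "represents (psi (psl a b c d)) (\<lambda>s.
    if (of_int a * s + of_int b) * (of_int c * s + of_int d) < 0 then nilp c d else 0)"
  using represents_psi_fun[of "psl a b c d"] by (simp add: psi_fun_Some[OF assms])

lemma sl2_add: "X \<in> sl2 \<Longrightarrow> Y \<in> sl2 \<Longrightarrow> X + Y \<in> sl2"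
  by (simp add: sl2_iff)

lemma sl2_scaleR: "X \<in> sl2 \<Longrightarrow> r *\<^sub>R X \<in> sl2"
  by (simp add: sl2_iff flip: distrib_left)

lemma const_pp_add: "X \<in> sl2 \<Longrightarrow> Y \<in> sl2 \<Longrightarrow> const_pp (X + Y) = const_pp X + const_pp Y"
  by (rule represents_eq[OF represents_const[OF sl2_add]
    represents_add[OF represents_const represents_const]]) auto

lemma const_pp_scaleR: "X \<in> sl2 \<Longrightarrow> const_pp (r *\<^sub>R X) = r *\<^sub>R const_pp X"
  by (rule represents_eq[OF represents_const[OF sl2_scaleR]
    represents_scaleR[OF represents_const]]) auto

lemma const_pp_eq_iff:
  assumes "X \<in> sl2" "Y \<in> sl2" shows "const_pp X = const_pp Y \<longleftrightarrow> X = Y"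
proof
  assume "const_pp X = const_pp Y"
  then have "finite {t::real. rep_ppsl2 (const_pp X) (Some t) \<noteq> X}"
      "finite {t::real. rep_ppsl2 (const_pp X) (Some t) \<noteq> Y}"
    using represents_const[OF assms(1)] represents_const[OF assms(2)]
    unfolding represents_def by simp_all
  then have "finite ({t::real. rep_ppsl2 (const_pp X) (Some t) \<noteq> X} \<union>
      {t::real. rep_ppsl2 (const_pp X) (Some t) \<noteq> Y})" by simp
  show "X = Y"
  proof (rule ccontr)
    assume "X \<noteq> Y"
    then have "({t::real. rep_ppsl2 (const_pp X) (Some t) \<noteq> X} \<union>
      {t::real. rep_ppsl2 (const_pp X) (Some t) \<noteq> Y}) = UNIV" by auto
    then show False using \<open>finite (_ \<union> _)\<close> infinite_UNIV_char_0 by metis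
  qed
qed simp

section \<open>The USA identities\<close>

lemma mat_usa: "usa_rhs mat_h mat_e mat_f a b c d =
   mat2 (of_int (c * (d + b) + a * (d - b))) (of_int (d\<^sup>2 - b\<^sup>2 + 2 * b * d))
     (of_int (a\<^sup>2 - c\<^sup>2 - 2 * a * c)) (- of_int (c * (d + b) + a * (d - b)))"
  by (simp add: usa_rhs_def matrix2_eq_iff mat_e_def mat_f_def mat_h_def)

lemma const_pp_usa:
  "const_pp (usa_rhs mat_h mat_e mat_f a b c d) =
    usa_rhs (const_pp mat_h) (const_pp mat_e) (const_pp mat_f) a b c d"
  unfolding usa_rhs_def by (simp only: const_pp_add const_pp_scaleR sl2_add sl2_scaleR sl2_mats)

text \<open>
Write \<open>n = a s + b\<close> and \<open>m = c s + d\<close>. If \<open>n m > 0\<close>, the hyperfans contribute \<open>N\<^sub>p\<^sub>+\<^sub>q - 2 N\<^sub>p\<close>, and otherwise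
\<open>2 N\<^sub>q - N\<^sub>q\<^sub>-\<^sub>p\<close>; the remaining terms cancel. Both are equal to the right-hand side because \<open>N\<close> is
quadratic in its row.
\<close>

lemma usa_identity:
  assumes "a * d - b * c = 1"
  shows "Psi psi (psl a b c d) = usa_rhs (const_pp mat_h) (const_pp mat_e) (const_pp mat_f) a b c d"
proof -
  define hat where "hat = (\<lambda>a b c d s. if (of_int a * s + of_int b) * (of_int c * s + of_int d) < (0::real)
    then nilp c d else 0)"
  have rep: "represents (psi (psl a b c d)) (hat a b c d)" if "a * d - b * c = 1" for a b c d
    using represents_psi[OF that] by (simp add: hat_def)
  define lhs where "lhs = (\<lambda>s.
    hat (- c) (- d) (a + c) (b + d) s - 2 *\<^sub>R hat (- c) (- d) a b s
      + hat (- c) (- d) (a - c) (b - d) s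
    - (hat a b (a + c) (b + d) s - 2 *\<^sub>R hat a b c d s + hat a b (c - a) (d - b) s))"
  have "represents (Psi psi (psl a b c d)) lhs"
    unfolding Psi_psl[OF assms] lhs_def
    by (intro represents_add represents_diff represents_scaleR rep)
      (use assms in \<open>simp_all add: algebra_simps\<close>)
  moreover have "represents (const_pp (usa_rhs mat_h mat_e mat_f a b c d))
      (\<lambda>_. usa_rhs mat_h mat_e mat_f a b c d)"
    by (rule represents_const) (simp add: mat_usa sl2_iff)
  moreover have "finite {s. lhs s \<noteq> usa_rhs mat_h mat_e mat_f a b c d}"
  proof (rule finite_subset)
    define R where "R = (\<lambda>a b. {s::real. of_int a * s + of_int b = 0})"
    have R: "finite (R a b)" if "a \<noteq> 0 \<or> b \<noteq> 0" for a b
    proof (cases "a = 0")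
      case False
      then have "R a b \<subseteq> {- of_int b / of_int a}" by (auto simp: R_def field_simps)
      then show ?thesis by (rule finite_subset) simp
    qed (use that in \<open>simp add: R_def\<close>)
    let ?R = "R a b \<union> R c d \<union> R (a + c) (b + d) \<union> R (a - c) (b - d)"
    show "finite ?R"
      using assms by (intro finite_UnI R) (auto simp: algebra_simps add_eq_0_iff)
    have "lhs s = usa_rhs mat_h mat_e mat_f a b c d" if "s \<notin> ?R" for s
    proof -
      define n m where "n = of_int a * s + of_int b" and "m = of_int c * s + of_int d"
      have nz: "n \<noteq> 0" "m \<noteq> 0" "n + m \<noteq> 0" "n - m \<noteq> 0"
        using that by (auto simp: R_def n_def m_def algebra_simps)
      have nm: "of_int (- c) * s + of_int (- d) = - m"
        "of_int (a + c) * s + of_int (b + d) = n + m"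
        "of_int (a - c) * s + of_int (b - d) = n - m"
        "of_int (c - a) * s + of_int (d - b) = m - n"
        by (simp_all add: n_def m_def algebra_simps)
      have hv: "hat (- c) (- d) (a + c) (b + d) s = (if - m * (n + m) < 0 then nilp (a + c) (b + d) else 0)"
        "hat (- c) (- d) a b s = (if - m * n < 0 then nilp a b else 0)"
        "hat (- c) (- d) (a - c) (b - d) s = (if - m * (n - m) < 0 then nilp (a - c) (b - d) else 0)"
        "hat a b (a + c) (b + d) s = (if n * (n + m) < 0 then nilp (a + c) (b + d) else 0)"
        "hat a b c d s = (if n * m < 0 then nilp c d else 0)"
        "hat a b (c - a) (d - b) s = (if n * (m - n) < 0 then nilp (c - a) (d - b) else 0)"
        by (simp_all only: hat_def nm n_def[symmetric] m_def[symmetric])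
      show ?thesis
      proof (cases "n * m < 0")
        case True
        then have "(n > 0 \<and> m < 0) \<or> (n < 0 \<and> m > 0)" by (auto simp: mult_less_0_iff)
        then have "\<not> - m * n < 0" "\<not> - m * (n - m) < 0" "n * (m - n) < 0"
          "- m * (n + m) < 0 \<longleftrightarrow> n * (n + m) < 0"
          using nz by (auto simp: mult_less_0_iff zero_less_mult_iff)
        then show ?thesis using True unfolding lhs_def hv
          by (cases "n * (n + m) < 0"; simp only: if_True if_False simp_thms)
            (simp_all add: mat_usa nilp_def matrix2_eq_iff algebra_simps power2_eq_square)
      next
        case False
        then have "(n > 0 \<and> m > 0) \<or> (n < 0 \<and> m < 0)"
          using nz by (auto simp: mult_less_0_iff)
        then have "- m * n < 0" "- m * (n + m) < 0" "\<not> n * (n + m) < 0"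
          "- m * (n - m) < 0 \<longleftrightarrow> n * (m - n) < 0"
          using nz by (auto simp: mult_less_0_iff zero_less_mult_iff)
        then show ?thesis using False unfolding lhs_def hv
          by (cases "n * (m - n) < 0"; simp only: if_True if_False simp_thms)
            (simp_all add: mat_usa nilp_def matrix2_eq_iff algebra_simps power2_eq_square)
      qed
    qed
    then show "{s. lhs s \<noteq> usa_rhs mat_h mat_e mat_f a b c d} \<subseteq> ?R" by blast
  qed
  ultimately have "Psi psi (psl a b c d) = const_pp (usa_rhs mat_h mat_e mat_f a b c d)"
    by (rule represents_eq)
  then show ?thesis by (simp add: const_pp_usa)
qed

lemma Psi_one_T_U:
  "Psi psi 1 = const_pp mat_h + const_pp mat_e + const_pp mat_f"
  "Psi psi T_psl = 2 *\<^sub>R const_pp mat_e + const_pp mat_f"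
  "Psi psi (inverse U_psl) = const_pp mat_e + 2 *\<^sub>R const_pp mat_f"
  using usa_identity[of 1 1 0 0] usa_identity[of 1 1 1 0] usa_identity[of 1 1 0 "-1"]
  by (simp_all add: psl_one T_psl_def U_psl_def psl_inverse usa_rhs_def)

lemma constants_from_hyperfans:
  "const_pp mat_h = Psi psi 1 - (1/3) *\<^sub>R Psi psi T_psl - (1/3) *\<^sub>R Psi psi (inverse U_psl)"
  "const_pp mat_e = (2/3) *\<^sub>R Psi psi T_psl - (1/3) *\<^sub>R Psi psi (inverse U_psl)"
  "const_pp mat_f = - (1/3) *\<^sub>R Psi psi T_psl + (2/3) *\<^sub>R Psi psi (inverse U_psl)"
proof -
  have 1: "x = (4/3 - 1/3) *\<^sub>R x + (2/3 - 2/3) *\<^sub>R y" for x y :: ppsl2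
    by simp
  have 2: "x = x + (1 - 2/3 - 1/3) *\<^sub>R y + (1 - 1/3 - 2/3) *\<^sub>R z" for x y z :: ppsl2
    by simp
  show "const_pp mat_h = Psi psi 1 - (1/3) *\<^sub>R Psi psi T_psl - (1/3) *\<^sub>R Psi psi (inverse U_psl)"
    by (subst 2[of _ "const_pp mat_e" "const_pp mat_f"], unfold Psi_one_T_U scaleR_left_diff_distrib)
      (simp add: algebra_simps)
  show "const_pp mat_e = (2/3) *\<^sub>R Psi psi T_psl - (1/3) *\<^sub>R Psi psi (inverse U_psl)"
    by (subst 1[of _ "const_pp mat_f"], unfold Psi_one_T_U scaleR_left_diff_distrib)
      (simp add: algebra_simps)
  show "const_pp mat_f = - (1/3) *\<^sub>R Psi psi T_psl + (2/3) *\<^sub>R Psi psi (inverse U_psl)"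
    by (subst 1[of _ "const_pp mat_e"], unfold Psi_one_T_U scaleR_left_diff_distrib)
      (simp add: algebra_simps)
qed

section \<open>Linear combinations of hyperfans\<close>

lemma hyperfan_comb_superset:
  assumes "finite K" "Poly_Mapping.keys r \<subseteq> K"
  shows "hyperfan_comb r = (\<Sum>A\<in>K. Poly_Mapping.lookup r A *\<^sub>R psi A)"
  unfolding hyperfan_comb_def
  by (rule sum.mono_neutral_left[OF assms]) (simp add: in_keys_iff)

lemma lookup_scaleR: "Poly_Mapping.lookup (k *\<^sub>R r) A = k *\<^sub>R Poly_Mapping.lookup r A"
  by transfer simp

lemma linear_hyperfan_comb: "linear hyperfan_comb"
proof (rule linearI)
  fix r s :: "psl2z \<Rightarrow>\<^sub>0 real" and k :: real
  let ?K = "Poly_Mapping.keys r \<union> Poly_Mapping.keys s"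
  show "hyperfan_comb (r + s) = hyperfan_comb r + hyperfan_comb s"
    using hyperfan_comb_superset[of ?K "r + s"] hyperfan_comb_superset[of ?K r]
      hyperfan_comb_superset[of ?K s] keys_add[of r s]
    by (simp add: lookup_add scaleR_left_distrib sum.distrib)
  have "Poly_Mapping.keys (k *\<^sub>R r) \<subseteq> Poly_Mapping.keys r"
    by (auto simp: in_keys_iff lookup_scaleR)
  then show "hyperfan_comb (k *\<^sub>R r) = k *\<^sub>R hyperfan_comb r"
    using hyperfan_comb_superset[of "Poly_Mapping.keys r" "k *\<^sub>R r"]
    by (simp add: lookup_scaleR hyperfan_comb_def scaleR_sum_right)
qed

lemma hyperfan_comb_gen: "hyperfan_comb (gen A) = psi A"
  by (simp add: hyperfan_comb_def gen_def)

lemma poly_mapping_gen_sum: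
  "r = (\<Sum>A\<in>Poly_Mapping.keys r. Poly_Mapping.lookup r A *\<^sub>R gen A)"
proof (rule poly_mapping_eqI)
  fix B
  have "Poly_Mapping.lookup (\<Sum>A\<in>Poly_Mapping.keys r. Poly_Mapping.lookup r A *\<^sub>R gen A) B =
      (\<Sum>A\<in>Poly_Mapping.keys r. Poly_Mapping.lookup r A * (if A = B then 1 else 0))"
    by (simp add: lookup_sum lookup_scaleR gen_def lookup_single when_def)
  also have "\<dots> = Poly_Mapping.lookup r B"
    by (simp add: in_keys_iff if_distrib[of "(*) _"] cong: if_cong)
  finally show "Poly_Mapping.lookup r B =
      Poly_Mapping.lookup (\<Sum>A\<in>Poly_Mapping.keys r. Poly_Mapping.lookup r A *\<^sub>R gen A) B" ..
qed

lemma hyperfan_comb_Psi_gen: "hyperfan_comb (Psi gen A) = Psi psi A"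
proof -
  interpret linear hyperfan_comb by (rule linear_hyperfan_comb)
  show ?thesis by (simp add: Psi_def add diff scale hyperfan_comb_gen)
qed

lemma hyperfan_comb_constants:
  "hyperfan_comb h_gen = const_pp mat_h"
  "hyperfan_comb e_gen = const_pp mat_e"
  "hyperfan_comb f_gen = const_pp mat_f"
proof -
  interpret linear hyperfan_comb by (rule linear_hyperfan_comb)
  show "hyperfan_comb h_gen = const_pp mat_h" "hyperfan_comb e_gen = const_pp mat_e"
    "hyperfan_comb f_gen = const_pp mat_f"
    by (simp_all only: h_gen_def e_gen_def f_gen_def add diff scale hyperfan_comb_Psi_gen
      constants_from_hyperfans)
qed

lemma hyperfan_comb_usa_relations:
  assumes "r \<in> span usa_relations" shows "hyperfan_comb r = 0"
proof -
  interpret linear hyperfan_comb by (rule linear_hyperfan_comb)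
  have "hyperfan_comb s = 0" if "s \<in> usa_relations" for s
    using that unfolding usa_relations_def
    by (auto simp: diff hyperfan_comb_Psi_gen usa_identity usa_rhs_def add scale
      hyperfan_comb_constants)
  then show ?thesis
    using linear_eq_0_on_span[OF linear_hyperfan_comb _ assms] by blast
qed

section \<open>The hyperfans span\<close>

text \<open>
The symmetric form of \<open>X\<close>, evaluated on the basis dual to the rows \<open>p\<close> and \<open>q\<close>, becomes a combination of \<open>p\<^sup>2\<close>, \<open>q\<^sup>2\<close> and the
mixed term \<open>2 p q = (p + q)\<^sup>2 - p\<^sup>2 - q\<^sup>2\<close>.
\<close>

lemma sl2_decomp:
  assumes "X \<in> sl2" "a * d - b * c = (1::int)"
  shows "\<exists>u v w. X = u *\<^sub>R nilp a b + v *\<^sub>R nilp c d + w *\<^sub>R nilp (a + c) (b + d)"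
proof -
  define x y z where xyz: "x = X$1$1" "y = X$1$2" "z = X$2$1"
  have X: "X = mat2 x y z (- x)"
    using assms(1) by (simp add: matrix2_eq_iff xyz sl2_iff)
  define a' b' c' d' where r: "a' = real_of_int a" "b' = real_of_int b" "c' = real_of_int c"
    "d' = real_of_int d"
  have "real_of_int (a * d - b * c) = 1" using assms(2) by simp
  then have det: "a' * d' - b' * c' = 1" by (simp add: r)
  define u v w where uvw: "u = - z * d'\<^sup>2 - 2 * x * c' * d' + y * c'\<^sup>2"
    "v = - z * b'\<^sup>2 - 2 * x * a' * b' + y * a'\<^sup>2"
    "w = z * b' * d' + x * (a' * d' + b' * c') - y * a' * c'"
  have "(u - w) * (a' * b') + (v - w) * (c' * d') + w * ((a' + c') * (b' + d')) =
      x * (a' * d' - b' * c')\<^sup>2"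
    "(u - w) * b'\<^sup>2 + (v - w) * d'\<^sup>2 + w * (b' + d')\<^sup>2 = y * (a' * d' - b' * c')\<^sup>2"
    "(u - w) * a'\<^sup>2 + (v - w) * c'\<^sup>2 + w * (a' + c')\<^sup>2 = - z * (a' * d' - b' * c')\<^sup>2"
    unfolding uvw by (simp_all add: algebra_simps power2_eq_square)
  then have "X = (u - w) *\<^sub>R nilp a b + (v - w) *\<^sub>R nilp c d + w *\<^sub>R nilp (a + c) (b + d)"
    unfolding det X by (simp add: matrix2_eq_iff nilp_def r[symmetric])
  then show ?thesis by blast
qed

definition in_span :: "(real \<Rightarrow> real^2^2) \<Rightarrow> bool" where
  "in_span f \<longleftrightarrow> (\<exists>F\<in>span (range psi). represents F f)"

lemma in_span_add: "in_span f \<Longrightarrow> in_span g \<Longrightarrow> in_span (\<lambda>t. f t + g t)"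
  unfolding in_span_def by (metis represents_add span_add)

lemma in_span_diff: "in_span f \<Longrightarrow> in_span g \<Longrightarrow> in_span (\<lambda>t. f t - g t)"
  unfolding in_span_def by (metis represents_diff span_diff)

lemma in_span_scaleR: "in_span f \<Longrightarrow> in_span (\<lambda>t. r *\<^sub>R f t)"
  unfolding in_span_def by (metis represents_scaleR span_scale)

lemma in_span_zero: "in_span (\<lambda>_. 0)"
  unfolding in_span_def by (metis represents_zero span_zero)

lemma in_span_cong: "in_span f \<Longrightarrow> finite {t. f t \<noteq> g t} \<Longrightarrow> in_span g"
  unfolding in_span_def by (metis represents_cong)

lemma in_span_sum: "(\<And>i. i \<in> I \<Longrightarrow> in_span (f i)) \<Longrightarrow> in_span (\<lambda>t. \<Sum>i\<in>I. f i t)"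
  by (induction I rule: infinite_finite_induct) (auto intro: in_span_zero in_span_add)

lemma const_pp_in_span:
  assumes "X \<in> sl2" shows "const_pp X \<in> span (range psi)"
proof -
  have Psi: "Psi psi A \<in> span (range psi)" for A
    unfolding Psi_def by (intro span_add span_diff span_scale span_base rangeI)
  have 1: "const_pp mat_h \<in> span (range psi)" "const_pp mat_e \<in> span (range psi)"
    "const_pp mat_f \<in> span (range psi)"
    unfolding constants_from_hyperfans by (intro span_add span_diff span_scale Psi)+
  have "X = X$1$1 *\<^sub>R mat_h + X$1$2 *\<^sub>R mat_e + X$2$1 *\<^sub>R mat_f"
    using assms by (simp add: sl2_iff matrix2_eq_iff mat_h_def mat_e_def mat_f_def)
  then have "const_pp X = const_pp (X$1$1 *\<^sub>R mat_h + X$1$2 *\<^sub>R mat_e + X$2$1 *\<^sub>R mat_f)"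
    by simp
  also have "\<dots> = X$1$1 *\<^sub>R const_pp mat_h + X$1$2 *\<^sub>R const_pp mat_e + X$2$1 *\<^sub>R const_pp mat_f"
    by (simp only: const_pp_add const_pp_scaleR sl2_add sl2_scaleR sl2_mats)
  finally show ?thesis using 1 by (simp add: span_add span_scale)
qed

lemma in_span_const: "X \<in> sl2 \<Longrightarrow> in_span (\<lambda>_. X)"
  unfolding in_span_def using represents_const const_pp_in_span by blast

text \<open>
The indicator function of the arc from \<open>pt a b\<close> to \<open>\<infinity>\<close>, times \<open>X\<close>; it is \<open>0\<close> if \<open>pt a b\<close> is \<open>\<infinity>\<close> itself.
\<close>

definition step :: "int \<Rightarrow> int \<Rightarrow> real^2^2 \<Rightarrow> real \<Rightarrow> real^2^2" where
  "step a b X t = (if a \<noteq> 0 \<and> - of_int b / of_int a < t then X else 0)"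

text \<open>
The set where the product of the two forms is negative is the arc between their zeros that goes through
\<open>\<infinity>\<close> or the one that does not, according to the sign of \<open>a c\<close>. The last summand accounts for this choice.
\<close>

lemma hyperfan_steps:
  assumes "a * d - b * c = 1"
  shows "finite {t. (if (of_int a * t + of_int b) * (of_int c * t + of_int d) < (0::real) then X else 0)
    \<noteq> step c d X t - step a b X t + (if a * c < 0 \<or> c = 0 then X else 0)}" (is "finite {t. ?P t}")
proof (rule finite_subset)
  show "{t. ?P t} \<subseteq> {- of_int b / of_int a, - of_int d / of_int c}"
  proof (rule subsetI, rule ccontr)
    fix t assume "t \<in> {t. ?P t}" and t: "t \<notin> {- of_int b / of_int a, - of_int d / of_int c}"
    then have P: "?P t" by simp
    define x y where xy: "x = - real_of_int b / of_int a" "y = - real_of_int d / of_int c"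
    have det: "real_of_int a * of_int d - of_int b * of_int c = 1"
      using assms by (metis of_int_1 of_int_diff of_int_mult)
    have ra: "of_int a * t + of_int b = of_int a * (t - x)" if "a \<noteq> 0"
      using that by (simp add: xy field_simps)
    have rc: "of_int c * t + of_int d = of_int c * (t - y)" if "c \<noteq> 0"
      using that by (simp add: xy field_simps)
    have xy': "- (of_int b / of_int a) = x" "- (of_int d / of_int c) = y"
      by (simp_all add: xy)
    have tx: "t \<noteq> x" "t \<noteq> y" using t by (simp_all add: xy)
    consider "a = 0" | "c = 0" | "a \<noteq> 0" "c \<noteq> 0" by blast
    then show False
    proof cases
      case 1
      then have "b * c = -1" using assms by simp
      then have bc: "(b = 1 \<and> c = -1) \<or> (b = -1 \<and> c = 1)" by (auto simp: zmult_eq_neg1_iff)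
      show False using P 1 bc tx rc by (auto simp: step_def xy[symmetric])
    next
      case 2
      then have "a * d = 1" using assms by simp
      then have bc: "(a = 1 \<and> d = 1) \<or> (a = -1 \<and> d = -1)" by (auto simp: zmult_eq_1_iff)
      show False using P 2 bc tx ra by (auto simp: step_def xy[symmetric] split: if_splits)
    next
      case 3
      have d: "x - y = 1 / (of_int a * of_int c)"
        using 3 det by (simp add: xy field_simps)
      have prod: "(of_int a * t + of_int b) * (of_int c * t + of_int d) =
          (of_int a * of_int c) * ((t - x) * (t - y))"
        unfolding ra[OF 3(1)] rc[OF 3(2)] by (simp add: algebra_simps)
      show False
      proof (cases "a * c > 0")
        case True
        then have r: "real_of_int a * of_int c > 0" by (metis of_int_0_less_iff of_int_mult)
        then have "y < x" using d by (metis diff_gt_0_iff_gt zero_less_divide_1_iff)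
        have "(of_int a * t + of_int b) * (of_int c * t + of_int d) < 0 \<longleftrightarrow> (t - x) * (t - y) < 0"
          unfolding prod using mult_less_cancel_left_pos[OF r, of "(t - x) * (t - y)" 0] by simp
        also have "\<dots> \<longleftrightarrow> y < t \<and> t < x"
          using tx \<open>y < x\<close> by (auto simp: mult_less_0_iff)
        finally have "(if y < t \<and> t < x then X else 0) \<noteq> (if y < t then X else 0) - (if x < t then X else 0)"
          using P True 3 by (simp add: step_def xy')
        then show False using tx \<open>y < x\<close> by (auto split: if_splits)
      next
        case False
        then have F: "a * c < 0" using 3 by (simp add: order_less_le)
        then have r: "real_of_int a * of_int c < 0" by (metis of_int_less_0_iff of_int_mult)
        then have "x < y" using d by (metis diff_less_0_iff_less divide_less_0_1_iff)
        have "(of_int a * t + of_int b) * (of_int c * t + of_int d) < 0 \<longleftrightarrow> 0 < (t - x) * (t - y)"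
          unfolding prod using mult_less_cancel_left_neg[OF r, of "(t - x) * (t - y)" 0] by simp
        also have "\<dots> \<longleftrightarrow> t < x \<or> y < t"
          using tx \<open>x < y\<close> by (auto simp: zero_less_mult_iff)
        finally have "(if t < x \<or> y < t then X else 0) \<noteq>
            (if y < t then X else 0) - (if x < t then X else 0) + X"
          using P F 3 by (simp add: step_def xy')
        then show False using tx \<open>x < y\<close> by (auto split: if_splits)
      qed
    qed
  qed
qed simp

lemma in_span_arc_nilp:
  assumes "a * d - b * c = 1"
  shows "in_span (\<lambda>t. step c d (nilp c d) t - step a b (nilp c d) t)"
proof -
  let ?X = "nilp c d"
  let ?k = "if a * c < 0 \<or> c = 0 then ?X else 0"
  have "in_span (\<lambda>t. if (of_int a * t + of_int b) * (of_int c * t + of_int d) < (0::real) then ?X else 0)"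
    unfolding in_span_def using represents_psi[OF assms] by (blast intro: span_base)
  then have "in_span (\<lambda>t. step c d ?X t - step a b ?X t + ?k)"
    by (rule in_span_cong) (rule hyperfan_steps[OF assms])
  then have "in_span (\<lambda>t. step c d ?X t - step a b ?X t + ?k - ?k)"
    by (rule in_span_diff) (simp add: in_span_const nilp_sl2)
  then show ?thesis by simp
qed

lemma step_uminus: "step (- a) (- b) = step a b"
  by (intro ext) (simp add: step_def)

lemma step_add: "step a b (X + Y) t = step a b X t + step a b Y t"
  by (simp add: step_def)

lemma step_scaleR: "step a b (r *\<^sub>R X) t = r *\<^sub>R step a b X t"
  by (simp add: step_def)

text \<open>
The orientations \<open>p \<rightarrow> q\<close> and \<open>q \<rightarrow> p\<close> provide \<open>N\<^sub>q\<close> and \<open>N\<^sub>p\<close> on the arc between \<open>p\<close> and \<open>q\<close>. With the mediant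
\<open>r\<close>, the hyperfans of \<open>p \<rightarrow> r\<close> and \<open>q \<rightarrow> r\<close> carry the same matrix \<open>N\<^sub>r\<close> on adjacent arcs, so the combination of
the two provides \<open>N\<^sub>r\<close> on the arc between \<open>p\<close> and \<open>q\<close>. These three matrices span.
\<close>

lemma in_span_arc:
  assumes det: "a * d - b * c = 1" and X: "X \<in> sl2"
  shows "in_span (\<lambda>t. step c d X t - step a b X t)"
proof -
  let ?D = "\<lambda>X t. step c d X t - step a b X t"
  let ?N = "nilp (a + c) (b + d)"
  have 1: "in_span (?D (nilp c d))" using in_span_arc_nilp[OF det] by simp
  have "in_span (\<lambda>t. step a b (nilp a b) t - step c d (nilp a b) t)"
    using in_span_arc_nilp[of "-c" b "-d" a] det by (simp add: step_uminus mult.commute)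
  from in_span_scaleR[OF this, of "-1"] have 2: "in_span (?D (nilp a b))" by simp
  have "in_span (\<lambda>t. step (a + c) (b + d) ?N t - step a b ?N t)"
    using in_span_arc_nilp[of a "b + d" b "a + c"] det by (simp add: algebra_simps)
  moreover have "in_span (\<lambda>t. step (a + c) (b + d) ?N t - step c d ?N t)"
    using in_span_arc_nilp[of "-c" "b + d" "-d" "a + c"] det
    by (simp add: algebra_simps step_uminus)
  ultimately have "in_span (\<lambda>t. (step (a + c) (b + d) ?N t - step a b ?N t)
      - (step (a + c) (b + d) ?N t - step c d ?N t))"
    by (rule in_span_diff)
  then have 3: "in_span (?D ?N)" by simp
  obtain u v w where X: "X = u *\<^sub>R nilp a b + v *\<^sub>R nilp c d + w *\<^sub>R ?N"
    using sl2_decomp[OF X det] by blast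
  have "?D X = (\<lambda>t. u *\<^sub>R ?D (nilp a b) t + v *\<^sub>R ?D (nilp c d) t + w *\<^sub>R ?D ?N t)"
    unfolding X step_add step_scaleR by (simp add: algebra_simps)
  then show ?thesis
    using in_span_add[OF in_span_add[OF in_span_scaleR[OF 2] in_span_scaleR[OF 1]] in_span_scaleR[OF 3]]
    by simp
qed

text \<open>
Every rational number has a Farey neighbour of smaller denominator, found with Bezout coefficients
reduced modulo the denominator. The induction ends at \<open>\<infinity>\<close>, where the step is zero.
\<close>

lemma in_span_step:
  assumes "coprime a b" "X \<in> sl2"
  shows "in_span (step a b X)"
  using assms(1)
proof (induction "nat \<bar>a\<bar>" arbitrary: a b rule: less_induct)
  case less
  show ?case
  proof (cases "a = 0")
    case True
    then show ?thesis using in_span_zero by (simp add: step_def[abs_def])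
  next
    case False
    obtain u v where uv: "u * a + v * b = 1"
      using less.prems by (metis bezout_int coprime_imp_gcd_eq_1)
    \<comment> \<open>The neighbour \<open>(c, u - k * b)\<close> solves \<open>a * (u - k * b) - b * c = 1\<close> with \<open>0 \<le> c < \<bar>a\<bar>\<close>.\<close>
    define c where "c = (- v) mod \<bar>a\<bar>"
    define k where "k = (- v) div \<bar>a\<bar> * sgn a"
    have "\<bar>a\<bar> = sgn a * a" by (simp add: abs_sgn mult.commute)
    then have c: "c = - v - k * a"
      unfolding c_def k_def by (simp add: minus_div_mult_eq_mod[symmetric] algebra_simps)
    have det: "a * (u - k * b) - b * c = 1"
      using uv by (simp add: c algebra_simps)
    have "0 \<le> c" "c < \<bar>a\<bar>" using False by (simp_all add: c_def)
    moreover have "coprime c (u - k * b)"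
    proof (rule coprimeI)
      fix x assume "x dvd c" "x dvd u - k * b"
      then have "x dvd a * (u - k * b) - b * c" by simp
      then show "is_unit x" by (simp add: det)
    qed
    ultimately have "in_span (step c (u - k * b) X)"
      using less.hyps[of c "u - k * b"] by simp
    then have "in_span (\<lambda>t. step c (u - k * b) X t - (step c (u - k * b) X t - step a b X t))"
      by (rule in_span_diff) (rule in_span_arc[OF det assms(2)])
    then show ?thesis by simp
  qed
qed

lemma in_span_rational_step:
  assumes "s \<in> \<rat>" "X \<in> sl2"
  shows "in_span (\<lambda>t. if s < t then X else 0)"
proof -
  obtain m n where mn: "n > 0" "coprime m n" "s = of_int m / of_int n"
    using assms(1) by (metis Rats_cases')
  then have "coprime n (- m)" by (simp add: coprime_commute)
  from in_span_step[OF this assms(2)] show ?thesis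
    using mn by (simp add: step_def[abs_def])
qed

text \<open>
Induction on the largest breakpoint \<open>b\<close>: freezing \<open>f\<close> at its value just below \<open>b\<close> removes this breakpoint
and changes \<open>f\<close>, away from \<open>b\<close>, by a step. The heights of the steps are differences of values of \<open>f\<close>, so they stay
in any subspace that contains the range.
\<close>

lemma piecewise_constant_steps:
  fixes f :: "real \<Rightarrow> 'v::real_vector"
  assumes "finite B" "\<And>C. connected C \<Longrightarrow> C \<inter> B = {} \<Longrightarrow> f constant_on C"
  shows "\<exists>u J. u \<in> range f \<and> (\<forall>s\<in>B. \<exists>x y. J s = f x - f y) \<and>
    (\<forall>t. t \<notin> B \<longrightarrow> f t = u + (\<Sum>s\<in>B. if s < t then J s else 0))"
  using assms
proof (induction B arbitrary: f rule: finite_linorder_max_induct)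
  case empty
  have "f constant_on UNIV" using empty by (simp add: connected_UNIV)
  then show ?case unfolding constant_on_def by auto
next
  case (insert b A)
  obtain c where c: "c < b" "\<forall>s\<in>A. s < c"
  proof -
    have "\<exists>c<b. \<forall>s\<in>A. s < c"
    proof (cases "A = {}")
      case False
      then have "Max A < b" using insert by simp
      then obtain c where "Max A < c" "c < b" using dense by blast
      then show ?thesis using insert(1) False by (intro exI[of _ c]) auto
    qed (auto intro: lt_ex)
    then show ?thesis using that by blast
  qed
  define g where "g t = (if t < b then f t else f c)" for t
  have "g constant_on C" if C: "connected C" "C \<inter> A = {}" for C
  proof (cases "C \<subseteq> {..<b}")
    case True
    then have "f constant_on C" using C insert.prems[of C] by auto
    then show ?thesis using True unfolding constant_on_def g_def by auto
  next
    case False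
    then obtain y where y: "y \<in> C" "b \<le> y" by (metis lessThan_iff not_less subsetI)
    have gt: "\<forall>s\<in>A. s < x" if "x \<in> C" for x
    proof (intro ballI, rule ccontr)
      fix s assume s: "s \<in> A" "\<not> s < x"
      then have "s \<in> C" using C(1) that y insert(2) unfolding connected_iff_interval
        by (meson less_imp_le not_less order_trans)
      then show False using C(2) s by auto
    qed
    have "g x = f c" if "x \<in> C" for x
    proof (cases "x < b")
      case True
      have "s < min x c" if "s \<in> A" for s
        using True c gt[OF \<open>x \<in> C\<close>] that by auto
      moreover have "max x c < b" using True c by simp
      ultimately have "{min x c..max x c} \<inter> insert b A = {}" by force
      then have "f constant_on {min x c..max x c}" by (intro insert.prems) simp
      then show ?thesis using True unfolding constant_on_def g_def
        by (metis atLeastAtMost_iff max.cobounded1 max.cobounded2 min.cobounded1 min.cobounded2)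
    qed (simp add: g_def)
    then show ?thesis unfolding constant_on_def by blast
  qed
  from insert.IH[OF this] obtain u J where uJ: "u \<in> range g"
    "\<forall>s\<in>A. \<exists>x y. J s = g x - g y"
    "\<And>t. t \<notin> A \<Longrightarrow> g t = u + (\<Sum>s\<in>A. if s < t then J s else 0)" by blast
  have range: "range g \<subseteq> range f" by (auto simp: g_def)
  define J' where "J' = J(b := f (b + 1) - f c)"
  have bA: "b \<notin> A" using insert(2) by blast
  have "f t = u + (\<Sum>s\<in>insert b A. if s < t then J' s else 0)" if t: "t \<notin> insert b A" for t
  proof -
    have J': "(\<Sum>s\<in>A. if s < t then J' s else 0) = (\<Sum>s\<in>A. if s < t then J s else 0)"
      using bA by (intro sum.cong) (auto simp: J'_def)
    have "f t = f (b + 1)" if "b < t"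
    proof -
      have "f constant_on {b<..}"
        by (rule insert.prems) (use insert(2) in auto)
      then show ?thesis using that unfolding constant_on_def
        by (metis greaterThan_iff less_add_one)
    qed
    then have "f t = g t + (if b < t then f (b + 1) - f c else 0)"
      using t by (auto simp: g_def)
    also have "\<dots> = u + ((\<Sum>s\<in>A. if s < t then J s else 0) + (if b < t then f (b + 1) - f c else 0))"
      using uJ(3)[of t] t by simp
    finally show ?thesis using bA insert(1) J' by (simp add: J'_def add.commute)
  qed
  moreover have "u \<in> range f" using uJ(1) range by blast
  moreover have "\<exists>x y. J' s = f x - f y" if "s \<in> insert b A" for s
  proof (cases "s = b")
    case False
    with that have "s \<in> A" by simp
    then obtain x y where "J s = g x - g y" using uJ(2) by blast
    moreover have "g x \<in> range f" "g y \<in> range f" using range by auto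
    then obtain x' y' where "g x = f x'" "g y = f y'" by blast
    ultimately have "J' s = f x' - f y'" using False by (simp add: J'_def)
    then show ?thesis by blast
  qed (auto simp: J'_def)
  ultimately show ?case by blast
qed

lemma connected_cay_Some:
  assumes "connected C" shows "connected (cay ` Some ` C)"
proof -
  have "continuous_on C (\<lambda>s. (complex_of_real s - \<i>) / (complex_of_real s + \<i>))"
    by (intro continuous_intros) auto
  from connected_continuous_image[OF this assms] show ?thesis
    by (simp add: image_image cay_def)
qed

theorem span_hyperfans: "span (range psi) = UNIV"
proof -
  have "F \<in> span (range psi)" for F
  proof -
    define f where "f = rep_ppsl2 F \<circ> Some"
    have F: "represents F f" by (simp add: represents_def f_def)
    obtain B where B: "finite B" "B \<subseteq> qhat" and range: "range (rep_ppsl2 F) \<subseteq> sl2"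
      and const: "\<And>C. connected (cay ` C) \<Longrightarrow> C \<inter> B = {} \<Longrightarrow> rep_ppsl2 F constant_on C"
      using rep_piecewise[of F] unfolding piecewise_sl2_def by blast
    define B' where "B' = Some -` B"
    have fin: "finite B'" unfolding B'_def by (intro finite_vimageI B) simp
    have rat: "B' \<subseteq> \<rat>" using B(2) by (auto simp: B'_def qhat_def)
    have "f constant_on C" if "connected C" "C \<inter> B' = {}" for C
      using const[OF connected_cay_Some[OF that(1)]] that(2)
      unfolding constant_on_def B'_def f_def by auto
    from piecewise_constant_steps[OF fin this] obtain u J where
      uJ: "u \<in> range f" "\<forall>s\<in>B'. \<exists>x y. J s = f x - f y"
      "\<And>t. t \<notin> B' \<Longrightarrow> f t = u + (\<Sum>s\<in>B'. if s < t then J s else 0)" by blast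
    have sl: "range f \<subseteq> sl2" using range by (auto simp: f_def)
    have "in_span (\<lambda>t. u + (\<Sum>s\<in>B'. if s < t then J s else 0))"
    proof (intro in_span_add in_span_const in_span_sum in_span_rational_step)
      show "u \<in> sl2" using uJ(1) sl by blast
      fix s assume s: "s \<in> B'"
      then show "s \<in> \<rat>" using rat by blast
      obtain x y where "J s = f x - f y" using uJ(2) s by blast
      moreover have "f x \<in> sl2" "f y \<in> sl2" using sl by auto
      ultimately show "J s \<in> sl2" by (simp add: sl2_iff)
    qed
    then obtain G where G: "G \<in> span (range psi)"
      "represents G (\<lambda>t. u + (\<Sum>s\<in>B'. if s < t then J s else 0))"
      unfolding in_span_def by blast
    have "finite {t. f t \<noteq> u + (\<Sum>s\<in>B'. if s < t then J s else 0)}"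
      by (rule finite_subset[OF _ fin]) (use uJ(3) in blast)
    then have "F = G" by (rule represents_eq[OF F G(2)])
    then show ?thesis using G(1) by simp
  qed
  then show ?thesis by blast
qed

section \<open>Arithmetic of Farey neighbours\<close>

lemma abs_mult_eq_one:
  fixes x y :: int
  assumes "\<bar>x\<bar> * \<bar>y\<bar> = 1" shows "\<bar>x\<bar> = 1" "\<bar>y\<bar> = 1"
  using zmult_eq_1_iff[of "\<bar>x\<bar>" "\<bar>y\<bar>"] assms by linarith+

lemma unimodular_products_same_sign:
  fixes a b c d :: int
  assumes "\<bar>a * d - b * c\<bar> = 1" shows "0 \<le> (b * c) * (a * d)"
proof (rule ccontr)
  assume "\<not> ?thesis"
  then have "(b * c) * (a * d) < 0" by simp
  then show False using assms by (auto simp: mult_less_0_iff[of "b * c"])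
qed

text \<open>
If the rows were incomparable, one diagonal product would exceed the other by more than \<open>1\<close>, unless the
rows are the unit vectors.
\<close>

lemma farey_comparable_nonneg:
  fixes a b c d :: int
  assumes "0 \<le> a" "0 \<le> b" "0 \<le> c" "0 \<le> d" "\<bar>a * d - b * c\<bar> = 1"
  shows "a \<le> c \<and> b \<le> d \<or> c \<le> a \<and> d \<le> b \<or> a = 0 \<and> d = 0 \<or> b = 0 \<and> c = 0"
proof (rule ccontr)
  assume neg: "\<not> ?thesis"
  then have "c < a \<and> b < d \<or> a < c \<and> d < b" by linarith
  then show False
  proof
    assume "c < a \<and> b < d"
    then have "(c + 1) * (b + 1) \<le> a * d" using assms by (intro mult_mono) auto
    then have "b + c + 1 \<le> a * d - b * c" by (simp add: algebra_simps)
    then show False using neg assms by linarith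
  next
    assume "a < c \<and> d < b"
    then have "(a + 1) * (d + 1) \<le> c * b" using assms by (intro mult_mono) auto
    then have "a + d + 1 \<le> b * c - a * d" by (simp add: algebra_simps)
    then show False using neg assms by linarith
  qed
qed

lemma unimodular_same_quadrant:
  fixes a b c d :: int
  assumes "\<bar>a * d - b * c\<bar> = 1"
  shows "0 \<le> a * c \<and> 0 \<le> b * d \<or> a * c \<le> 0 \<and> b * d \<le> 0"
proof -
  have "0 \<le> (b * c) * (a * d)" by (rule unimodular_products_same_sign[OF assms])
  then have "0 \<le> (a * c) * (b * d)" by (simp add: algebra_simps)
  then show ?thesis by (simp only: zero_le_mult_iff)
qed

lemma farey_comparable:
  fixes a b c d :: int
  assumes "\<bar>a * d - b * c\<bar> = 1"
  shows "\<bar>a\<bar> \<le> \<bar>c\<bar> \<and> \<bar>b\<bar> \<le> \<bar>d\<bar> \<or> \<bar>c\<bar> \<le> \<bar>a\<bar> \<and> \<bar>d\<bar> \<le> \<bar>b\<bar> \<or> a = 0 \<and> d = 0 \<or> b = 0 \<and> c = 0"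
proof -
  have "0 \<le> (b * c) * (a * d)" by (rule unimodular_products_same_sign[OF assms])
  then have "\<bar>a * d\<bar> - \<bar>b * c\<bar> = a * d - b * c \<or> \<bar>a * d\<bar> - \<bar>b * c\<bar> = - (a * d - b * c)"
    by (auto simp: zero_le_mult_iff[of "b * c"])
  then have "\<bar>\<bar>a\<bar> * \<bar>d\<bar> - \<bar>b\<bar> * \<bar>c\<bar>\<bar> = 1"
    using assms by (auto simp: abs_mult)
  from farey_comparable_nonneg[OF _ _ _ _ this] show ?thesis by auto
qed

text \<open>
The generation does not distinguish the two ends of the edge from \<open>0\<close> to \<open>\<infinity>\<close>. The weights \<open>1\<close> and \<open>2\<close> make
\<open>0 = pt 1 0\<close> lower than \<open>\<infinity> = pt 0 1\<close>, so that one inequality describes \<open>O_set\<close> including this edge.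
\<close>

definition height :: "int \<Rightarrow> int \<Rightarrow> int" where
  "height a b = \<bar>a\<bar> + 2 * \<bar>b\<bar>"

lemma abs_diff_same_sign:
  fixes a c :: int
  assumes "0 \<le> a * c" "\<bar>a\<bar> \<le> \<bar>c\<bar>" shows "\<bar>c\<bar> = \<bar>a\<bar> + \<bar>c - a\<bar>"
  using assms by (auto simp: zero_le_mult_iff)

text \<open>
Unless the edge joins \<open>0\<close> and \<open>\<infinity>\<close>, its higher end \<open>q\<close> is the mediant of the lower end \<open>p\<close> and of \<open>q - \<epsilon> p\<close>. The sign \<open>\<epsilon>\<close> is the one for
which \<open>\<epsilon> p\<close> and \<open>q\<close> lie in the same closed quadrant; then absolute values add up componentwise.
\<close>

lemma farey_child:
  assumes "\<bar>a * d - b * c\<bar> = 1" "height a b < height c d"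
  obtains "b = 0" "c = 0"
  | \<epsilon> where "\<epsilon> = 1 \<or> \<epsilon> = -1" "\<bar>c\<bar> = \<bar>a\<bar> + \<bar>c - \<epsilon> * a\<bar>" "\<bar>d\<bar> = \<bar>b\<bar> + \<bar>d - \<epsilon> * b\<bar>"
proof -
  have "b = 0 \<and> c = 0 \<or> (\<bar>a\<bar> \<le> \<bar>c\<bar> \<and> \<bar>b\<bar> \<le> \<bar>d\<bar>)"
  proof -
    have "\<not> (\<bar>c\<bar> \<le> \<bar>a\<bar> \<and> \<bar>d\<bar> \<le> \<bar>b\<bar>)" using assms(2) by (auto simp: height_def)
    moreover have "\<not> (a = 0 \<and> d = 0)"
    proof
      assume z: "a = 0 \<and> d = 0"
      then have "\<bar>b\<bar> * \<bar>c\<bar> = 1" using assms(1) by (simp add: abs_mult)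
      from abs_mult_eq_one[OF this] have "\<bar>b\<bar> = 1" "\<bar>c\<bar> = 1" .
      then show False using assms(2) z by (simp add: height_def)
    qed
    ultimately show ?thesis using farey_comparable[OF assms(1)] by blast
  qed
  then consider "b = 0" "c = 0" | "\<bar>a\<bar> \<le> \<bar>c\<bar>" "\<bar>b\<bar> \<le> \<bar>d\<bar>" by blast
  then show ?thesis
  proof cases
    case 2
    from unimodular_same_quadrant[OF assms(1)] show ?thesis
    proof
      assume "0 \<le> a * c \<and> 0 \<le> b * d"
      then show ?thesis using that(2)[of 1] abs_diff_same_sign[of a c] abs_diff_same_sign[of b d] 2 by simp
    next
      assume "a * c \<le> 0 \<and> b * d \<le> 0"
      then show ?thesis using that(2)[of "-1"] abs_diff_same_sign[of "-a" c]
        abs_diff_same_sign[of "-b" d] 2 by simp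
    qed
  qed (use that in blast)
qed

lemma int_mult_neg_distance:
  fixes x y :: int assumes "x * y < 0" shows "2 \<le> \<bar>x - y\<bar>"
  using assms by (auto simp: mult_less_0_iff)

text \<open>
For rows \<open>p, q\<close> and \<open>u, v\<close> of unimodular matrices put \<open>x\<^sub>1 = det (p, u)\<close>, \<open>x\<^sub>2 = det (q, u)\<close> and likewise \<open>y\<^sub>1\<close>, \<open>y\<^sub>2\<close> for
\<open>v\<close>. The sign of \<open>x\<^sub>1 x\<^sub>2\<close> tells the side of the edge \<open>p q\<close> on which \<open>u\<close> lies. If the two edges crossed,
the determinant would be a difference of nonzero integers of opposite sign.
\<close>

lemma farey_edges_do_not_cross:
  fixes x1 x2 y1 y2 :: int
  assumes "\<bar>x1 * y2 - x2 * y1\<bar> = 1" "x1 * x2 < 0" shows "y1 * y2 \<le> 0"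
proof (rule ccontr)
  assume "\<not> ?thesis"
  then have "(x1 * x2) * (y1 * y2) < 0" using assms(2) by (simp add: mult_less_0_iff)
  then have "(x1 * y2) * (x2 * y1) < 0" by (simp add: algebra_simps)
  then show False using int_mult_neg_distance assms(1) by fastforce
qed

text \<open>
In the notation of the previous lemma, the three inequalities say that some point of the chord \<open>u v\<close> is
strictly inside the triangle with vertices \<open>p\<close>, \<open>q\<close> and \<open>p + q\<close>. As edges do not cross, \<open>u\<close> and \<open>v\<close> are then both
on the inner side of each edge of the triangle. A Farey point with this property is a vertex, and
two vertices make one of the three forms vanish on the whole chord.
\<close>

lemma farey_edge_avoids_triangle:
  fixes x1 x2 y1 y2 :: int and k l :: real
  assumes det: "\<bar>x1 * y2 - x2 * y1\<bar> = 1" and kl: "k > 0" "l > 0"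
    and "k * of_int (x1 * x2) + l * of_int (y1 * y2) < 0"
    and "k * of_int (x1 * (x1 + x2)) + l * of_int (y1 * (y1 + y2)) > 0"
    and "k * of_int (x2 * (x1 + x2)) + l * of_int (y2 * (y1 + y2)) > 0"
  shows False
proof -
  have neg: "u \<le> 0 \<and> v \<le> 0"
    if "k * of_int u + l * of_int v < 0" "u < 0 \<longrightarrow> v \<le> 0" "v < 0 \<longrightarrow> u \<le> 0" for u v :: int
  proof -
    have "u < 0 \<or> v < 0"
    proof (rule ccontr)
      assume "\<not> ?thesis"
      then have "0 \<le> k * of_int u + l * of_int v" using kl by simp
      then show False using that(1) by simp
    qed
    then show ?thesis using that by auto
  qed
  have cross: "\<bar>x1 * (y1 + y2) - (x1 + x2) * y1\<bar> = 1" "\<bar>x2 * (y1 + y2) - (x1 + x2) * y2\<bar> = 1"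
    using det by (simp_all add: algebra_simps abs_minus_commute)
  have 1: "x1 * x2 \<le> 0 \<and> y1 * y2 \<le> 0"
    using neg[of "x1 * x2" "y1 * y2"] farey_edges_do_not_cross[OF det]
      farey_edges_do_not_cross[of y1 x2 y2 x1] det assms(4)
    by (simp add: algebra_simps abs_minus_commute)
  have 2: "- (x1 * (x1 + x2)) \<le> 0 \<and> - (y1 * (y1 + y2)) \<le> 0"
  proof (rule neg)
    show "k * of_int (- (x1 * (x1 + x2))) + l * of_int (- (y1 * (y1 + y2))) < 0"
      using assms(5) by simp
    show "- (x1 * (x1 + x2)) < 0 \<longrightarrow> - (y1 * (y1 + y2)) \<le> 0"
      using farey_edges_do_not_cross[of "-x1" "y1 + y2" "x1 + x2" "-y1"] cross
      by (simp add: algebra_simps abs_minus_commute)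
    show "- (y1 * (y1 + y2)) < 0 \<longrightarrow> - (x1 * (x1 + x2)) \<le> 0"
      using farey_edges_do_not_cross[of "-y1" "x1 + x2" "y1 + y2" "-x1"] cross
      by (simp add: algebra_simps abs_minus_commute)
  qed
  have 3: "- (x2 * (x1 + x2)) \<le> 0 \<and> - (y2 * (y1 + y2)) \<le> 0"
  proof (rule neg)
    show "k * of_int (- (x2 * (x1 + x2))) + l * of_int (- (y2 * (y1 + y2))) < 0"
      using assms(6) by simp
    show "- (x2 * (x1 + x2)) < 0 \<longrightarrow> - (y2 * (y1 + y2)) \<le> 0"
      using farey_edges_do_not_cross[of "-x2" "y1 + y2" "x1 + x2" "-y2"] cross
      by (simp add: algebra_simps abs_minus_commute)
    show "- (y2 * (y1 + y2)) < 0 \<longrightarrow> - (x2 * (x1 + x2)) \<le> 0"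
      using farey_edges_do_not_cross[of "-y2" "x1 + x2" "y1 + y2" "-x2"] cross
      by (simp add: algebra_simps abs_minus_commute)
  qed
  have vertex: "x = 0 \<or> y = 0 \<or> x + y = 0"
    if "x * y \<le> 0" "- (x * (x + y)) \<le> 0" "- (y * (x + y)) \<le> 0" for x y :: int
    using that by (auto simp: mult_le_0_iff zero_le_mult_iff)
  have "x1 = 0 \<or> x2 = 0 \<or> x1 + x2 = 0" "y1 = 0 \<or> y2 = 0 \<or> y1 + y2 = 0"
    using vertex[of x1 x2] vertex[of y1 y2] 1 2 3 by blast+
  then show False using assms(4-6) by (auto simp del: of_int_mult of_int_add)
qed

section \<open>Chords in the Klein model\<close>

text \<open>
The isometry from the Poincare to the Klein disk. It preserves radii.
\<close>

definition klein :: "complex \<Rightarrow> complex" where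
  "klein z = (2 / (1 + (cmod z)\<^sup>2)) *\<^sub>R z"

text \<open>
The affine form on the plane which on the circle is a positive multiple of \<open>(a y - b x) (c y - d x)\<close> at the point
\<open>pt x y\<close> (lemma \<open>chord_form_cay\<close>). Its zero set is the line through \<open>pt a b\<close> and \<open>pt c d\<close>. Points of the closed
disk correspond to positive semidefinite binary quadratic forms, and this is their polarization at
the two rows; in particular it is positive for equal rows in the open disk.
\<close>

definition chord_form :: "int \<Rightarrow> int \<Rightarrow> int \<Rightarrow> int \<Rightarrow> complex \<Rightarrow> real" where
  "chord_form a b c d w = of_int (a * c) * (1 + Re w) - of_int (a * d + b * c) * Im w
     + of_int (b * d) * (1 - Re w)"

lemma cay_pt:
  assumes "x \<noteq> 0 \<or> y \<noteq> 0"
  shows "cay (pt x y) = Complex (((of_int y)\<^sup>2 - (of_int x)\<^sup>2) / ((of_int x)\<^sup>2 + (of_int y)\<^sup>2))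
    (2 * of_int x * of_int y / ((of_int x)\<^sup>2 + (of_int y)\<^sup>2))"
proof (cases "x = 0")
  case True
  then show ?thesis using assms by (simp add: pt_def cay_def complex_eq_iff)
next
  case False
  define u v where "u = real_of_int x" and "v = real_of_int y"
  define s where "s = - v / u"
  have u: "u \<noteq> 0" using False by (simp add: u_def)
  then have nz: "u\<^sup>2 + v\<^sup>2 \<noteq> 0" "s\<^sup>2 + 1 \<noteq> 0"
    by (auto simp: add_nonneg_eq_0_iff)
  have v: "v = - s * u" using u by (simp add: s_def)
  have "(v\<^sup>2 - u\<^sup>2) / (u\<^sup>2 + v\<^sup>2) = (s\<^sup>2 - 1) / (s\<^sup>2 + 1)"
    unfolding frac_eq_eq[OF nz] by (simp add: v power2_eq_square algebra_simps)
  moreover have "2 * u * v / (u\<^sup>2 + v\<^sup>2) = - 2 * s / (s\<^sup>2 + 1)"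
    unfolding frac_eq_eq[OF nz] by (simp add: v power2_eq_square algebra_simps)
  moreover have "cay (pt x y) = Complex ((s\<^sup>2 - 1) / (s\<^sup>2 + 1)) (- 2 * s / (s\<^sup>2 + 1))"
    using False by (simp add: pt_def cay_def complex_eq_iff Re_divide Im_divide power2_eq_square
      s_def u_def v_def)
  ultimately show ?thesis by (simp add: u_def v_def)
qed

lemma chord_form_cay:
  assumes "x \<noteq> 0 \<or> y \<noteq> 0"
  shows "chord_form a b c d (cay (pt x y)) =
    2 / ((of_int x)\<^sup>2 + (of_int y)\<^sup>2) * of_int ((a * y - b * x) * (c * y - d * x))"
proof -
  define u v where "u = real_of_int x" and "v = real_of_int y"
  have "u \<noteq> 0 \<or> v \<noteq> 0" using assms by (simp add: u_def v_def)
  then have nz: "u\<^sup>2 + v\<^sup>2 \<noteq> 0" by simp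
  define k where "k = 2 / (u\<^sup>2 + v\<^sup>2)"
  have "1 + (v\<^sup>2 - u\<^sup>2) / (u\<^sup>2 + v\<^sup>2) = k * v\<^sup>2" "1 - (v\<^sup>2 - u\<^sup>2) / (u\<^sup>2 + v\<^sup>2) = k * u\<^sup>2"
    "2 * u * v / (u\<^sup>2 + v\<^sup>2) = k * (u * v)"
    using nz by (simp_all add: k_def add_divide_eq_iff diff_divide_eq_iff divide_add_eq_iff
      divide_diff_eq_iff)
  then have "chord_form a b c d (cay (pt x y)) =
      of_int (a * c) * (k * v\<^sup>2) - of_int (a * d + b * c) * (k * (u * v)) + of_int (b * d) * (k * u\<^sup>2)"
    by (simp add: chord_form_def cay_pt[OF assms] u_def v_def)
  also have "\<dots> = k * of_int ((a * y - b * x) * (c * y - d * x))"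
    by (simp add: u_def v_def algebra_simps power2_eq_square)
  finally show ?thesis by (simp add: k_def u_def v_def)
qed

lemma chord_form_affine:
  "chord_form a b c d ((1 - t) *\<^sub>R v + t *\<^sub>R w) =
    (1 - t) * chord_form a b c d v + t * chord_form a b c d w"
  by (simp add: chord_form_def algebra_simps)

lemma chord_form_commute: "chord_form a b c d = chord_form c d a b"
  by (simp add: chord_form_def fun_eq_iff algebra_simps)

lemma chord_form_mediant:
  "chord_form a b (a + c) (b + d) w = chord_form a b a b w + chord_form a b c d w"
  by (simp add: chord_form_def algebra_simps)

text \<open>
Completing the square; the determinant of the form is \<open>1 - |w|\<^sup>2\<close>.
\<close>

lemma chord_form_diag_pos:
  assumes "cmod w < 1" "a \<noteq> 0 \<or> b \<noteq> 0" shows "0 < chord_form a b a b w"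
proof -
  define X Y where "X = Re w" and "Y = Im w"
  have n: "X\<^sup>2 + Y\<^sup>2 < 1"
    using assms(1) by (simp add: X_def Y_def cmod_def)
  then have "X\<^sup>2 < 1" by (smt (verit) zero_le_power2)
  then have "\<bar>X\<bar> < 1" by (simp add: abs_square_less_1)
  then have X: "0 < 1 + X" by linarith
  define u v where "u = real_of_int a" and "v = real_of_int b"
  have "(1 + X) * chord_form a b a b w = (u * (1 + X) - v * Y)\<^sup>2 + v\<^sup>2 * (1 - X\<^sup>2 - Y\<^sup>2)"
    by (simp add: chord_form_def X_def[symmetric] Y_def[symmetric] u_def v_def algebra_simps
        power2_eq_square)
  moreover have "0 < (u * (1 + X) - v * Y)\<^sup>2 + v\<^sup>2 * (1 - X\<^sup>2 - Y\<^sup>2)"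
  proof (cases "v = 0")
    case True
    then show ?thesis using assms(2) X by (simp add: u_def v_def)
  next
    case False
    then show ?thesis using n by (intro add_nonneg_pos) auto
  qed
  ultimately show ?thesis using X by (metis zero_less_mult_pos)
qed

lemma klein_radial:
  assumes "cmod w = 1"
  shows "klein (s *\<^sub>R w) = (2 * s / (1 + s\<^sup>2)) *\<^sub>R w"
  using assms by (simp add: klein_def)

lemma cmod_klein_less:
  assumes "cmod z < 1" shows "cmod (klein z) < 1"
proof -
  have "0 < (1 - cmod z)\<^sup>2" using assms by simp
  then have "2 * cmod z < 1 + (cmod z)\<^sup>2" by (simp add: power2_eq_square algebra_simps)
  moreover have "0 < 1 + (cmod z)\<^sup>2" by (simp add: add_pos_nonneg)
  ultimately show ?thesis by (simp add: klein_def)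
qed

lemma cay_norm: "cmod (cay x) = 1"
proof (cases x)
  case (Some s)
  have "cmod (complex_of_real s - \<i>) = cmod (complex_of_real s + \<i>)"
    by (simp add: cmod_def)
  moreover have "cmod (complex_of_real s + \<i>) \<noteq> 0" by simp
  ultimately show ?thesis using Some by (simp add: cay_def norm_divide)
qed (simp add: cay_def)

text \<open>
If the form vanishes at \<open>w\<close> in the open disk, the quadratic form of \<open>w\<close> has no mixed term in the basis dual
to the two rows. So \<open>w\<close> is a combination of the two ends whose coefficients are the two diagonal values, hence
positive; comparing traces, they sum up to \<open>1\<close>.
\<close>

lemma geodesic_pt:
  assumes "\<bar>a * d - b * c\<bar> = 1"
  shows "geodesic (pt a b) (pt c d) = {z \<in> ball 0 1. chord_form a b c d (klein z) = 0}"
proof -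
  have nz: "a \<noteq> 0 \<or> b \<noteq> 0" "c \<noteq> 0 \<or> d \<noteq> 0" using assms by auto
  have "klein z \<in> open_segment (cay (pt a b)) (cay (pt c d)) \<longleftrightarrow> chord_form a b c d (klein z) = 0"
    if z: "z \<in> ball 0 1" for z
  proof
    assume "klein z \<in> open_segment (cay (pt a b)) (cay (pt c d))"
    then obtain t where "klein z = (1 - t) *\<^sub>R cay (pt a b) + t *\<^sub>R cay (pt c d)"
      by (auto simp: in_segment)
    then show "chord_form a b c d (klein z) = 0"
      by (simp add: chord_form_affine chord_form_cay[OF nz(1)] chord_form_cay[OF nz(2)])
  next
    assume L: "chord_form a b c d (klein z) = 0"
    define w where "w = klein z"
    have w: "cmod w < 1" using z by (simp add: w_def cmod_klein_less)
    define X Y where "X = Re w" and "Y = Im w"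
    define a' b' c' d' where r: "a' = real_of_int a" "b' = real_of_int b" "c' = real_of_int c"
      "d' = real_of_int d"
    define \<alpha> where "\<alpha> = chord_form c d c d w / 2"
    define \<beta> where "\<beta> = chord_form a b a b w / 2"
    have pos: "0 < \<alpha>" "0 < \<beta>"
      using chord_form_diag_pos[OF w] nz by (simp_all add: \<alpha>_def \<beta>_def)
    have D: "(a' * d' - b' * c')\<^sup>2 = 1"
    proof -
      have "a * d - b * c = 1 \<or> a * d - b * c = -1" using assms by linarith
      then have "(a * d - b * c)\<^sup>2 = 1" by auto
      then have "real_of_int ((a * d - b * c)\<^sup>2) = 1" by simp
      then show ?thesis by (simp add: r)
    qed
    have L': "a' * c' * (1 + X) - (a' * d' + b' * c') * Y + b' * d' * (1 - X) = 0"
      using L by (simp add: chord_form_def w_def[symmetric] X_def Y_def r)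
    have \<alpha>: "2 * \<alpha> = c' * c' * (1 + X) - 2 * c' * d' * Y + d' * d' * (1 - X)"
      and \<beta>: "2 * \<beta> = a' * a' * (1 + X) - 2 * a' * b' * Y + b' * b' * (1 - X)"
      unfolding \<alpha>_def \<beta>_def X_def Y_def r
      by (simp_all add: chord_form_def)
    define l where "l = a' * c' * (1 + X) - (a' * d' + b' * c') * Y + b' * d' * (1 - X)"
    have l: "l = 0" using L' by (simp add: l_def)
    have "2 * \<alpha> * (a' * a') + 2 * \<beta> * (c' * c') - 2 * l * (a' * c') = (a' * d' - b' * c')\<^sup>2 * (1 - X)"
      unfolding \<alpha> \<beta> l_def by (simp add: algebra_simps power2_eq_square)
    then have m11: "2 * (\<alpha> * (a' * a') + \<beta> * (c' * c')) = 1 - X" by (simp add: D l)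
    have "2 * \<alpha> * (b' * b') + 2 * \<beta> * (d' * d') - 2 * l * (b' * d') = (a' * d' - b' * c')\<^sup>2 * (1 + X)"
      unfolding \<alpha> \<beta> l_def by (simp add: algebra_simps power2_eq_square)
    then have m22: "2 * (\<alpha> * (b' * b') + \<beta> * (d' * d')) = 1 + X" by (simp add: D l)
    have "2 * \<alpha> * (a' * b') + 2 * \<beta> * (c' * d') - l * (a' * d' + b' * c') = (a' * d' - b' * c')\<^sup>2 * Y"
      unfolding \<alpha> \<beta> l_def by (simp add: algebra_simps power2_eq_square)
    then have m12: "2 * (\<alpha> * (a' * b') + \<beta> * (c' * d')) = Y" by (simp add: D l)
    define n m where "n = a'\<^sup>2 + b'\<^sup>2" and "m = c'\<^sup>2 + d'\<^sup>2"
    have nm: "0 < n" "0 < m"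
      using nz by (auto simp: n_def m_def r sum_power2_gt_zero_iff)
    have sum1: "\<alpha> * n + \<beta> * m = 1"
      using m11 m22 by (simp add: n_def m_def power2_eq_square algebra_simps)
    have P: "\<alpha> * n * Re (cay (pt a b)) = \<alpha> * (b'\<^sup>2 - a'\<^sup>2)"
      "\<alpha> * n * Im (cay (pt a b)) = \<alpha> * (2 * (a' * b'))"
      "\<beta> * m * Re (cay (pt c d)) = \<beta> * (d'\<^sup>2 - c'\<^sup>2)"
      "\<beta> * m * Im (cay (pt c d)) = \<beta> * (2 * (c' * d'))"
      using nm by (simp_all add: cay_pt[OF nz(1)] cay_pt[OF nz(2)] r[symmetric] n_def[symmetric] m_def[symmetric])
    have "w = (1 - \<beta> * m) *\<^sub>R cay (pt a b) + (\<beta> * m) *\<^sub>R cay (pt c d)"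
    proof (rule complex_eqI)
      have e: "1 - \<beta> * m = \<alpha> * n" using sum1 by simp
      show "Re w = Re ((1 - \<beta> * m) *\<^sub>R cay (pt a b) + (\<beta> * m) *\<^sub>R cay (pt c d))"
        unfolding e plus_complex.sel scaleR_complex.sel P using m11 m22 by (simp add: X_def[symmetric] algebra_simps power2_eq_square)
      show "Im w = Im ((1 - \<beta> * m) *\<^sub>R cay (pt a b) + (\<beta> * m) *\<^sub>R cay (pt c d))"
        unfolding e plus_complex.sel scaleR_complex.sel P using m12 by (simp add: Y_def[symmetric] algebra_simps)
    qed
    moreover have "0 < \<beta> * m" "\<beta> * m < 1"
      using pos nm sum1 by (auto simp: add_pos_pos) (metis less_add_same_cancel2 mult_pos_pos)
    moreover have "cay (pt a b) \<noteq> cay (pt c d)"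
    proof
      assume eq: "cay (pt a b) = cay (pt c d)"
      have "w = cay (pt c d)" using calculation(1) by (simp add: eq flip: scaleR_left_distrib)
      then show False using w cay_norm by simp
    qed
    ultimately show "klein z \<in> open_segment (cay (pt a b)) (cay (pt c d))"
      unfolding in_segment w_def[symmetric] by blast
  qed
  then show ?thesis unfolding geodesic_def klein_def by blast
qed

lemma farey_tesselation_pt:
  "farey_tesselation = {geodesic (pt a b) (pt c d) | a b c d. a * d - b * c = 1}"
proof -
  have "geodesic (e_init A) (e_term A) \<in> {geodesic (pt a b) (pt c d) | a b c d. a * d - b * c = 1}" for A
  proof -
    obtain a b c d where "a * d - b * c = 1" "A = psl a b c d" by (rule psl_cases)
    then show ?thesis by (auto simp: e_init_psl e_term_psl)
  qed
  moreover have "geodesic (pt a b) (pt c d) \<in> farey_tesselation" if "a * d - b * c = 1" for a b c d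
    unfolding farey_tesselation_def using that
    by (intro image_eqI[of _ _ "psl a b c d"]) (simp_all add: e_init_psl e_term_psl)
  ultimately show ?thesis unfolding farey_tesselation_def by blast
qed

section \<open>Generations\<close>

abbreviation farey_complement :: "complex set" where
  "farey_complement \<equiv> ball 0 1 - \<Union> farey_tesselation"

lemma pt_uminus: "pt (- a) (- b) = pt a b"
  by (simp add: pt_def)

lemma chord_in_farey:
  assumes "\<bar>a * d - b * c\<bar> = 1" "z \<in> ball 0 1" "chord_form a b c d (klein z) = 0"
  shows "z \<in> \<Union> farey_tesselation"
proof -
  have z: "z \<in> geodesic (pt a b) (pt c d)" using assms by (simp add: geodesic_pt)
  have "geodesic (pt a b) (pt c d) \<in> farey_tesselation"
  proof (cases "a * d - b * c = 1")
    case True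
    then show ?thesis unfolding farey_tesselation_pt by blast
  next
    case False
    then have "(- a) * d - (- b) * c = 1" using assms(1) by linarith
    then have "geodesic (pt (- a) (- b)) (pt c d) \<in> farey_tesselation"
      unfolding farey_tesselation_pt by blast
    then show ?thesis by (simp add: pt_uminus)
  qed
  with z show ?thesis by blast
qed

lemma triangle_avoids_farey:
  assumes det: "\<bar>a * d - b * c\<bar> = 1" and z: "z \<in> ball 0 1"
    and "chord_form a b c d (klein z) < 0"
    and "0 < chord_form a b (a + c) (b + d) (klein z)"
    and "0 < chord_form c d (a + c) (b + d) (klein z)"
  shows "z \<in> farey_complement"
proof -
  have False if edge: "z \<in> \<Union> farey_tesselation"
  proof -
    obtain x y x' y' where d: "x * y' - y * x' = 1" and "z \<in> geodesic (pt x y) (pt x' y')"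
      using edge unfolding farey_tesselation_pt by blast
    then have "klein z \<in> open_segment (cay (pt x y)) (cay (pt x' y'))"
      by (simp add: geodesic_def klein_def)
    then obtain t where t: "0 < t" "t < 1"
        "klein z = (1 - t) *\<^sub>R cay (pt x y) + t *\<^sub>R cay (pt x' y')"
      by (auto simp: in_segment)
    have nz: "x \<noteq> 0 \<or> y \<noteq> 0" "x' \<noteq> 0 \<or> y' \<noteq> 0" using d by auto
    define k where "k = (1 - t) * (2 / ((of_int x)\<^sup>2 + (of_int y)\<^sup>2))"
    define l where "l = t * (2 / ((of_int x')\<^sup>2 + (of_int y')\<^sup>2))"
    have kl: "0 < k" "0 < l"
      unfolding k_def l_def using t nz
      by (auto intro!: mult_pos_pos divide_pos_pos simp: sum_power2_gt_zero_iff)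
    have form: "chord_form u v u' v' (klein z) = k * of_int ((u * y - v * x) * (u' * y - v' * x))
        + l * of_int ((u * y' - v * x') * (u' * y' - v' * x'))" for u v u' v'
      by (simp only: t(3) chord_form_affine chord_form_cay[OF nz(1)] chord_form_cay[OF nz(2)]
        k_def l_def mult.assoc)
    have "(a * y - b * x) * (c * y' - d * x') - (c * y - d * x) * (a * y' - b * x')
        = (a * d - b * c) * (x * y' - y * x')"
      by (simp add: algebra_simps)
    then have "\<bar>(a * y - b * x) * (c * y' - d * x') - (c * y - d * x) * (a * y' - b * x')\<bar> = 1"
      using det d by simp
    from farey_edge_avoids_triangle[OF this kl] show False
      using assms(3-5) unfolding form by (simp add: algebra_simps)
  qed
  then show ?thesis using z by blast
qed

text \<open>
The triangles that the radius to \<open>w\<close> enters before it crosses the edge between \<open>pt a b\<close> and \<open>pt c d\<close>, for \<open>w\<close> beyond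
this edge and rows in the same closed quadrant, for which the form is nonnegative at the origin.
\<close>

definition origin_side :: "int \<Rightarrow> int \<Rightarrow> int \<Rightarrow> int \<Rightarrow> complex \<Rightarrow> complex set set" where
  "origin_side a b c d w = {t \<in> components farey_complement.
     \<exists>z \<in> closed_segment 0 w \<inter> t. 0 < chord_form a b c d (klein z)}"

lemma origin_side_commute: "origin_side a b c d = origin_side c d a b"
  unfolding origin_side_def chord_form_commute[of a b] ..

lemma radial_speed:
  fixes s t :: real
  assumes "0 \<le> s" "s \<le> t" "t \<le> 1"
  shows "2 * s / (1 + s\<^sup>2) \<le> 2 * t / (1 + t\<^sup>2)"
proof -
  have "0 \<le> (t - s) * (1 - s * t)"
    using assms by (intro mult_nonneg_nonneg) (auto simp: mult_le_one)
  then have "2 * s * (1 + t\<^sup>2) \<le> 2 * t * (1 + s\<^sup>2)"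
    by (simp add: algebra_simps power2_eq_square)
  moreover have "0 < 1 + s\<^sup>2" "0 < 1 + t\<^sup>2" by (simp_all add: add_pos_nonneg)
  ultimately show ?thesis by (simp add: divide_le_eq le_divide_eq mult.commute)
qed

lemma radial_speed_less_1:
  fixes s :: real
  assumes "0 \<le> s" "s < 1" shows "0 \<le> 2 * s / (1 + s\<^sup>2)" "2 * s / (1 + s\<^sup>2) < 1"
proof -
  have "0 < (1 - s)\<^sup>2" using assms by simp
  then have "2 * s < 1 + s\<^sup>2" by (simp add: power2_eq_square algebra_simps)
  moreover have "0 < 1 + s\<^sup>2" by (simp add: add_pos_nonneg)
  ultimately show "0 \<le> 2 * s / (1 + s\<^sup>2)" "2 * s / (1 + s\<^sup>2) < 1" using assms(1) by simp_all
qed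

text \<open>
Along a radius the form is affine in the Klein distance \<open>2 s / (1 + s\<^sup>2)\<close> from the origin.
\<close>

lemma chord_form_radial:
  assumes "cmod w = 1"
  shows "chord_form a b c d (klein (s *\<^sub>R w)) =
    of_int (a * c + b * d) + 2 * s / (1 + s\<^sup>2) * (chord_form a b c d w - of_int (a * c + b * d))"
proof -
  have "chord_form a b c d (r *\<^sub>R w) =
      of_int (a * c + b * d) + r * (chord_form a b c d w - of_int (a * c + b * d))" for r
    by (simp add: chord_form_def algebra_simps)
  then show ?thesis unfolding klein_radial[OF assms] .
qed

lemma chord_form_radial_mono:
  assumes "cmod w = 1" "chord_form a b c d w \<le> 0" "0 \<le> a * c + b * d"
    and "0 \<le> s" "s \<le> t" "t \<le> 1"
  shows "chord_form a b c d (klein (t *\<^sub>R w)) \<le> chord_form a b c d (klein (s *\<^sub>R w))"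
proof -
  have "chord_form a b c d w - of_int (a * c + b * d) \<le> 0"
    using assms(2,3) by linarith
  then show ?thesis
    unfolding chord_form_radial[OF assms(1)]
    by (intro add_left_mono mult_right_mono_neg radial_speed[OF assms(4-6)])
qed

lemma chord_form_radial_pos:
  assumes "cmod w = 1" "0 \<le> chord_form a b c d w" "0 < a * c + b * d" "0 \<le> s" "s < 1"
  shows "0 < chord_form a b c d (klein (s *\<^sub>R w))"
proof -
  define k :: real where "k = of_int (a * c + b * d)"
  define r where "r = 2 * s / (1 + s\<^sup>2)"
  have "0 < k" using assms(3) unfolding k_def by (simp only: of_int_0_less_iff)
  moreover have "0 \<le> r" "r < 1" using radial_speed_less_1[OF assms(4,5)] by (simp_all add: r_def)
  ultimately have "0 < (1 - r) * k + r * chord_form a b c d w"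
    using assms(2) by (intro add_pos_nonneg mult_pos_pos mult_nonneg_nonneg) auto
  also have "\<dots> = chord_form a b c d (klein (s *\<^sub>R w))"
    unfolding chord_form_radial[OF assms(1)] r_def[symmetric] k_def[symmetric]
    by (simp add: algebra_simps)
  finally show ?thesis .
qed

lemma continuous_on_klein: "continuous_on S (\<lambda>z. chord_form a b c d (klein z))"
proof -
  have "1 + (cmod z)\<^sup>2 \<noteq> 0" for z by (metis add_pos_nonneg less_numeral_extra(3) zero_le_power2 zero_less_one)
  then show ?thesis
    unfolding chord_form_def klein_def by (intro continuous_intros) auto
qed

text \<open>
A connected set that avoids the tesselation cannot change sides of an edge, by the intermediate value
theorem for the form of the edge.
\<close>

lemma chord_separates:
  assumes det: "\<bar>a * d - b * c\<bar> = 1" and "connected T" "T \<subseteq> farey_complement"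
    and "z \<in> T" "z' \<in> T" "0 < chord_form a b c d (klein z)"
  shows "0 < chord_form a b c d (klein z')"
proof (rule ccontr)
  let ?f = "\<lambda>z. chord_form a b c d (klein z)"
  assume "\<not> 0 < ?f z'"
  moreover have "connected (?f ` T)"
    by (rule connected_continuous_image[OF continuous_on_klein assms(2)])
  ultimately have "0 \<in> ?f ` T"
    using connectedD_interval[of "?f ` T" "?f z'" "?f z" 0] assms by auto
  then obtain y where "y \<in> T" "?f y = 0" by auto
  then show False using chord_in_farey[OF det, of y] assms(3) by blast
qed

text \<open>
Let \<open>r = p + q\<close> be the mediant of the rows. Beyond the edge \<open>p q\<close> and before the edge \<open>p r\<close>, the radius is inside the
triangle \<open>p q r\<close>, which the tesselation avoids. This portion is nonempty, as the forms of \<open>p r\<close> and \<open>p q\<close> differ by a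
positive form, and connected, as both forms decrease along the radius. So it lies in
a single component \<open>T\<close>. The edge \<open>p q\<close> separates \<open>T\<close> from the triangles met before. The condition on \<open>x\<close> and \<open>y\<close> allows
the radius to end at \<open>r\<close>.
\<close>

lemma origin_side_mediant:
  assumes det: "\<bar>a * d - b * c\<bar> = 1" and quad: "0 \<le> a * c" "0 \<le> b * d"
    and beyond: "(a * y - b * x) * (c * y - d * x) < 0"
    and first: "(a * y - b * x) * ((a + c) * y - (b + d) * x) \<le> 0"
  defines "w \<equiv> cay (pt x y)"
  obtains T where "T \<notin> origin_side a b c d w"
    "origin_side a b (a + c) (b + d) w = insert T (origin_side a b c d w)"
proof -
  let ?f = "\<lambda>s. chord_form a b c d (klein (s *\<^sub>R w))"
  let ?g = "\<lambda>s. chord_form a b (a + c) (b + d) (klein (s *\<^sub>R w))"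
  let ?h = "\<lambda>s. chord_form c d (a + c) (b + d) (klein (s *\<^sub>R w))"
  have w: "cmod w = 1" by (simp add: w_def cay_norm)
  have nz: "x \<noteq> 0 \<or> y \<noteq> 0" using beyond by auto
  then have k: "0 < 2 / ((real_of_int x)\<^sup>2 + (real_of_int y)\<^sup>2)" by (simp add: sum_power2_gt_zero_iff)
  \<comment> \<open>On the far side of the edge \<open>p q\<close>, the inner side of \<open>q r\<close> contains the outer side of \<open>p r\<close>.\<close>
  have last: "0 \<le> (c * y - d * x) * ((a + c) * y - (b + d) * x)"
  proof -
    define X1 X2 where "X1 = a * y - b * x" and "X2 = c * y - d * x"
    have "(a + c) * y - (b + d) * x = X1 + X2" by (simp add: X1_def X2_def algebra_simps)
    moreover have "X1 * X2 < 0" using beyond by (simp add: X1_def X2_def)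
    moreover have "X1 * (X1 + X2) \<le> 0" using first calculation(1) by (simp add: X1_def)
    ultimately show ?thesis
      unfolding X2_def[symmetric] by (auto simp: mult_less_0_iff mult_le_0_iff intro: mult_nonpos_nonpos)
  qed
  have F: "chord_form a b c d w < 0"
    unfolding w_def chord_form_cay[OF nz] using k beyond
    by (intro mult_pos_neg) (simp_all only: of_int_less_0_iff)
  have G: "chord_form a b (a + c) (b + d) w \<le> 0"
    unfolding w_def chord_form_cay[OF nz] using k first
    by (intro mult_nonneg_nonpos) (simp_all only: of_int_le_0_iff less_imp_le)
  have H: "0 \<le> chord_form c d (a + c) (b + d) w"
    unfolding w_def chord_form_cay[OF nz] using k last
    by (intro mult_nonneg_nonneg) (simp_all only: of_int_0_le_iff less_imp_le)
  have ab: "a \<noteq> 0 \<or> b \<noteq> 0" and cd: "c \<noteq> 0 \<or> d \<noteq> 0" using det by auto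
  have dot: "0 \<le> a * c + b * d" using quad by simp
  have "0 < a * a + b * b" "0 < c * c + d * d"
    using ab cd by (simp_all add: sum_power2_gt_zero_iff flip: power2_eq_square)
  then have dotg: "0 \<le> a * (a + c) + b * (b + d)" and doth: "0 < c * (a + c) + d * (b + d)"
    using quad by (simp_all add: algebra_simps)
  have ball: "s *\<^sub>R w \<in> ball 0 1" if "0 \<le> s" "s < 1" for s using that w by simp
  have fg: "?f s < ?g s" if "0 \<le> s" "s < 1" for s
    unfolding chord_form_mediant
    using chord_form_diag_pos[OF cmod_klein_less ab] ball[OF that] by simp
  have h: "0 < ?h s" if "0 \<le> s" "s < 1" for s
    by (rule chord_form_radial_pos[OF w H doth that])
  have seg: "\<exists>s. 0 \<le> s \<and> s < 1 \<and> z = s *\<^sub>R w" if "z \<in> closed_segment 0 w" "z \<in> ball 0 1" for z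
    using that w by (auto simp: in_segment)
  have contf: "continuous_on {0..1} ?f" and contg: "continuous_on {0..1} ?g"
    unfolding chord_form_radial[OF w]
    by (intro continuous_intros; simp add: add_pos_nonneg less_imp_neq[symmetric])+
  obtain s1 where s1: "0 \<le> s1" "s1 < 1" "?f s1 < 0" "0 < ?g s1"
  proof -
    have f1: "?f 1 = chord_form a b c d w"
      using chord_form_radial[OF w, of a b c d 1] by simp
    have "?f 0 = of_int (a * c + b * d)"
      using chord_form_radial[OF w, of a b c d 0] by simp
    then have "?f 1 \<le> 0" "0 \<le> ?f 0"
      using F dot f1 by (simp_all only: of_int_0_le_iff less_imp_le)
    then obtain s0 where s0: "0 \<le> s0" "s0 \<le> 1" "?f s0 = 0"
      using IVT2'[of ?f 1 0 0] contf by auto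
    have "?f 1 < 0" using F f1 by simp
    then have "s0 < 1" using s0 by (cases "s0 = 1") auto
    then have "0 < ?g s0" using fg[of s0] s0 by simp
    then obtain \<delta> where \<delta>: "0 < \<delta>" "\<And>s. s \<in> {0..1} \<Longrightarrow> \<bar>s - s0\<bar> < \<delta> \<Longrightarrow> \<bar>?g s - ?g s0\<bar> < ?g s0"
      using contg s0 unfolding continuous_on_iff dist_real_def by (metis atLeastAtMost_iff)
    \<comment> \<open>The radius crosses the edge \<open>p q\<close> at \<open>s0\<close>; a point slightly beyond is still before \<open>p r\<close>.\<close>
    define s where "s = s0 + min (\<delta> / 2) ((1 - s0) / 2)"
    have s: "s0 < s" "s < 1" "\<bar>s - s0\<bar> < \<delta>"
      using \<delta>(1) \<open>s0 < 1\<close> by (auto simp: s_def min_def field_simps)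
    have "0 < ?g s" using \<delta>(2)[of s] s s0 by auto
    moreover have "?f s < 0"
    proof -
      have "2 * s0 * (1 + s\<^sup>2) < 2 * s * (1 + s0\<^sup>2)"
      proof -
        have "s0 * s < 1 * 1" using s s0 by (intro mult_strict_mono') auto
        then have "0 < (s - s0) * (1 - s0 * s)"
          using s s0 by (intro mult_pos_pos) auto
        then show ?thesis by (simp add: algebra_simps power2_eq_square)
      qed
      moreover have "0 < 1 + s0\<^sup>2" "0 < 1 + s\<^sup>2" by (simp_all add: add_pos_nonneg)
      ultimately have "2 * s0 / (1 + s0\<^sup>2) < 2 * s / (1 + s\<^sup>2)"
        by (simp add: divide_less_eq less_divide_eq mult.commute)
      moreover have "chord_form a b c d w - of_int (a * c + b * d) < 0"
        using F dot by linarith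
      ultimately have "?f s < ?f s0"
        unfolding chord_form_radial[OF w] by (intro add_strict_left_mono mult_strict_right_mono_neg)
      then show ?thesis using s0 by simp
    qed
    ultimately show ?thesis using that[of s] s s0 by auto
  qed
  define T where "T = connected_component_set farey_complement (s1 *\<^sub>R w)"
  have tri: "s *\<^sub>R w \<in> farey_complement" if "0 \<le> s" "s < 1" "?f s < 0" "0 < ?g s" for s
    using triangle_avoids_farey[OF det ball that(3,4) h] that by simp
  have z1: "s1 *\<^sub>R w \<in> farey_complement" using tri s1 by blast
  have T: "T \<in> components farey_complement" unfolding T_def components_def using z1 by blast
  have z1T: "s1 *\<^sub>R w \<in> T" unfolding T_def using z1 by simp
  have z1seg: "s1 *\<^sub>R w \<in> closed_segment 0 w" using s1 by (auto simp: in_segment)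
  have "T \<notin> origin_side a b c d w"
  proof
    assume "T \<in> origin_side a b c d w"
    then obtain z where "z \<in> T" "0 < chord_form a b c d (klein z)" by (auto simp: origin_side_def)
    then have "0 < ?f s1"
      using chord_separates[OF det in_components_connected[OF T] in_components_subset[OF T] _ z1T]
      by blast
    then show False using s1 by simp
  qed
  moreover have "origin_side a b (a + c) (b + d) w = insert T (origin_side a b c d w)"
  proof (intro equalityI subsetI)
    fix t assume t: "t \<in> insert T (origin_side a b c d w)"
    show "t \<in> origin_side a b (a + c) (b + d) w"
    proof (cases "t = T")
      case True
      then show ?thesis using T z1T z1seg s1 by (auto simp: origin_side_def)
    next
      case False
      then obtain z where z: "t \<in> components farey_complement" "z \<in> closed_segment 0 w" "z \<in> t"
        "0 < chord_form a b c d (klein z)"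
        using t by (auto simp: origin_side_def)
      then have "z \<in> ball 0 1" using in_components_subset by blast
      then have "0 < chord_form a b (a + c) (b + d) (klein z)"
        using seg[OF z(2)] fg z(4) by fastforce
      then show ?thesis using z by (auto simp: origin_side_def)
    qed
  next
    fix t assume "t \<in> origin_side a b (a + c) (b + d) w"
    then obtain z where z: "t \<in> components farey_complement" "z \<in> closed_segment 0 w" "z \<in> t"
      "0 < chord_form a b (a + c) (b + d) (klein z)"
      by (auto simp: origin_side_def)
    then have zc: "z \<in> farey_complement" using in_components_subset by blast
    then obtain s where s: "0 \<le> s" "s < 1" "z = s *\<^sub>R w" using seg z by blast
    consider "0 < ?f s" | "?f s = 0" | "?f s < 0" by linarith
    then show "t \<in> insert T (origin_side a b c d w)"
    proof cases
      case 1
      then show ?thesis using z s by (auto simp: origin_side_def)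
    next
      case 2
      then show ?thesis using chord_in_farey[OF det, of z] zc s by simp
    next
      case 3
      have "closed_segment (s1 *\<^sub>R w) z \<subseteq> farey_complement"
      proof
        fix u assume "u \<in> closed_segment (s1 *\<^sub>R w) z"
        then obtain v where v: "0 \<le> v" "v \<le> 1" "u = (1 - v) *\<^sub>R (s1 *\<^sub>R w) + v *\<^sub>R z"
          by (auto simp: in_segment)
        define r where "r = (1 - v) * s1 + v * s"
        have r: "r \<in> closed_segment s1 s" "u = r *\<^sub>R w"
          using v by (auto simp: in_segment r_def s(3) scaleR_left_distrib)
        then have mm: "min s1 s \<le> r" "r \<le> max s1 s" by (auto simp: closed_segment_eq_real_ivl split: if_splits)
        have r01: "0 \<le> r" "r < 1" using mm s s1 by auto
        have "?f r \<le> ?f (min s1 s)"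
          by (rule chord_form_radial_mono[OF w less_imp_le[OF F] dot]) (use mm s s1 in auto)
        then have "?f r < 0" using s1 3 by (auto simp: min_def split: if_splits)
        moreover have "?g (max s1 s) \<le> ?g r"
          by (rule chord_form_radial_mono[OF w G dotg]) (use mm r01 s s1 in auto)
        then have "0 < ?g r" using s1 z(4) s by (auto simp: max_def split: if_splits)
        ultimately show "u \<in> farey_complement" using tri r01 r by simp
      qed
      then have "closed_segment (s1 *\<^sub>R w) z \<subseteq> T"
        unfolding T_def by (intro connected_component_maximal) auto
      then have "z \<in> T" by auto
      then have "t = T" using components_eq[OF T z(1)] z(3) by blast
      then show ?thesis by simp
    qed
  qed
  ultimately show ?thesis using that by blast
qed

lemma row_dot_mediant_pos:
  fixes a b c d :: int
  assumes "\<bar>a * d - b * c\<bar> = 1" "0 \<le> a * c" "0 \<le> b * d"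
  shows "0 < a * (a + c) + b * (b + d)"
proof -
  have "a \<noteq> 0 \<or> b \<noteq> 0" using assms(1) by auto
  then have "0 < a * a + b * b"
    by (simp add: sum_power2_gt_zero_iff flip: power2_eq_square)
  then show ?thesis using assms(2,3) by (simp add: algebra_simps)
qed

lemma generation_mediant:
  assumes "\<bar>a * d - b * c\<bar> = 1" "0 \<le> a * c" "0 \<le> b * d"
  defines "w \<equiv> cay (pt (a + c) (b + d))"
  shows "generation (pt (a + c) (b + d)) = card (origin_side a b (a + c) (b + d) w)"
proof -
  have w: "cmod w = 1" by (simp add: w_def cay_norm)
  note dot = row_dot_mediant_pos[OF assms(1-3)]
  then have "a + c \<noteq> 0 \<or> b + d \<noteq> 0" by auto
  then have F: "chord_form a b (a + c) (b + d) w = 0"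
    by (simp add: w_def chord_form_cay)
  have "closed_segment 0 w \<inter> t \<noteq> {} \<longleftrightarrow>
      (\<exists>z\<in>closed_segment 0 w \<inter> t. 0 < chord_form a b (a + c) (b + d) (klein z))"
    if t: "t \<in> components farey_complement" for t
  proof -
    have "0 < chord_form a b (a + c) (b + d) (klein z)" if z: "z \<in> closed_segment 0 w" "z \<in> t" for z
    proof -
      have "cmod z < 1" using in_components_subset[OF t] z(2) by auto
      then obtain s where "0 \<le> s" "s < 1" "z = s *\<^sub>R w"
        using z(1) w by (auto simp: in_segment)
      then show ?thesis using chord_form_radial_pos[OF w _ dot, of s] F by simp
    qed
    then show ?thesis by blast
  qed
  then show ?thesis
    unfolding generation_def origin_side_def w_def[symmetric] by (intro arg_cong[of _ _ card]) blast
qed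

lemma generation_base: "generation (pt 1 0) = 0" "generation (pt 0 1) = 0"
proof -
  have "closed_segment 0 (cay (pt a b)) \<inter> t = {}"
    if "t \<in> components farey_complement" "(a, b) = (1, 0) \<or> (a, b) = (0, 1)" for t a b
  proof (rule ccontr)
    assume "\<not> ?thesis"
    then obtain z where z: "z \<in> closed_segment 0 (cay (pt a b))" "z \<in> t" by blast
    then have zc: "z \<in> farey_complement" using in_components_subset[OF that(1)] by blast
    have "Im z = 0" using z(1) that(2) by (auto simp: in_segment pt_def cay_def)
    then have "chord_form 1 0 0 1 (klein z) = 0" by (simp add: chord_form_def klein_def)
    then show False using chord_in_farey[of 1 1 0 0 z] zc by auto
  qed
  then have "{t \<in> components farey_complement. closed_segment 0 (cay (pt a b)) \<inter> t \<noteq> {}} = {}"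
    if "(a, b) = (1, 0) \<or> (a, b) = (0, 1)" for a b
    using that by blast
  then show "generation (pt 1 0) = 0" "generation (pt 0 1) = 0"
    unfolding generation_def by (simp_all only: simp_thms card.empty)
qed

text \<open>
Every radius that ends beyond the edge enters exactly \<open>n\<close> triangles before it. The bound on the generations of
the two ends is carried along the induction to compare them with the mediant.
\<close>

definition edge_depth :: "int \<Rightarrow> int \<Rightarrow> int \<Rightarrow> int \<Rightarrow> nat \<Rightarrow> bool" where
  "edge_depth a b c d n \<longleftrightarrow> generation (pt a b) \<le> n \<and> generation (pt c d) \<le> n \<and>
    (\<forall>x y. (a * y - b * x) * (c * y - d * x) < 0 \<longrightarrow>
      finite (origin_side a b c d (cay (pt x y))) \<and> card (origin_side a b c d (cay (pt x y))) = n)"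

lemma edge_depth_commute: "edge_depth a b c d n \<longleftrightarrow> edge_depth c d a b n"
  unfolding edge_depth_def origin_side_commute[of a b c d] by (auto simp: mult.commute)

lemma edge_depth_base:
  assumes "\<bar>a\<bar> = 1" "\<bar>d\<bar> = 1" shows "edge_depth a 0 0 d 0"
proof -
  have a: "a = 1 \<or> a = -1" and d: "d = 1 \<or> d = -1" using assms by linarith+
  have "generation (pt a 0) = 0" "generation (pt 0 d) = 0"
    using a d generation_base pt_uminus[of 1 0] by (auto simp: pt_def)
  moreover have "origin_side a 0 0 d (cay (pt x y)) = {}" if xy: "a * y * (- (d * x)) < 0" for x y
  proof -
    let ?w = "cay (pt x y)"
    have nz: "x \<noteq> 0 \<or> y \<noteq> 0" using xy by auto
    have "chord_form a 0 0 d ?w \<le> 0"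
      unfolding chord_form_cay[OF nz] using xy
      by (intro mult_nonneg_nonpos) (simp_all only: of_int_le_0_iff, simp_all)
    then have "chord_form a 0 0 d (klein (s *\<^sub>R ?w)) \<le> 0" if "0 \<le> s" for s
      unfolding chord_form_radial[OF cay_norm] using that by (simp add: mult_nonneg_nonpos divide_nonpos_nonneg)
    then show ?thesis by (fastforce simp: origin_side_def in_segment)
  qed
  ultimately show ?thesis by (simp add: edge_depth_def)
qed

lemma edge_depth_mediant:
  assumes det: "\<bar>a * d - b * c\<bar> = 1" and quad: "0 \<le> a * c" "0 \<le> b * d"
    and n: "edge_depth a b c d n"
  shows "edge_depth a b (a + c) (b + d) (Suc n)" "generation (pt (a + c) (b + d)) = Suc n"
proof -
  have step: "finite (origin_side a b (a + c) (b + d) (cay (pt x y))) \<and>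
      card (origin_side a b (a + c) (b + d) (cay (pt x y))) = Suc n"
    if beyond: "(a * y - b * x) * (c * y - d * x) < 0"
      and first: "(a * y - b * x) * ((a + c) * y - (b + d) * x) \<le> 0" for x y
  proof -
    obtain T where "T \<notin> origin_side a b c d (cay (pt x y))"
      "origin_side a b (a + c) (b + d) (cay (pt x y)) = insert T (origin_side a b c d (cay (pt x y)))"
      by (rule origin_side_mediant[OF det quad beyond first])
    then show ?thesis using n beyond by (simp add: edge_depth_def)
  qed
  have "(a * (b + d) - b * (a + c)) * (c * (b + d) - d * (a + c)) = - ((a * d - b * c)\<^sup>2)"
    by (simp add: algebra_simps power2_eq_square)
  moreover have "(a * d - b * c)\<^sup>2 \<noteq> 0" using det by auto
  ultimately have "(a * (b + d) - b * (a + c)) * (c * (b + d) - d * (a + c)) < 0"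
    by (simp only: neg_less_0_iff_less zero_less_power2) auto
  then show gen: "generation (pt (a + c) (b + d)) = Suc n"
    using step[of "b + d" "a + c"] generation_mediant[OF det quad] by (simp add: algebra_simps)
  have "(a * y - b * x) * (c * y - d * x) < 0"
    if "(a * y - b * x) * ((a + c) * y - (b + d) * x) < 0" for x y
  proof -
    have "(a * y - b * x) * (c * y - d * x) =
        (a * y - b * x) * ((a + c) * y - (b + d) * x) - (a * y - b * x)\<^sup>2"
      by (simp add: algebra_simps power2_eq_square)
    then show ?thesis using that by (smt (verit) zero_le_power2)
  qed
  then show "edge_depth a b (a + c) (b + d) (Suc n)"
    using step n gen unfolding edge_depth_def by (auto simp: less_imp_le)
qed

lemma edge_depth_exists:
  assumes "\<bar>a * d - b * c\<bar> = 1" "0 \<le> a * c" "0 \<le> b * d"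
  shows "\<exists>n. edge_depth a b c d n"
  using assms
proof (induction "nat (\<bar>a\<bar> + \<bar>b\<bar> + \<bar>c\<bar> + \<bar>d\<bar>)" arbitrary: a b c d rule: less_induct)
  case less
  have child: "\<exists>n. edge_depth a b c d n"
    if det: "\<bar>a * d - b * c\<bar> = 1" and quad: "0 \<le> a * c" "0 \<le> b * d"
      and le: "\<bar>a\<bar> \<le> \<bar>c\<bar>" "\<bar>b\<bar> \<le> \<bar>d\<bar>"
      and IH: "\<And>c' d'. \<bar>a\<bar> + \<bar>b\<bar> + \<bar>c'\<bar> + \<bar>d'\<bar> < \<bar>a\<bar> + \<bar>b\<bar> + \<bar>c\<bar> + \<bar>d\<bar> \<Longrightarrow>
        \<bar>a * d' - b * c'\<bar> = 1 \<Longrightarrow> 0 \<le> a * c' \<Longrightarrow> 0 \<le> b * d' \<Longrightarrow> \<exists>n. edge_depth a b c' d' n"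
    for a b c d
  proof -
    have ab: "a \<noteq> 0 \<or> b \<noteq> 0" using det by auto
    have sub: "\<bar>c\<bar> = \<bar>a\<bar> + \<bar>c - a\<bar>" "\<bar>d\<bar> = \<bar>b\<bar> + \<bar>d - b\<bar>"
      using abs_diff_same_sign quad le by blast+
    have det': "\<bar>a * (d - b) - b * (c - a)\<bar> = 1" using det by (simp add: algebra_simps)
    have pos: "0 \<le> x * (y - x)" if "0 \<le> x * y" "\<bar>x\<bar> \<le> \<bar>y\<bar>" for x y :: int
      using that by (auto simp: zero_le_mult_iff)
    have quad': "0 \<le> a * (c - a)" "0 \<le> b * (d - b)" using pos quad le by blast+
    have "\<bar>a\<bar> + \<bar>b\<bar> + \<bar>c - a\<bar> + \<bar>d - b\<bar> < \<bar>a\<bar> + \<bar>b\<bar> + \<bar>c\<bar> + \<bar>d\<bar>"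
      using sub ab by linarith
    from IH[OF this det' quad'] obtain n where "edge_depth a b (c - a) (d - b) n" by blast
    from edge_depth_mediant(1)[OF det' quad' this] show ?thesis by auto
  qed
  from farey_comparable[OF less.prems(1)] consider
    "\<bar>a\<bar> \<le> \<bar>c\<bar>" "\<bar>b\<bar> \<le> \<bar>d\<bar>" | "\<bar>c\<bar> \<le> \<bar>a\<bar>" "\<bar>d\<bar> \<le> \<bar>b\<bar>" | "a = 0" "d = 0" | "b = 0" "c = 0"
    by blast
  then show ?case
  proof cases
    case 1
    show ?thesis by (rule child[OF less.prems 1]) (rule less.hyps; simp)
  next
    case 2
    have "\<exists>n. edge_depth c d a b n"
    proof (rule child[OF _ _ _ 2])
      show "\<bar>c * b - d * a\<bar> = 1" "0 \<le> c * a" "0 \<le> d * b"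
        using less.prems by (simp_all add: algebra_simps abs_minus_commute)
    qed (rule less.hyps; simp)
    then show ?thesis using edge_depth_commute by blast
  next
    case 3
    then have "\<bar>c\<bar> * \<bar>b\<bar> = 1" using less.prems(1) by (simp add: abs_mult mult.commute)
    from abs_mult_eq_one[OF this] have "\<bar>c\<bar> = 1" "\<bar>b\<bar> = 1" .
    then show ?thesis using edge_depth_base[of c b] edge_depth_commute 3 by blast
  next
    case 4
    then have "\<bar>a\<bar> * \<bar>d\<bar> = 1" using less.prems(1) by (simp add: abs_mult mult.commute)
    from abs_mult_eq_one[OF this] have "\<bar>a\<bar> = 1" "\<bar>d\<bar> = 1" .
    then show ?thesis using edge_depth_base[of a d] 4 by blast
  qed
qed

text \<open>
The lower end of the edge is a parent of the higher one, whose generation is one more than the depth of the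
edge between its two parents.
\<close>

lemma generation_less:
  assumes det: "\<bar>a * d - b * c\<bar> = 1" and less: "height a b < height c d" and nb: "b \<noteq> 0 \<or> c \<noteq> 0"
  shows "generation (pt a b) < generation (pt c d)"
proof -
  obtain \<epsilon> where e: "\<epsilon> = 1 \<or> \<epsilon> = -1" "\<bar>c\<bar> = \<bar>a\<bar> + \<bar>c - \<epsilon> * a\<bar>" "\<bar>d\<bar> = \<bar>b\<bar> + \<bar>d - \<epsilon> * b\<bar>"
    using farey_child[OF det less] nb by metis
  define a' b' where ab: "a' = \<epsilon> * a" "b' = \<epsilon> * b"
  have "pt a' b' = pt a b" using e(1) pt_uminus[of a b] by (auto simp: ab)
  have "\<bar>a' * d - b' * c\<bar> = 1" using det e(1) by (auto simp: ab abs_minus_commute algebra_simps)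
  then have det': "\<bar>a' * (d - b') - b' * (c - a')\<bar> = 1" by (simp add: algebra_simps)
  have "0 \<le> x * (y - x)" if "\<bar>y\<bar> = \<bar>x\<bar> + \<bar>y - x\<bar>" for x y :: int
    using that by (cases "0 \<le> x"; cases "x \<le> y") (auto simp: zero_le_mult_iff)
  moreover have "\<bar>c\<bar> = \<bar>a'\<bar> + \<bar>c - a'\<bar>" "\<bar>d\<bar> = \<bar>b'\<bar> + \<bar>d - b'\<bar>"
    using e by (auto simp: ab)
  ultimately have quad': "0 \<le> a' * (c - a')" "0 \<le> b' * (d - b')" by blast+
  obtain n where n: "edge_depth a' b' (c - a') (d - b') n"
    using edge_depth_exists[OF det' quad'] by blast
  then have "generation (pt a' b') \<le> n" by (simp add: edge_depth_def)
  moreover have "generation (pt c d) = Suc n"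
    using edge_depth_mediant(2)[OF det' quad' n] by simp
  ultimately show ?thesis using \<open>pt a' b' = pt a b\<close> by simp
qed

lemma height_neq:
  assumes "\<bar>a * d - b * c\<bar> = 1" shows "height a b \<noteq> height c d"
proof
  assume eq: "height a b = height c d"
  have "\<not> (a = 0 \<and> d = 0)" "\<not> (b = 0 \<and> c = 0)"
  proof -
    show "\<not> (a = 0 \<and> d = 0)"
    proof
      assume z: "a = 0 \<and> d = 0"
      then have "\<bar>b\<bar> * \<bar>c\<bar> = 1" using assms by (simp add: abs_mult)
      from abs_mult_eq_one[OF this] have "\<bar>b\<bar> = 1" "\<bar>c\<bar> = 1" .
      then show False using eq z by (simp add: height_def)
    qed
    show "\<not> (b = 0 \<and> c = 0)"
    proof
      assume z: "b = 0 \<and> c = 0"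
      then have "\<bar>a\<bar> * \<bar>d\<bar> = 1" using assms by (simp add: abs_mult)
      from abs_mult_eq_one[OF this] have "\<bar>a\<bar> = 1" "\<bar>d\<bar> = 1" .
      then show False using eq z by (simp add: height_def)
    qed
  qed
  then have "\<bar>a\<bar> = \<bar>c\<bar> \<and> \<bar>b\<bar> = \<bar>d\<bar>"
    using farey_comparable[OF assms] eq by (auto simp: height_def)
  moreover from unimodular_same_quadrant[OF assms] have "a * d - b * c = 0"
    using calculation by (auto simp: abs_eq_iff zero_le_mult_iff mult_le_0_iff)
  ultimately show False using assms by simp
qed

text \<open>
On an edge other than the one between \<open>0\<close> and \<open>\<infinity>\<close>, generation and height both increase from the parent to the
child. The edge from \<open>0\<close> to \<open>\<infinity>\<close> belongs to \<open>O_set\<close> by definition, and its reverse does not, since both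
ends have generation \<open>0\<close>.
\<close>

theorem O_set_iff_height:
  assumes det: "a * d - b * c = 1"
  shows "psl a b c d \<in> O_set \<longleftrightarrow> height a b < height c d"
proof -
  have base: "e_init (psl a b c d) = Some 0 \<and> e_term (psl a b c d) = None \<longleftrightarrow> b = 0 \<and> c = 0"
    using det by (auto simp: e_init_psl e_term_psl pt_def)
  have mem: "psl a b c d \<in> O_set \<longleftrightarrow> b = 0 \<and> c = 0 \<or> generation (pt a b) < generation (pt c d)"
    unfolding O_set_def mem_Collect_eq base using det by (simp add: e_init_psl e_term_psl)
  have det1: "\<bar>a * d - b * c\<bar> = 1" "\<bar>c * b - d * a\<bar> = 1" using det by (simp_all add: algebra_simps)
  show ?thesis
  proof (cases "b = 0 \<and> c = 0")
    case True
    then have "\<bar>a\<bar> * \<bar>d\<bar> = 1" using det1 by (simp add: abs_mult)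
    from abs_mult_eq_one[OF this] have "\<bar>a\<bar> = 1" "\<bar>d\<bar> = 1" .
    then show ?thesis using True mem by (simp add: height_def)
  next
    case False
    consider "height a b < height c d" | "height c d < height a b"
      using height_neq[OF det1(1)] by linarith
    then show ?thesis
    proof cases
      case 1
      then show ?thesis using generation_less[OF det1(1)] False mem by auto
    next
      case 2
      have "\<not> generation (pt a b) < generation (pt c d)"
      proof (cases "a = 0 \<and> d = 0")
        case True
        then have "\<bar>b\<bar> * \<bar>c\<bar> = 1" using det1 by (simp add: abs_mult)
        from abs_mult_eq_one[OF this] have "\<bar>b\<bar> = 1" "\<bar>c\<bar> = 1" .
        then have "pt a b = pt 0 1" "pt c d = pt 1 0" using True by (auto simp: pt_def)
        then show ?thesis by (simp add: generation_base)
      next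
        case False
        then show ?thesis using generation_less[OF det1(2) 2] by auto
      qed
      then show ?thesis using False mem 2 by auto
    qed
  qed
qed

section \<open>Reduction modulo the USA identities\<close>

text \<open>
The formal combinations that the USA identities reduce to hyperfans over \<open>O_set\<close> and the three constants.
\<close>

definition O_reducible :: "(psl2z \<Rightarrow>\<^sub>0 real) set" where
  "O_reducible = span (gen ` O_set \<union> {h_gen, e_gen, f_gen} \<union> usa_relations)"

lemma subspace_O_reducible: "subspace O_reducible"
  unfolding O_reducible_def by (rule subspace_span)

lemma gen_O_reducible:
  assumes "a * d - b * c = 1" "height a b < height c d"
  shows "gen (psl a b c d) \<in> O_reducible"
  unfolding O_reducible_def using O_set_iff_height[OF assms(1)] assms(2) by (intro span_base) simp

lemma Psi_gen_reducible:
  assumes "a * d - b * c = 1"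
  shows "Psi gen (psl a b c d) \<in> O_reducible"
proof -
  have "Psi gen (psl a b c d) - usa_rhs h_gen e_gen f_gen a b c d \<in> O_reducible"
    unfolding O_reducible_def using assms by (intro span_base) (auto simp: usa_relations_def)
  moreover have "usa_rhs h_gen e_gen f_gen a b c d \<in> O_reducible"
    unfolding usa_rhs_def O_reducible_def by (intro span_add span_scale span_base) auto
  ultimately show ?thesis
    using subspace_add[OF subspace_O_reducible] by fastforce
qed

lemma solve_two_relations:
  fixes x y :: "'v::real_vector"
  assumes "subspace V" "y - 2 *\<^sub>R x \<in> V" "x - 2 *\<^sub>R y \<in> V"
  shows "x \<in> V"
proof -
  have "x = (-(2/3)) *\<^sub>R (y - 2 *\<^sub>R x) + (-(1/3)) *\<^sub>R (x - 2 *\<^sub>R y)"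
  proof -
    have "(-(2/3)) *\<^sub>R (y - 2 *\<^sub>R x) + (-(1/3)) *\<^sub>R (x - 2 *\<^sub>R y) =
        (4/3 - 1/3) *\<^sub>R x + (2/3 - 2/3) *\<^sub>R y"
      unfolding scaleR_left_diff_distrib by (simp add: algebra_simps)
    then show ?thesis by simp
  qed
  then show ?thesis using assms by (metis subspace_add subspace_scale)
qed

lemma height_uminus: "height (- a) (- b) = height a b"
  by (simp add: height_def)

lemma abs_add_same_sign:
  fixes a c :: int
  assumes "\<bar>c\<bar> = \<bar>a\<bar> + \<bar>c - a\<bar>"
  shows "\<bar>a + c\<bar> = \<bar>a\<bar> + \<bar>c\<bar>" "\<bar>a - c\<bar> = \<bar>c\<bar> - \<bar>a\<bar>" "\<bar>c - a\<bar> = \<bar>c\<bar> - \<bar>a\<bar>"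
    "\<bar>a - c - c\<bar> = 2 * \<bar>c\<bar> - \<bar>a\<bar>" "\<bar>c - (a - c)\<bar> = 2 * \<bar>c\<bar> - \<bar>a\<bar>"
  using assms by linarith+

lemma abs_add_opposite_sign:
  fixes a c :: int
  assumes "\<bar>c\<bar> = \<bar>a\<bar> + \<bar>c + a\<bar>"
  shows "\<bar>a - c\<bar> = \<bar>a\<bar> + \<bar>c\<bar>" "\<bar>c - a\<bar> = \<bar>a\<bar> + \<bar>c\<bar>" "\<bar>a + c\<bar> = \<bar>c\<bar> - \<bar>a\<bar>"
    "\<bar>a + c + c\<bar> = 2 * \<bar>c\<bar> - \<bar>a\<bar>"
  using assms by linarith+

text \<open>
The reversed edges from \<open>q\<close> to its two parents are determined together. Let \<open>X\<close> and \<open>Y\<close> be their hyperfans. In each of the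
two USA identities for the edges from the parents to \<open>q\<close>, the other edges lead from a lower to a higher end, except
for one between the two parents, to which the induction hypothesis applies. If \<open>q\<close> is \<open>\<infinity>\<close> and the edge is the one from \<open>0\<close>, a single
identity suffices.
\<close>

lemma reversed_edge_reducible:
  assumes det: "a * d - b * c = 1" and less: "height a b < height c d"
    and IH: "\<And>u v x y. \<bar>u\<bar> + \<bar>v\<bar> + \<bar>x\<bar> + \<bar>y\<bar> < \<bar>a\<bar> + \<bar>b\<bar> + \<bar>c\<bar> + \<bar>d\<bar> \<Longrightarrow>
      u * y - v * x = 1 \<Longrightarrow> gen (psl u v x y) \<in> O_reducible"
  shows "gen (psl (- c) (- d) a b) \<in> O_reducible"
proof -
  note V = subspace_O_reducible
  note closed = subspace_add[OF V] subspace_diff[OF V] subspace_scale[OF V]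
  let ?g = "\<lambda>a b c d. gen (psl a b c d)"
  have det1: "\<bar>a * d - b * c\<bar> = 1" using det by simp
  have A: "?g a b c d \<in> O_reducible" by (rule gen_O_reducible[OF det less])
  note P = Psi_gen_reducible[OF det, unfolded Psi_psl[OF det]]
  have h0: "0 < height a b" "0 < height c d"
  proof -
    have "a \<noteq> 0 \<or> b \<noteq> 0" "c \<noteq> 0 \<or> d \<noteq> 0" using det by auto
    then show "0 < height a b" "0 < height c d" unfolding height_def by linarith+
  qed
  from farey_child[OF det1 less] show ?thesis
  proof cases
    case 1
    then have "\<bar>a\<bar> * \<bar>d\<bar> = 1" using det1 by (simp add: abs_mult)
    from abs_mult_eq_one[OF this] have ad: "\<bar>a\<bar> = 1" "\<bar>d\<bar> = 1" .
    have "?g (- c) (- d) (a + c) (b + d) \<in> O_reducible" "?g (- c) (- d) (a - c) (b - d) \<in> O_reducible"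
      "?g a b (a + c) (b + d) \<in> O_reducible" "?g a b (c - a) (d - b) \<in> O_reducible"
      by (rule gen_O_reducible; use det 1 ad in \<open>simp add: algebra_simps height_def\<close>)+
    then have "(1/2) *\<^sub>R (?g (- c) (- d) (a + c) (b + d) + ?g (- c) (- d) (a - c) (b - d)
      - (?g a b (a + c) (b + d) - 2 *\<^sub>R ?g a b c d + ?g a b (c - a) (d - b))
      - (?g (- c) (- d) (a + c) (b + d) - 2 *\<^sub>R ?g (- c) (- d) a b + ?g (- c) (- d) (a - c) (b - d)
      - (?g a b (a + c) (b + d) - 2 *\<^sub>R ?g a b c d + ?g a b (c - a) (d - b)))) \<in> O_reducible"
      by (intro closed A P)
    then show ?thesis by simp
  next
    case (2 \<epsilon>)
    let ?X = "?g (- c) (- d) a b"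
    from 2 consider (plus) "\<bar>c\<bar> = \<bar>a\<bar> + \<bar>c - a\<bar>" "\<bar>d\<bar> = \<bar>b\<bar> + \<bar>d - b\<bar>"
      | (minus) "\<bar>c\<bar> = \<bar>a\<bar> + \<bar>c + a\<bar>" "\<bar>d\<bar> = \<bar>b\<bar> + \<bar>d + b\<bar>"
      by auto
    then show ?thesis
    proof cases
      case plus
      let ?Y = "?g (- c) (- d) (a - c) (b - d)"
      note abs = abs_add_same_sign[OF plus(1)] abs_add_same_sign[OF plus(2)]
      have ab: "0 < \<bar>a\<bar> + \<bar>b\<bar>" using h0(1) unfolding height_def by linarith
      have det': "(a - c) * d - (b - d) * c = 1" using det by (simp add: algebra_simps)
      note P' = Psi_gen_reducible[OF det', unfolded Psi_psl[OF det']]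
      have heights: "height (a + c) (b + d) = height a b + height c d"
        "height (a - c) (b - d) = height c d - height a b"
        "height (a - c - c) (b - d - d) = 2 * height c d - height a b"
        "height (c - (a - c)) (d - (b - d)) = 2 * height c d - height a b"
        unfolding height_def abs by simp_all
      have m: "?g (- c) (- d) (a + c) (b + d) \<in> O_reducible" "?g a b (a + c) (b + d) \<in> O_reducible"
        "?g (- c) (- d) (a - c - c) (b - d - d) \<in> O_reducible" "?g (a - c) (b - d) c d \<in> O_reducible"
        "?g (a - c) (b - d) (c - (a - c)) (d - (b - d)) \<in> O_reducible"
        by (rule gen_O_reducible, use det in \<open>simp add: algebra_simps\<close>,
          use h0 less in \<open>simp only: heights height_uminus; linarith\<close>)+
      have i: "?g a b (c - a) (d - b) \<in> O_reducible" "?g (a - c) (b - d) a b \<in> O_reducible"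
        by (rule IH, use ab in \<open>simp add: abs\<close>,
          use det in \<open>simp add: algebra_simps\<close>)+
      have "(?g (- c) (- d) (a + c) (b + d) - 2 *\<^sub>R ?X + ?Y
          - (?g a b (a + c) (b + d) - 2 *\<^sub>R ?g a b c d + ?g a b (c - a) (d - b)))
        - ?g (- c) (- d) (a + c) (b + d)
        + (?g a b (a + c) (b + d) - 2 *\<^sub>R ?g a b c d + ?g a b (c - a) (d - b)) \<in> O_reducible"
        by (intro closed P m i A)
      then have 1: "?Y - 2 *\<^sub>R ?X \<in> O_reducible" by simp
      let ?Z = "?g (- c) (- d) (a - c - c) (b - d - d)"
      let ?W = "?g (a - c) (b - d) a b - 2 *\<^sub>R ?g (a - c) (b - d) c d
            + ?g (a - c) (b - d) (c - (a - c)) (d - (b - d))"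
      have W: "?W \<in> O_reducible" by (intro closed m i)
      have Q: "?X - 2 *\<^sub>R ?Y + ?Z - ?W \<in> O_reducible" using P' by simp
      have "(?X - 2 *\<^sub>R ?Y + ?Z - ?W) - ?Z + ?W \<in> O_reducible"
        by (rule closed(1)[OF closed(2)[OF Q m(3)] W])
      then have "?X - 2 *\<^sub>R ?Y \<in> O_reducible" by simp
      then show ?thesis using solve_two_relations[OF V 1] by simp
    next
      case minus
      let ?Y = "?g (- c) (- d) (a + c) (b + d)"
      note abs = abs_add_opposite_sign[OF minus(1)] abs_add_opposite_sign[OF minus(2)]
      have ab: "0 < \<bar>a\<bar> + \<bar>b\<bar>" using h0(1) unfolding height_def by linarith
      have det': "(a + c) * d - (b + d) * c = 1" using det by (simp add: algebra_simps)
      note P' = Psi_gen_reducible[OF det', unfolded Psi_psl[OF det']]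
      have heights: "height (a - c) (b - d) = height a b + height c d"
        "height (c - a) (d - b) = height a b + height c d"
        "height (a + c) (b + d) = height c d - height a b"
        "height (a + c + c) (b + d + d) = 2 * height c d - height a b"
        unfolding height_def abs by simp_all
      have m: "?g (- c) (- d) (a - c) (b - d) \<in> O_reducible" "?g a b (c - a) (d - b) \<in> O_reducible"
        "?g (- c) (- d) (a + c + c) (b + d + d) \<in> O_reducible" "?g (a + c) (b + d) c d \<in> O_reducible"
        "?g (a + c) (b + d) (a + c + c) (b + d + d) \<in> O_reducible"
        by (rule gen_O_reducible, use det in \<open>simp add: algebra_simps\<close>,
          use h0 less in \<open>simp only: heights height_uminus; linarith\<close>)+
      have i: "?g a b (a + c) (b + d) \<in> O_reducible" "?g (a + c) (b + d) (- a) (- b) \<in> O_reducible"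
        by (rule IH, use ab in \<open>simp add: abs\<close>,
          use det in \<open>simp add: algebra_simps\<close>)+
      have "(?Y - 2 *\<^sub>R ?X + ?g (- c) (- d) (a - c) (b - d)
          - (?g a b (a + c) (b + d) - 2 *\<^sub>R ?g a b c d + ?g a b (c - a) (d - b)))
        - ?g (- c) (- d) (a - c) (b - d)
        + (?g a b (a + c) (b + d) - 2 *\<^sub>R ?g a b c d + ?g a b (c - a) (d - b)) \<in> O_reducible"
        by (intro closed P m i A)
      then have 1: "?Y - 2 *\<^sub>R ?X \<in> O_reducible" by simp
      let ?Z = "?g (- c) (- d) (a + c + c) (b + d + d)"
      let ?W = "?g (a + c) (b + d) (a + c + c) (b + d + d) - 2 *\<^sub>R ?g (a + c) (b + d) c d
            + ?g (a + c) (b + d) (- a) (- b)"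
      have W: "?W \<in> O_reducible" by (intro closed m i)
      have Q: "?Z - 2 *\<^sub>R ?Y + ?X - ?W \<in> O_reducible" using P' by simp
      have "(?Z - 2 *\<^sub>R ?Y + ?X - ?W) - ?Z + ?W \<in> O_reducible"
        by (rule closed(1)[OF closed(2)[OF Q m(3)] W])
      then have "?X - 2 *\<^sub>R ?Y \<in> O_reducible" by simp
      then show ?thesis using solve_two_relations[OF V 1] by simp
    qed
  qed
qed

lemma gen_reducible:
  assumes "a * d - b * c = 1" shows "gen (psl a b c d) \<in> O_reducible"
  using assms
proof (induction "nat (\<bar>a\<bar> + \<bar>b\<bar> + \<bar>c\<bar> + \<bar>d\<bar>)" arbitrary: a b c d rule: less_induct)
  case less
  have "height a b \<noteq> height c d" by (rule height_neq) (simp add: less.prems)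
  then consider "height a b < height c d" | "height c d < height a b" by linarith
  then show ?case
  proof cases
    case 1
    then show ?thesis by (rule gen_O_reducible[OF less.prems])
  next
    case 2
    have "gen (psl (- (- a)) (- (- b)) c d) \<in> O_reducible"
    proof (rule reversed_edge_reducible)
      show "c * (- b) - d * (- a) = 1" using less.prems by (simp add: algebra_simps)
      show "height c d < height (- a) (- b)" using 2 by (simp add: height_def)
      fix u v x y :: int
      assume "\<bar>u\<bar> + \<bar>v\<bar> + \<bar>x\<bar> + \<bar>y\<bar> < \<bar>c\<bar> + \<bar>d\<bar> + \<bar>- a\<bar> + \<bar>- b\<bar>" "u * y - v * x = 1"
      moreover from this(1)
      have "nat (\<bar>u\<bar> + \<bar>v\<bar> + \<bar>x\<bar> + \<bar>y\<bar>) < nat (\<bar>a\<bar> + \<bar>b\<bar> + \<bar>c\<bar> + \<bar>d\<bar>)"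
        by (subst nat_less_eq_zless) (simp_all add: add_ac)
      ultimately show "gen (psl u v x y) \<in> O_reducible" by (intro less.hyps)
    qed
    then show ?thesis by simp
  qed
qed

theorem O_reducible_UNIV: "O_reducible = UNIV"
proof -
  have "r \<in> O_reducible" for r
  proof -
    have "gen A \<in> O_reducible" for A using psl_cases[of A] gen_reducible by metis
    then have "(\<Sum>A\<in>Poly_Mapping.keys r. Poly_Mapping.lookup r A *\<^sub>R gen A) \<in> O_reducible"
      by (intro subspace_sum[OF subspace_O_reducible] subspace_scale[OF subspace_O_reducible])
    then show ?thesis by (simp flip: poly_mapping_gen_sum)
  qed
  then show ?thesis by blast
qed

section \<open>Independence modulo the constants\<close>

text \<open>
The two sides of a point of the circle in the orientation of increasing \<open>s\<close>: the left side of \<open>\<infinity>\<close> is the end at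
\<open>+\<infinity>\<close>.
\<close>

definition left_germ :: "rhat \<Rightarrow> real filter" where
  "left_germ v = (case v of None \<Rightarrow> at_top | Some s \<Rightarrow> at_left s)"

definition right_germ :: "rhat \<Rightarrow> real filter" where
  "right_germ v = (case v of None \<Rightarrow> at_bot | Some s \<Rightarrow> at_right s)"

lemma germ_nontrivial: "left_germ v \<noteq> bot" "right_germ v \<noteq> bot"
  by (simp_all add: left_germ_def right_germ_def
    split: option.split)

lemma germ_avoids_finite:
  assumes "finite S"
  shows "\<forall>\<^sub>F t in left_germ v. t \<notin> S" "\<forall>\<^sub>F t in right_germ v. t \<notin> S"
proof -
  have "\<forall>\<^sub>F t in left_germ v. t \<noteq> x" "\<forall>\<^sub>F t in right_germ v. t \<noteq> x" for x
    by (auto simp: left_germ_def right_germ_def eventually_neq_at_within split: option.split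
      intro: eventually_mono[OF eventually_gt_at_top[of x]] eventually_mono[OF eventually_gt_at_bot[of x]])
  then have "\<forall>\<^sub>F t in left_germ v. \<forall>x\<in>S. t \<noteq> x" "\<forall>\<^sub>F t in right_germ v. \<forall>x\<in>S. t \<noteq> x"
    using assms by (simp_all add: eventually_ball_finite)
  then show "\<forall>\<^sub>F t in left_germ v. t \<notin> S" "\<forall>\<^sub>F t in right_germ v. t \<notin> S"
    by (auto elim: eventually_mono)
qed

text \<open>
A step also jumps back to \<open>0\<close> at \<open>\<infinity>\<close>. This contribution cancels in the difference of two steps, so \<open>\<infinity>\<close> is treated like
any other point.
\<close>

lemma step_jump:
  "\<exists>L. (\<forall>\<^sub>F t in left_germ v. step a b X t = L) \<and>
    (\<forall>\<^sub>F t in right_germ v. step a b X t = L + (of_bool (pt a b = v) - of_bool (v = None)) *\<^sub>R X)"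
proof (cases "a = 0")
  case True
  then show ?thesis by (intro exI[of _ 0]) (auto simp: step_def pt_def)
next
  case False
  show ?thesis
  proof (cases v)
    case None
    have "\<forall>\<^sub>F t in at_top. step a b X t = X"
      by (rule eventually_mono[OF eventually_gt_at_top[of "- of_int b / of_int a"]])
        (use False in \<open>simp add: step_def\<close>)
    moreover have "\<forall>\<^sub>F t in at_bot. step a b X t = 0"
      by (rule eventually_mono[OF eventually_gt_at_bot[of "- of_int b / of_int a"]])
        (simp add: step_def)
    ultimately show ?thesis unfolding None left_germ_def right_germ_def
      using False by (intro exI[of _ X]) (simp add: pt_def)
  next
    case (Some s)
    define x where "x = - real_of_int b / of_int a"
    have st: "step a b X t = (if x < t then X else 0)" for t
      using False by (simp add: step_def x_def)
    have pt: "pt a b = Some x" using False by (simp add: pt_def x_def)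
    have "\<exists>L. (\<forall>\<^sub>F t in at_left s. step a b X t = L) \<and>
        (\<forall>\<^sub>F t in at_right s. step a b X t = L + of_bool (x = s) *\<^sub>R X)"
    proof -
      consider "x < s" | "x = s" | "s < x" by linarith
      then show ?thesis
      proof cases
        case 1
        have "\<forall>\<^sub>F t in at_left s. x < t" using 1 by (intro eventually_at_leftI[of x]) auto
        then have "\<forall>\<^sub>F t in at_left s. step a b X t = X" by eventually_elim (simp add: st)
        moreover have "\<forall>\<^sub>F t in at_right s. step a b X t = X"
          using eventually_at_right_less[of s] by eventually_elim (use 1 in \<open>simp add: st\<close>)
        ultimately show ?thesis using 1 by auto
      next
        case 2
        have "\<forall>\<^sub>F t in at_left s. t < s" by (simp add: eventually_at_filter)
        then have "\<forall>\<^sub>F t in at_left s. step a b X t = 0" by eventually_elim (use 2 in \<open>simp add: st\<close>)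
        moreover have "\<forall>\<^sub>F t in at_right s. step a b X t = X"
          using eventually_at_right_less[of s] by eventually_elim (use 2 in \<open>simp add: st\<close>)
        ultimately show ?thesis using 2 by auto
      next
        case 3
        have "\<forall>\<^sub>F t in at_left s. t < s" by (simp add: eventually_at_filter)
        then have "\<forall>\<^sub>F t in at_left s. step a b X t = 0" by eventually_elim (use 3 in \<open>simp add: st\<close>)
        moreover have "\<forall>\<^sub>F t in at_right s. t < x" using 3 by (intro eventually_at_rightI[of s x]) auto
        then have "\<forall>\<^sub>F t in at_right s. step a b X t = 0" by eventually_elim (simp add: st)
        ultimately show ?thesis using 3 by auto
      qed
    qed
    then show ?thesis by (simp add: Some left_germ_def right_germ_def pt)
  qed
qed

lemma hyperfan_jump:
  "\<exists>L. (\<forall>\<^sub>F t in left_germ v. psi_fun A (Some t) = L) \<and>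
    (\<forall>\<^sub>F t in right_germ v. psi_fun A (Some t) =
      L + (of_bool (e_term A = v) - of_bool (e_init A = v)) *\<^sub>R psl_conj A mat_e)"
proof -
  obtain a b c d where det: "a * d - b * c = 1" and A: "A = psl a b c d" by (rule psl_cases)
  define X where "X = nilp c d"
  define k where "k = (if a * c < 0 \<or> c = 0 then X else 0)"
  obtain L where L: "\<forall>\<^sub>F t in left_germ v. step a b X t = L"
    "\<forall>\<^sub>F t in right_germ v. step a b X t = L + (of_bool (pt a b = v) - of_bool (v = None)) *\<^sub>R X"
    using step_jump by blast
  obtain M where M: "\<forall>\<^sub>F t in left_germ v. step c d X t = M"
    "\<forall>\<^sub>F t in right_germ v. step c d X t = M + (of_bool (pt c d = v) - of_bool (v = None)) *\<^sub>R X"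
    using step_jump by blast
  let ?S = "{t. psi_fun A (Some t) \<noteq> step c d X t - step a b X t + k}"
  have "finite ?S" using hyperfan_steps[OF det, of X]
    unfolding A psi_fun_Some[OF det] X_def[symmetric] k_def[symmetric] .
  note avoid = germ_avoids_finite[OF this, of v]
  have "\<forall>\<^sub>F t in left_germ v. psi_fun A (Some t) = M - L + k"
    using L(1) M(1) avoid(1) by eventually_elim simp
  moreover have "\<forall>\<^sub>F t in right_germ v. psi_fun A (Some t) =
      M - L + k + (of_bool (pt c d = v) - of_bool (pt a b = v)) *\<^sub>R X"
    using L(2) M(2) avoid(2)
  proof eventually_elim
    case (elim t)
    from elim(3) have "psi_fun A (Some t) = step c d X t - step a b X t + k" by simp
    also have "\<dots> = M - L + k + (of_bool (pt c d = v) - of_bool (pt a b = v)) *\<^sub>R X"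
      unfolding elim(1,2) by (simp add: algebra_simps)
    finally show ?case .
  qed
  ultimately show ?thesis
    unfolding A e_init_psl[OF det] e_term_psl[OF det] conj_e_psl[OF det] X_def[symmetric] by blast
qed

lemma jumps_vanish:
  assumes "X \<in> sl2" "(\<Sum>A\<in>K. c A *\<^sub>R psi A) = const_pp X"
  shows "(\<Sum>A\<in>K. (c A * (of_bool (e_term A = v) - of_bool (e_init A = v))) *\<^sub>R psl_conj A mat_e) = 0"
proof (cases "finite K")
  case True
  define j where "j A = (of_bool (e_term A = v) - of_bool (e_init A = v)) *\<^sub>R psl_conj A mat_e" for A
  obtain L where L: "\<And>A. \<forall>\<^sub>F t in left_germ v. psi_fun A (Some t) = L A"
    "\<And>A. \<forall>\<^sub>F t in right_germ v. psi_fun A (Some t) = L A + j A"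
    using hyperfan_jump[where v = v] unfolding j_def by metis
  have "represents (\<Sum>A\<in>K. c A *\<^sub>R psi A) (\<lambda>t. \<Sum>A\<in>K. c A *\<^sub>R psi_fun A (Some t))"
    by (intro represents_sum represents_scaleR represents_psi_fun)
  then have "finite {t. rep_ppsl2 (const_pp X) (Some t) \<noteq> (\<Sum>A\<in>K. c A *\<^sub>R psi_fun A (Some t))}"
    unfolding assms(2) represents_def .
  moreover have "finite {t. rep_ppsl2 (const_pp X) (Some t) \<noteq> X}"
    using represents_const[OF assms(1)] unfolding represents_def .
  ultimately have "finite ({t. rep_ppsl2 (const_pp X) (Some t) \<noteq> (\<Sum>A\<in>K. c A *\<^sub>R psi_fun A (Some t))}
      \<union> {t. rep_ppsl2 (const_pp X) (Some t) \<noteq> X})" by simp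
  note avoid = germ_avoids_finite[OF this, of v]
  have "\<forall>\<^sub>F t in left_germ v. \<forall>A\<in>K. psi_fun A (Some t) = L A"
    using L(1) True by (simp add: eventually_ball_finite)
  then have "\<forall>\<^sub>F t in left_germ v. (\<Sum>A\<in>K. c A *\<^sub>R L A) = X"
    using avoid(1) by eventually_elim auto
  then have 1: "(\<Sum>A\<in>K. c A *\<^sub>R L A) = X"
    using germ_nontrivial(1) by (simp add: eventually_const_iff)
  have "\<forall>\<^sub>F t in right_germ v. \<forall>A\<in>K. psi_fun A (Some t) = L A + j A"
    using L(2) True by (simp add: eventually_ball_finite)
  then have "\<forall>\<^sub>F t in right_germ v. (\<Sum>A\<in>K. c A *\<^sub>R (L A + j A)) = X"
    using avoid(2) by eventually_elim auto
  then have "(\<Sum>A\<in>K. c A *\<^sub>R (L A + j A)) = X"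
    using germ_nontrivial(2) by (simp add: eventually_const_iff)
  with 1 have "(\<Sum>A\<in>K. c A *\<^sub>R j A) = 0"
    by (simp add: scaleR_add_right sum.distrib)
  then show ?thesis by (simp add: j_def)
qed simp

text \<open>
The polarization of the quadratic form of \<open>X\<close> at the rows \<open>u\<close> and \<open>v\<close>. It vanishes on \<open>N\<^sub>u\<close> and on \<open>N\<^sub>v\<close>, and thus
isolates the coefficient of a third nilpotent matrix.
\<close>

definition pairing :: "int \<Rightarrow> int \<Rightarrow> int \<Rightarrow> int \<Rightarrow> real^2^2 \<Rightarrow> real" where
  "pairing u1 u2 v1 v2 X =
    - X$2$1 * of_int (u2 * v2) - X$1$1 * of_int (u2 * v1 + u1 * v2) + X$1$2 * of_int (u1 * v1)"

lemma linear_pairing: "linear (pairing u1 u2 v1 v2)"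
  by (rule linearI) (simp_all add: pairing_def algebra_simps)

lemma pairing_nilp:
  "pairing u1 u2 v1 v2 (nilp c d) = of_int ((c * u2 - d * u1) * (c * v2 - d * v1))"
  by (simp add: pairing_def nilp_def algebra_simps power2_eq_square)

lemma pairing_jumps_vanish:
  assumes "X \<in> sl2" "(\<Sum>A\<in>K. c A *\<^sub>R psi A) = const_pp X"
  shows "(\<Sum>A\<in>K. c A * (of_bool (e_term A = v) - of_bool (e_init A = v)) *
    pairing u1 u2 v1 v2 (psl_conj A mat_e)) = 0"
proof -
  interpret linear "pairing u1 u2 v1 v2" by (rule linear_pairing)
  show ?thesis using arg_cong[OF jumps_vanish[OF assms, of v], of "pairing u1 u2 v1 v2"]
    by (simp add: sum scale)
qed

text \<open>
A reduced fraction determines its numerator and denominator up to a common sign.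
\<close>

lemma pt_eq_rows:
  assumes "coprime a b" "coprime a' b'" "pt a b = pt a' b'"
  shows "(a' = a \<and> b' = b) \<or> (a' = - a \<and> b' = - b)"
proof (cases "a = 0")
  case True
  then have "a' = 0" using assms(3) by (auto simp: pt_def split: if_splits)
  then show ?thesis using True assms(1,2) by auto
next
  case False
  then have "a' \<noteq> 0" "real_of_int b / of_int a = of_int b' / of_int a'"
    using assms(3) by (auto simp: pt_def split: if_splits)
  then have "real_of_int (b * a') = real_of_int (b' * a)" using False by (simp add: field_simps)
  then have eq: "b * a' = b' * a" by (simp only: of_int_eq_iff)
  have "a dvd b * a'" by (simp add: eq)
  moreover have "a' dvd b' * a" by (simp flip: eq)
  ultimately have "a dvd a'" "a' dvd a"
    using assms(1,2) by (simp_all add: coprime_dvd_mult_right_iff)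
  then have "\<bar>a\<bar> = \<bar>a'\<bar>" by (rule zdvd_antisym_abs)
  then consider "a' = a" | "a' = - a" by linarith
  then show ?thesis
  proof cases
    case 2
    then have "(b + b') * a = 0" using eq by (simp add: algebra_simps)
    then show ?thesis using False 2 by auto
  qed (use eq False in simp)
qed

lemma unimodular_coprime:
  assumes "a * d - b * c = (1::int)" shows "coprime a b" "coprime c d"
proof -
  show "coprime a b"
  proof (rule coprimeI)
    fix x assume "x dvd a" "x dvd b"
    then have "x dvd a * d - b * c" by simp
    then show "is_unit x" by (simp add: assms)
  qed
  show "coprime c d"
  proof (rule coprimeI)
    fix x assume "x dvd c" "x dvd d"
    then have "x dvd a * d - b * c" by simp
    then show "is_unit x" by (simp add: assms)
  qed
qed

lemma same_row_shift:
  fixes a b c d c' d' :: int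
  assumes "a * d - b * c = 1" "a * d' - b * c' = 1"
  shows "\<exists>k. c' = c + k * a \<and> d' = d + k * b"
proof (intro exI conjI)
  let ?k = "d * c' - c * d'"
  have "c + ?k * a = c * (1 - (a * d' - b * c')) + c' * (a * d - b * c)" by (simp add: algebra_simps)
  then show "c' = c + ?k * a" by (simp add: assms)
  have "d + ?k * b = d * (1 - (a * d' - b * c')) + d' * (a * d - b * c)" by (simp add: algebra_simps)
  then show "d' = d + ?k * b" by (simp add: assms)
qed

lemma e_init_eqD:
  assumes det: "a * d - b * c = 1" and B: "e_init B = pt a b"
  obtains k where "B = psl a b (c + k * a) (d + k * b)"
proof -
  obtain a' b' c' d' where B': "a' * d' - b' * c' = 1" "B = psl a' b' c' d'" by (rule psl_cases)
  have "pt a b = pt a' b'" using B B' by (simp add: e_init_psl)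
  from pt_eq_rows[OF unimodular_coprime(1)[OF det] unimodular_coprime(1)[OF B'(1)] this]
  have "\<exists>c'' d''. a * d'' - b * c'' = 1 \<and> B = psl a b c'' d''"
  proof
    assume "a' = - a \<and> b' = - b"
    then show ?thesis using B' psl_uminus[OF B'(1)]
      by (intro exI[of _ "- c'"] exI[of _ "- d'"]) auto
  qed (use B' in blast)
  then show ?thesis using same_row_shift[OF det] that by metis
qed

lemma e_term_eqD:
  assumes det: "a * d - b * c = 1" and B: "e_term B = pt c d"
  obtains k where "B = psl (a + k * c) (b + k * d) c d"
proof -
  obtain a' b' c' d' where B': "a' * d' - b' * c' = 1" "B = psl a' b' c' d'" by (rule psl_cases)
  have "pt c d = pt c' d'" using B B' by (simp add: e_term_psl)
  from pt_eq_rows[OF unimodular_coprime(2)[OF det] unimodular_coprime(2)[OF B'(1)] this]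
  have "\<exists>a'' b''. a'' * d - b'' * c = 1 \<and> B = psl a'' b'' c d"
  proof
    assume "c' = - c \<and> d' = - d"
    then show ?thesis using B' psl_uminus[OF B'(1)]
      by (intro exI[of _ "- a'"] exI[of _ "- b'"]) auto
  qed (use B' in blast)
  then obtain a'' b'' where 1: "a'' * d - b'' * c = 1" "B = psl a'' b'' c d" by blast
  have "\<exists>k. - a'' = - a + k * c \<and> - b'' = - b + k * d"
    by (rule same_row_shift) (use det 1 in \<open>simp_all add: algebra_simps\<close>)
  then obtain k where "- a'' = - a + k * c" "- b'' = - b + k * d" by blast
  then have "a'' = a + (- k) * c" "b'' = b + (- k) * d" by simp_all
  then show ?thesis using that[of "- k"] 1(2) by blast
qed

lemma height_mult: "height (k * a) (k * b) = \<bar>k\<bar> * height a b"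
  by (simp add: height_def abs_mult algebra_simps)

lemma height_triangle: "height (a + c) (b + d) \<le> height a b + height c d"
  using abs_triangle_ineq[of a c] abs_triangle_ineq[of b d] by (simp add: height_def)

lemma height_pos: "a \<noteq> 0 \<or> b \<noteq> 0 \<Longrightarrow> 0 < height a b"
  unfolding height_def by linarith

text \<open>
The edges from \<open>p\<close> lead to the rows \<open>q + k p\<close>, where \<open>q = p + r\<close> and \<open>r\<close> is lower than \<open>p\<close>. For positive \<open>k\<close> they are higher than \<open>q\<close>,
and for \<open>k \<le> -4\<close> as well by the triangle inequality; \<open>k = -1\<close> gives \<open>r\<close>. If \<open>p\<close> has two parents \<open>r\<close> and \<open>p - r\<close>, then \<open>k = -2\<close>
gives the other parent, and \<open>k = -3\<close> its mediant with \<open>p\<close>. If \<open>p\<close> is \<open>\<infinity>\<close>, then \<open>k = -2\<close> gives the integer opposite to \<open>q\<close>, and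
\<open>k = -3\<close> a point higher than \<open>q\<close>.
\<close>

lemma unique_other_child_pos:
  assumes det: "\<bar>a * s - b * r\<bar> = 1" and quad: "0 \<le> a * r" "0 \<le> b * s"
    and less: "height r s < height a b" and "k \<noteq> 0"
    and lower: "height a b < height (a + r + k * a) (b + s + k * b)"
    and upper: "height (a + r + k * a) (b + s + k * b) \<le> height (a + r) (b + s)"
  shows "k = (if a = 0 then -2 else -3)"
proof -
  have same: "(0 \<le> a \<and> 0 \<le> r) \<or> (a \<le> 0 \<and> r \<le> 0)" "(0 \<le> b \<and> 0 \<le> s) \<or> (b \<le> 0 \<and> s \<le> 0)"
    using quad by (simp_all add: zero_le_mult_iff)
  have sum: "height (a + r) (b + s) = height a b + height r s"
  proof -
    have "\<bar>a + r\<bar> = \<bar>a\<bar> + \<bar>r\<bar>" "\<bar>b + s\<bar> = \<bar>b\<bar> + \<bar>s\<bar>" using same by linarith+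
    then show ?thesis by (simp add: height_def)
  qed
  have "a \<noteq> 0 \<or> b \<noteq> 0" using det by auto
  then have hab: "0 < height a b" by (rule height_pos)
  have "height (k * a) (k * b) \<le> height (a + r + k * a) (b + s + k * b) + height (- (a + r)) (- (b + s))"
    using height_triangle[of "a + r + k * a" "- (a + r)" "b + s + k * b" "- (b + s)"] by simp
  then have "\<bar>k\<bar> * height a b \<le> 2 * height a b + 2 * height r s"
    using upper sum unfolding height_mult height_uminus by linarith
  also have "\<dots> < 4 * height a b" using less by simp
  finally have "\<bar>k\<bar> < 4"
    using hab by (simp add: mult_less_cancel_right_pos)
  then have "k \<in> {-3, -2, -1, 1, 2, 3}" using \<open>k \<noteq> 0\<close> by auto
  moreover have "\<not> 0 < k"
  proof
    assume "0 < k"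
    have grow: "\<bar>x + y\<bar> + \<bar>k * x\<bar> = \<bar>x + y + k * x\<bar>" if "(0 \<le> x \<and> 0 \<le> y) \<or> (x \<le> 0 \<and> y \<le> 0)" for x y
    proof -
      have "0 \<le> x \<longrightarrow> 0 \<le> k * x" "x \<le> 0 \<longrightarrow> k * x \<le> 0"
        using \<open>0 < k\<close> by (simp_all add: mult_nonneg_nonpos)
      then show ?thesis using that by linarith
    qed
    have "height (a + r) (b + s) + height (k * a) (k * b) = height (a + r + k * a) (b + s + k * b)"
      using grow[OF same(1)] grow[OF same(2)] by (simp add: height_def)
    moreover have "0 < height (k * a) (k * b)" unfolding height_mult using hab \<open>0 < k\<close> by simp
    ultimately show False using upper by simp
  qed
  moreover have "k \<noteq> -1" using lower less by auto
  ultimately have k: "k = -2 \<or> k = -3" by auto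
  from farey_comparable[OF det] consider "\<bar>a\<bar> \<le> \<bar>r\<bar>" "\<bar>b\<bar> \<le> \<bar>s\<bar>" | "\<bar>r\<bar> \<le> \<bar>a\<bar>" "\<bar>s\<bar> \<le> \<bar>b\<bar>"
    | "a = 0" "s = 0" | "b = 0" "r = 0" by blast
  then show ?thesis
  proof cases
    case 1
    then show ?thesis using less by (simp add: height_def)
  next
    case 2
    have "a \<noteq> 0"
    proof
      assume "a = 0"
      then have "r = 0" using 2 by simp
      then show False using det \<open>a = 0\<close> by simp
    qed
    have "r \<noteq> 0 \<or> s \<noteq> 0" using det by auto
    then have "0 < height r s" by (rule height_pos)
    moreover have "\<bar>r - a\<bar> = \<bar>a\<bar> - \<bar>r\<bar>" "\<bar>s - b\<bar> = \<bar>b\<bar> - \<bar>s\<bar>" using same 2 by linarith+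
    ultimately have "height (r - a) (s - b) < height a b" by (simp add: height_def)
    then have "k \<noteq> -2" using lower by (auto simp: algebra_simps)
    then show ?thesis using k \<open>a \<noteq> 0\<close> by simp
  next
    case 3
    then have "\<bar>b\<bar> * \<bar>r\<bar> = 1" using det by (simp add: abs_mult)
    from abs_mult_eq_one[OF this] have "\<bar>b\<bar> = 1" "\<bar>r\<bar> = 1" .
    then have "k \<noteq> -3" using upper 3 by (auto simp: height_def)
    then show ?thesis using k 3 by simp
  next
    case 4
    then have "\<bar>a\<bar> * \<bar>s\<bar> = 1" using det by (simp add: abs_mult)
    from abs_mult_eq_one[OF this] have "\<bar>a\<bar> = 1" "\<bar>s\<bar> = 1" .
    then show ?thesis using less 4 by (simp add: height_def)
  qed
qed

lemma unique_other_child: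
  assumes det: "\<bar>a * d - b * c\<bar> = 1" and e: "e = 1 \<or> e = -1"
    and add: "\<bar>c\<bar> = \<bar>a\<bar> + \<bar>c - e * a\<bar>" "\<bar>d\<bar> = \<bar>b\<bar> + \<bar>d - e * b\<bar>"
    and less: "height (c - e * a) (d - e * b) < height a b" and k: "k \<noteq> 0"
    and bounds: "height a b < height (c + k * a) (d + k * b)"
      "height (c + k * a) (d + k * b) \<le> height c d"
  shows "k = e * (if a = 0 then -2 else -3)"
proof -
  have quad: "0 \<le> e * x * (y - e * x)" if "\<bar>y\<bar> = \<bar>x\<bar> + \<bar>y - e * x\<bar>" for x y :: int
  proof -
    have "(0 \<le> e * x \<and> 0 \<le> y - e * x) \<or> (e * x \<le> 0 \<and> y - e * x \<le> 0)"
      using that e by auto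
    then show ?thesis by (auto intro: mult_nonneg_nonneg mult_nonpos_nonpos)
  qed
  have ee: "e * (e * x) = x" for x using e by auto
  have ha: "height (e * a) (e * b) = height a b" using e by (auto simp: height_def)
  have "e * k = (if e * a = 0 then -2 else -3)"
  proof (rule unique_other_child_pos[of "e * a" "d - e * b" "e * b" "c - e * a" "e * k"])
    show "\<bar>e * a * (d - e * b) - e * b * (c - e * a)\<bar> = 1"
      using det e by (auto simp: algebra_simps abs_minus_commute)
    show "0 \<le> e * a * (c - e * a)" "0 \<le> e * b * (d - e * b)" using quad add by blast+
    show "height (c - e * a) (d - e * b) < height (e * a) (e * b)" using less ha by simp
    show "e * k \<noteq> 0" using e k by auto
    show "height (e * a) (e * b) < height (e * a + (c - e * a) + e * k * (e * a)) (e * b + (d - e * b) + e * k * (e * b))"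
      "height (e * a + (c - e * a) + e * k * (e * a)) (e * b + (d - e * b) + e * k * (e * b)) \<le>
        height (e * a + (c - e * a)) (e * b + (d - e * b))"
      using bounds e unfolding ha by auto
  qed
  then have "e * (e * k) = e * (if a = 0 then -2 else -3)" using e by auto
  then show ?thesis unfolding ee .
qed

lift_definition init_height :: "psl2z \<Rightarrow> int" is "\<lambda>A. height (A$1$1) (A$1$2)"
  by (auto simp: height_def)

lift_definition term_height :: "psl2z \<Rightarrow> int" is "\<lambda>A. height (A$2$1) (A$2$2)"
  by (auto simp: height_def)

lemma init_height_psl: "a * d - b * c = 1 \<Longrightarrow> init_height (psl a b c d) = height a b"
  by (simp add: psl_abs init_height.abs_eq)

lemma term_height_psl: "a * d - b * c = 1 \<Longrightarrow> term_height (psl a b c d) = height c d"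
  by (simp add: psl_abs term_height.abs_eq)

lemma finite_lexicographic_max:
  fixes f g :: "'a \<Rightarrow> int"
  assumes "finite K" "K \<noteq> {}"
  obtains x where "x \<in> K" "\<And>y. y \<in> K \<Longrightarrow> f y \<le> f x" "\<And>y. y \<in> K \<Longrightarrow> f y = f x \<Longrightarrow> g y \<le> g x"
proof -
  define L where "L = {y \<in> K. f y = Max (f ` K)}"
  have "Max (f ` K) \<in> f ` K" using assms by simp
  then obtain y where "y \<in> K" "f y = Max (f ` K)" by auto
  then have L: "finite L" "L \<noteq> {}" using assms by (auto simp: L_def)
  then have "Max (g ` L) \<in> g ` L" by simp
  then obtain x where x: "x \<in> L" "g x = Max (g ` L)" by auto
  show ?thesis
  proof (rule that[of x])
    show "x \<in> K" using x by (simp add: L_def)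
    show "f y \<le> f x" if "y \<in> K" for y using x that assms by (simp add: L_def)
    show "g y \<le> g x" if "y \<in> K" "f y = f x" for y
      using x that L by (simp add: L_def)
  qed
qed

lemma det_shift_row2:
  "(a::int) * d - b * c = 1 \<Longrightarrow> a * (d + k * b) - b * (c + k * a) = 1"
  by (simp add: algebra_simps)

lemma det_shift_row1:
  "(a::int) * d - b * c = 1 \<Longrightarrow> (a + k * c) * d - (b + k * d) * c = 1"
  by (simp add: algebra_simps)

lemma sum_single_term:
  fixes f :: "'a \<Rightarrow> real"
  assumes "finite K" "x \<in> K" "\<And>y. y \<in> K \<Longrightarrow> y \<noteq> x \<Longrightarrow> f y = 0"
  shows "sum f K = f x"
proof -
  have "sum f K = sum f {x}"
    using assms by (intro sum.mono_neutral_right) auto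
  then show ?thesis by simp
qed

text \<open>
The edge \<open>M = p \<rightarrow> q\<close> is chosen with \<open>q\<close> of maximal height, and among these with \<open>p\<close> of maximal height. Unless it is the edge from
\<open>0\<close> to \<open>\<infinity>\<close>, the jump at \<open>q\<close> forces the edge \<open>N\<close> from the other parent to occur, so that \<open>p\<close> is the higher parent
(fact \<open>shorter\<close>). At \<open>p\<close>, edges that end there contribute multiples of \<open>N\<^sub>p\<close>, and edges that start there end at \<open>q\<close> or at
one other point \<open>y\<close>. The pairing with \<open>p\<close> and \<open>y\<close> leaves only the coefficient of \<open>M\<close>.
\<close>

lemma hyperfan_coefficients_vanish:
  assumes "finite K" "K \<subseteq> O_set" "X \<in> sl2" "(\<Sum>A\<in>K. c A *\<^sub>R psi A) = const_pp X" "A \<in> K"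
  shows "c A = 0"
proof (rule ccontr)
  assume "c A \<noteq> 0"
  define K' where "K' = {A \<in> K. c A \<noteq> 0}"
  have K': "finite K'" "K' \<noteq> {}" "K' \<subseteq> O_set"
    using assms \<open>c A \<noteq> 0\<close> by (auto simp: K'_def)
  have "(\<Sum>A\<in>K'. c A *\<^sub>R psi A) = const_pp X"
    unfolding assms(4)[symmetric] using assms(1) by (intro sum.mono_neutral_left) (auto simp: K'_def)
  note vanish = pairing_jumps_vanish[OF assms(3) this]
  obtain M where M: "M \<in> K'" "\<And>B. B \<in> K' \<Longrightarrow> term_height B \<le> term_height M"
    "\<And>B. B \<in> K' \<Longrightarrow> term_height B = term_height M \<Longrightarrow> init_height B \<le> init_height M"
    using finite_lexicographic_max[OF K'(1,2), of term_height init_height] by blast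
  obtain p1 p2 q1 q2 where det: "p1 * q2 - p2 * q1 = 1" and M_psl: "M = psl p1 p2 q1 q2"
    by (rule psl_cases)
  have det1: "\<bar>p1 * q2 - p2 * q1\<bar> = 1" using det by simp
  have less: "height p1 p2 < height q1 q2"
    using M(1) K'(3) O_set_iff_height[OF det] by (auto simp: M_psl)
  have th_M: "term_height M = height q1 q2" and ih_M: "init_height M = height p1 p2"
    using det by (simp_all add: M_psl term_height_psl init_height_psl)
  have pos: "0 < height p1 p2" "0 < height q1 q2"
    using det by (auto intro!: height_pos)
  have max: "height y1 y2 \<le> height q1 q2" if "psl x1 x2 y1 y2 \<in> K'" "x1 * y2 - x2 * y1 = 1" for x1 x2 y1 y2
    using M(2)[OF that(1)] that(2) by (simp add: th_M term_height_psl)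
  have ordered: "height x1 x2 < height y1 y2" if "psl x1 x2 y1 y2 \<in> K'" "x1 * y2 - x2 * y1 = 1" for x1 x2 y1 y2
    using that K'(3) O_set_iff_height by blast
  have init_rows: thesis
    if B: "B \<in> K'" and init: "e_init B = pt p1 p2"
      and use: "\<And>k. B = psl p1 p2 (q1 + k * p1) (q2 + k * p2) \<Longrightarrow>
        height p1 p2 < height (q1 + k * p1) (q2 + k * p2) \<Longrightarrow>
        height (q1 + k * p1) (q2 + k * p2) \<le> height q1 q2 \<Longrightarrow> thesis" for B thesis
  proof -
    obtain k where k: "B = psl p1 p2 (q1 + k * p1) (q2 + k * p2)"
      using e_init_eqD[OF det init] .
    from use[OF k ordered max] B[unfolded k] det_shift_row2[OF det, of k] show thesis by blast
  qed
  have shorter: "height (q1 - e * p1) (q2 - e * p2) < height p1 p2"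
    if e: "e = 1 \<or> e = -1" "\<bar>q1\<bar> = \<bar>p1\<bar> + \<bar>q1 - e * p1\<bar>" "\<bar>q2\<bar> = \<bar>p2\<bar> + \<bar>q2 - e * p2\<bar>" for e
  proof -
    define N where "N = psl (p1 - e * q1) (p2 - e * q2) q1 q2"
    have det_N: "(p1 - e * q1) * q2 - (p2 - e * q2) * q1 = 1"
      using det by (simp add: algebra_simps)
    have eh: "height (p1 - e * q1) (p2 - e * q2) = height (q1 - e * p1) (q2 - e * p2)"
      using e(1) by (auto simp: height_def abs_minus_commute add.commute)
    have "N \<in> K'"
    proof (rule ccontr)
      assume "N \<notin> K'"
      let ?f = "\<lambda>B. c B * (of_bool (e_term B = pt q1 q2) - of_bool (e_init B = pt q1 q2)) *
        pairing p1 p2 p1 p2 (psl_conj B mat_e)"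
      have no_init: "e_init B \<noteq> pt q1 q2" if B: "B \<in> K'" for B
      proof
        assume "e_init B = pt q1 q2"
        have det': "q1 * (- p2) - q2 * (- p1) = 1" using det by (simp add: algebra_simps)
        obtain k where k: "B = psl q1 q2 (- p1 + k * q1) (- p2 + k * q2)"
          using e_init_eqD[OF det' \<open>e_init B = pt q1 q2\<close>] .
        from B[unfolded k] show False
          using ordered max det_shift_row2[OF det', of k] by fastforce
      qed
      have "?f B = 0" if B: "B \<in> K'" "B \<noteq> M" for B
      proof -
        have "e_term B \<noteq> pt q1 q2"
        proof
          assume "e_term B = pt q1 q2"
          then obtain k where k: "B = psl (p1 + k * q1) (p2 + k * q2) q1 q2"
            using e_term_eqD[OF det] by blast
          have "height (p1 + k * q1) (p2 + k * q2) < height q1 q2"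
            using B(1)[unfolded k] ordered det_shift_row1[OF det, of k] by blast
          moreover have "k \<noteq> 0" using B(2) by (auto simp: k M_psl)
          moreover have "k \<noteq> - e" using B(1) \<open>N \<notin> K'\<close> by (auto simp: k N_def)
          moreover have "height (k * q1) (k * q2) \<le>
              height (p1 + k * q1) (p2 + k * q2) + height (- p1) (- p2)"
            using height_triangle[of "p1 + k * q1" "- p1" "p2 + k * q2" "- p2"] by simp
          ultimately have "\<bar>k\<bar> * height q1 q2 < 2 * height q1 q2"
            using less unfolding height_mult height_uminus by linarith
          then have "\<bar>k\<bar> < 2" using pos(2) by (simp add: mult_less_cancel_right_pos)
          with \<open>k \<noteq> 0\<close> \<open>k \<noteq> - e\<close> e(1) have "k = e" by auto
          have grow: "\<bar>y\<bar> \<le> \<bar>x + e * y\<bar>" if "\<bar>y\<bar> = \<bar>x\<bar> + \<bar>y - e * x\<bar>" for x y :: int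
            using that e(1) by auto
          have "height q1 q2 \<le> height (p1 + k * q1) (p2 + k * q2)"
            using grow[OF e(2)] grow[OF e(3)] by (simp add: \<open>k = e\<close> height_def)
          then show False using \<open>height (p1 + k * q1) (p2 + k * q2) < height q1 q2\<close> by simp
        qed
        then show ?thesis using no_init[OF B(1)] by simp
      qed
      then have "?f M = 0"
        using sum_single_term[OF K'(1) M(1), of ?f] vanish[of "pt q1 q2" p1 p2 p1 p2] by simp
      moreover have "(q1 * p2 - q2 * p1) * (q1 * p2 - q2 * p1) = 1"
      proof -
        have "q1 * p2 - q2 * p1 = -1" using det by (simp add: algebra_simps)
        then show ?thesis by simp
      qed
      ultimately have "c M = 0"
        using no_init[OF M(1)]
        by (simp only: M_psl e_term_psl[OF det] conj_e_psl[OF det] pairing_nilp) simp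
      then show False using M(1) by (simp add: K'_def)
    qed
    then have "init_height N \<le> init_height M"
      using M(3)[of N] det_N th_M by (simp add: N_def term_height_psl)
    then have "height (q1 - e * p1) (q2 - e * p2) \<le> height p1 p2"
      using det_N eh ih_M by (simp add: N_def init_height_psl)
    moreover have "height p1 p2 \<noteq> height (q1 - e * p1) (q2 - e * p2)"
      by (rule height_neq) (use det in \<open>simp add: algebra_simps\<close>)
    ultimately show ?thesis by simp
  qed
  have unique: "\<exists>k0. \<forall>k. k \<noteq> 0 \<longrightarrow> height p1 p2 < height (q1 + k * p1) (q2 + k * p2) \<longrightarrow>
      height (q1 + k * p1) (q2 + k * p2) \<le> height q1 q2 \<longrightarrow> k = k0 \<and> k0 \<noteq> 0"
    using det1 less
  proof (cases rule: farey_child)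
    case 1
    then have "\<bar>p1\<bar> * \<bar>q2\<bar> = 1" using det1 by (simp add: abs_mult)
    from abs_mult_eq_one[OF this] have "\<bar>p1\<bar> = 1" "\<bar>q2\<bar> = 1" .
    then show ?thesis using 1 by (simp add: height_def abs_mult)
  next
    case (2 e)
    let ?k0 = "e * (if p1 = 0 then -2 else -3)"
    have "?k0 \<noteq> 0" using 2(1) by auto
    with unique_other_child[OF det1 2 shorter[OF 2]] show ?thesis
      by (intro exI[of _ ?k0]) simp
  qed
  obtain y1 y2 where y: "q1 * y2 - q2 * y1 \<noteq> 0"
    "\<And>k. k \<noteq> 0 \<Longrightarrow> height p1 p2 < height (q1 + k * p1) (q2 + k * p2) \<Longrightarrow>
      height (q1 + k * p1) (q2 + k * p2) \<le> height q1 q2 \<Longrightarrow> y1 = q1 + k * p1 \<and> y2 = q2 + k * p2"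
  proof -
    obtain k0 where k0: "\<And>k. k \<noteq> 0 \<Longrightarrow> height p1 p2 < height (q1 + k * p1) (q2 + k * p2) \<Longrightarrow>
      height (q1 + k * p1) (q2 + k * p2) \<le> height q1 q2 \<Longrightarrow> k = k0 \<and> k0 \<noteq> 0"
      using unique by blast
    \<comment> \<open>If no other child exists, any row that is not proportional to \<open>q\<close> will do.\<close>
    define k where "k = (if k0 = 0 then 1 else k0)"
    have "q1 * (q2 + k * p2) - q2 * (q1 + k * p1) = - k * (p1 * q2 - p2 * q1)"
      by (simp add: algebra_simps)
    then have "q1 * (q2 + k * p2) - q2 * (q1 + k * p1) \<noteq> 0"
      using det by (simp add: k_def)
    then show ?thesis
      using that[of "q2 + k * p2" "q1 + k * p1"] k0 by (auto simp: k_def)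
  qed
  let ?g = "\<lambda>B. c B * (of_bool (e_term B = pt p1 p2) - of_bool (e_init B = pt p1 p2)) *
    pairing p1 p2 y1 y2 (psl_conj B mat_e)"
  have term_p: "pairing p1 p2 y1 y2 (psl_conj B mat_e) = 0" if B: "e_term B = pt p1 p2" for B
  proof -
    have det': "(- q1) * p2 - (- q2) * p1 = 1" using det by (simp add: algebra_simps)
    obtain k where "B = psl (- q1 + k * p1) (- q2 + k * p2) p1 p2"
      using e_term_eqD[OF det' B] .
    then show ?thesis
      using conj_e_psl[OF det_shift_row1[OF det', of k]] by (simp add: pairing_nilp)
  qed
  have "?g B = 0" if B: "B \<in> K'" "B \<noteq> M" for B
  proof (cases "e_init B = pt p1 p2 \<and> e_term B \<noteq> pt p1 p2")
    case True
    then have "e_init B = pt p1 p2" by simp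
    with B(1) show ?thesis
    proof (rule init_rows)
      fix k assume k: "B = psl p1 p2 (q1 + k * p1) (q2 + k * p2)"
        "height p1 p2 < height (q1 + k * p1) (q2 + k * p2)"
        "height (q1 + k * p1) (q2 + k * p2) \<le> height q1 q2"
      then have "k \<noteq> 0" using B(2) by (auto simp: M_psl)
      then have "y1 = q1 + k * p1" "y2 = q2 + k * p2" using y(2) k by blast+
      then have "pairing p1 p2 y1 y2 (psl_conj B mat_e) = 0"
        using conj_e_psl[OF det_shift_row2[OF det, of k]] by (simp add: k(1) pairing_nilp)
      then show "?g B = 0" by simp
    qed
  next
    case False
    then show ?thesis using term_p[of B] by auto
  qed
  then have "?g M = 0"
    using sum_single_term[OF K'(1) M(1), of ?g] vanish[of "pt p1 p2" p1 p2 y1 y2] by simp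
  moreover have "pairing p1 p2 y1 y2 (psl_conj M mat_e) \<noteq> 0"
  proof -
    have "q1 * p2 - q2 * p1 = -1" using det by (simp add: algebra_simps)
    then have "(q1 * p2 - q2 * p1) * (q1 * y2 - q2 * y1) \<noteq> 0" using y(1) by simp
    then show ?thesis unfolding M_psl conj_e_psl[OF det] pairing_nilp by (simp only: of_int_eq_0_iff not_False_eq_True)
  qed
  moreover have "e_term M \<noteq> pt p1 p2" using term_p calculation(2) by blast
  moreover have "e_init M = pt p1 p2" by (simp add: M_psl e_init_psl[OF det])
  ultimately have "c M = 0" by simp
  then show False using M(1) by (simp add: K'_def)
qed

section \<open>The relations and the basis\<close>

lemma const_pp_basis_comb:
  "u *\<^sub>R const_pp mat_h + v *\<^sub>R const_pp mat_e + w *\<^sub>R const_pp mat_f = const_pp (mat2 u v w (- u))"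
proof -
  have "mat2 u v w (- u) = u *\<^sub>R mat_h + v *\<^sub>R mat_e + w *\<^sub>R mat_f"
    by (simp add: matrix2_eq_iff mat_h_def mat_e_def mat_f_def)
  then show ?thesis by (simp only: const_pp_add const_pp_scaleR sl2_add sl2_scaleR sl2_mats)
qed

text \<open>
The same fact for formal combinations: no nonzero combination over \<open>O_set\<close> is constant.
\<close>

lemma O_comb_constant:
  assumes "r \<in> span (gen ` O_set)" "X \<in> sl2" "hyperfan_comb r = const_pp X"
  shows "r = 0"
proof -
  have "span (gen ` O_set) \<subseteq> {r. \<forall>A. A \<notin> O_set \<longrightarrow> Poly_Mapping.lookup r A = 0}"
  proof (rule span_minimal)
    show "subspace {r. \<forall>A. A \<notin> O_set \<longrightarrow> Poly_Mapping.lookup r A = (0::real)}"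
      by (simp add: subspace_def lookup_add lookup_scaleR)
  qed (auto simp: gen_def lookup_single when_def)
  then have "Poly_Mapping.lookup r A = 0" if "A \<notin> O_set" for A using assms(1) that by blast
  then have "Poly_Mapping.keys r \<subseteq> O_set" by (auto simp: in_keys_iff)
  then have "Poly_Mapping.lookup r A = 0" if "A \<in> Poly_Mapping.keys r" for A
    using hyperfan_coefficients_vanish[of "Poly_Mapping.keys r" X "Poly_Mapping.lookup r" A]
      assms(2,3) that by (simp add: hyperfan_comb_def)
  then have "Poly_Mapping.lookup r A = 0" for A by (cases "A \<in> Poly_Mapping.keys r") (auto simp: in_keys_iff)
  then show ?thesis by (intro poly_mapping_eqI) simp
qed

lemma O_decomposition:
  obtains s u v w t where "s \<in> span (gen ` O_set)" "t \<in> span usa_relations"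
    "r = s + (u *\<^sub>R h_gen + v *\<^sub>R e_gen + w *\<^sub>R f_gen) + t"
proof -
  have "r \<in> span ((gen ` O_set \<union> {h_gen, e_gen, f_gen}) \<union> usa_relations)"
    using O_reducible_UNIV by (simp add: O_reducible_def)
  then obtain s t x where "s \<in> span (gen ` O_set)" "x \<in> span {h_gen, e_gen, f_gen}"
    "t \<in> span usa_relations" "r = s + x + t"
    unfolding span_Un by blast
  moreover from this(2) obtain u v w where "x - u *\<^sub>R h_gen - v *\<^sub>R e_gen - w *\<^sub>R f_gen = 0"
    by (auto simp: span_breakdown_eq)
  then have "x = u *\<^sub>R h_gen + v *\<^sub>R e_gen + w *\<^sub>R f_gen" by (simp add: algebra_simps)
  ultimately show ?thesis using that by blast
qed

lemma hyperfan_comb_decomposition: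
  assumes "t \<in> span usa_relations"
  shows "hyperfan_comb (s + (u *\<^sub>R h_gen + v *\<^sub>R e_gen + w *\<^sub>R f_gen) + t) =
    hyperfan_comb s + const_pp (mat2 u v w (- u))"
proof -
  interpret linear hyperfan_comb by (rule linear_hyperfan_comb)
  show ?thesis
    by (simp only: add scale hyperfan_comb_constants hyperfan_comb_usa_relations[OF assms]
      const_pp_basis_comb add_0_right)
qed

theorem theorem5p2:
  shows "span (range psi) = UNIV
    \<and> (\<forall>a b c d :: int. a * d - b * c = 1 \<longrightarrow>
        Psi psi (psl a b c d) = usa_rhs (const_pp mat_h) (const_pp mat_e) (const_pp mat_f) a b c d)
    \<and> {r. hyperfan_comb r = 0} = span usa_relations
    \<and> (inj_on psi O_set \<and> independent (psi ` O_set)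
       \<and> span (psi ` O_set) \<inter> const_pp ` sl2 = {0}
       \<and> (\<forall>F. \<exists>G\<in>span (psi ` O_set). \<exists>X\<in>sl2. F = G + const_pp X))"
proof -
  interpret linear hyperfan_comb by (rule linear_hyperfan_comb)
  have image: "hyperfan_comb ` span (gen ` O_set) = span (psi ` O_set)"
    using linear_span_image[OF linear_hyperfan_comb, of "gen ` O_set"]
    by (simp add: image_image hyperfan_comb_gen)
  have sl2: "mat2 u v w (- u) \<in> sl2" for u v w by (simp add: sl2_iff)
  have kernel: "r \<in> span usa_relations" if "hyperfan_comb r = 0" for r
  proof -
    obtain s u v w t where d: "s \<in> span (gen ` O_set)" "t \<in> span usa_relations"
      "r = s + (u *\<^sub>R h_gen + v *\<^sub>R e_gen + w *\<^sub>R f_gen) + t"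
      by (rule O_decomposition)
    then have eq: "hyperfan_comb s + const_pp (mat2 u v w (- u)) = 0"
      using hyperfan_comb_decomposition that by simp
    have "hyperfan_comb s = const_pp (- mat2 u v w (- u))"
      using eq const_pp_scaleR[OF sl2, of "-1"] by (simp add: add_eq_0_iff2)
    moreover have "- mat2 u v w (- u) \<in> sl2" by (simp add: sl2_iff)
    ultimately have s: "s = 0" using O_comb_constant[OF d(1)] by blast
    then have "const_pp (mat2 u v w (- u)) = const_pp 0"
      using eq zero const_pp_scaleR[of 0 0] by simp
    then have "mat2 u v w (- u) = 0" using const_pp_eq_iff sl2 sl2_mats(4) by blast
    then have "u = 0" "v = 0" "w = 0" by (simp_all add: matrix2_eq_iff)
    then show ?thesis using d s by simp
  qed
  have const_zero: "const_pp 0 = 0" using const_pp_scaleR[of 0 0] by simp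
  have inj: "inj_on psi O_set"
  proof (rule inj_onI, rule ccontr)
    fix A B assume AB: "A \<in> O_set" "B \<in> O_set" "psi A = psi B" "A \<noteq> B"
    then have "(\<Sum>C\<in>{A, B}. (if C = A then 1 else -1) *\<^sub>R psi C) = const_pp 0"
      by (simp add: const_zero)
    from hyperfan_coefficients_vanish[OF _ _ _ this, of A] AB show False by simp
  qed
  have "independent (psi ` O_set)"
  proof
    assume "dependent (psi ` O_set)"
    then obtain T u where T: "finite T" "T \<subseteq> psi ` O_set" "(\<Sum>F\<in>T. u F *\<^sub>R F) = 0" "\<exists>F\<in>T. u F \<noteq> 0"
      unfolding dependent_explicit by blast
    obtain K where K: "K \<subseteq> O_set" "finite K" "T = psi ` K"
      using finite_subset_image[OF T(1,2)] by blast
    have "inj_on psi K" using inj K(1) by (rule inj_on_subset)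
    then have "(\<Sum>A\<in>K. u (psi A) *\<^sub>R psi A) = const_pp 0"
      using T(3) by (simp add: K(3) sum.reindex const_zero)
    from hyperfan_coefficients_vanish[OF K(2,1) _ this] have "u (psi A) = 0" if "A \<in> K" for A
      using that by simp
    then show False using T(4) K(3) by blast
  qed
  moreover have "span (psi ` O_set) \<inter> const_pp ` sl2 = {0}"
  proof
    show "span (psi ` O_set) \<inter> const_pp ` sl2 \<subseteq> {0}"
    proof
      fix F assume "F \<in> span (psi ` O_set) \<inter> const_pp ` sl2"
      then obtain r X where "r \<in> span (gen ` O_set)" "F = hyperfan_comb r" "X \<in> sl2" "F = const_pp X"
        unfolding image[symmetric] by blast
      then show "F \<in> {0}" using O_comb_constant[of r X] zero by simp
    qed
    have "0 \<in> const_pp ` sl2" using const_zero by (metis image_eqI sl2_mats(4))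
    then show "{0} \<subseteq> span (psi ` O_set) \<inter> const_pp ` sl2" by (simp add: span_zero)
  qed
  moreover have "\<exists>G\<in>span (psi ` O_set). \<exists>X\<in>sl2. F = G + const_pp X" for F
  proof -
    have "hyperfan_comb ` span (range gen) = span (range psi)"
      using linear_span_image[OF linear_hyperfan_comb, of "range gen"]
      by (simp add: image_image hyperfan_comb_gen)
    then obtain r where F: "F = hyperfan_comb r" using span_hyperfans by blast
    obtain s u v w t where d: "s \<in> span (gen ` O_set)" "t \<in> span usa_relations"
      "r = s + (u *\<^sub>R h_gen + v *\<^sub>R e_gen + w *\<^sub>R f_gen) + t"
      by (rule O_decomposition)
    then have "F = hyperfan_comb s + const_pp (mat2 u v w (- u))"
      using hyperfan_comb_decomposition F by simp
    then show ?thesis using d(1) sl2 image by blast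
  qed
  ultimately show ?thesis
    using span_hyperfans usa_identity kernel hyperfan_comb_usa_relations inj
    by (intro conjI allI impI equalityI subsetI) auto
qed

end
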